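(* Let $I,J$ be admissible subsets of $\{1,\dots,n-1\}$, let $\eta^*$ be a composition with $\eta^*_i\ge\eta^*_{i+1}$ for all $i\in I$ and $\eta^*_j>\eta^*_{j+1}$ for all $j\in J$, and let $\eta\in W_{I\cup J}(\eta^* )$. Then the constant $a^{(I,J)}_\eta$ defined by $O_{I,J}E_\eta(z;q,t)=a^{(I,J)}_\eta S^{(I,J)}_{\eta^*}(z;q,t)$ is $$a^{(I,J)}_\eta=(-1)^{l(\omega_J)}\,M_{I,\eta}\,\frac{d'_\eta\; d'_{\eta^{(-,+)}}\; d_{\eta^{(-,+)}}}{d'_{\eta^{(0,+)}}\; d_{\eta^{(0,+)}}\; d'_{\eta^{(-,-)}}},$$ where $\omega_J\in W_J$ is such that $\omega_J\,\eta^{(+,+)}=\eta^{(+,0)}$.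
   Context: Let $n\ge1$, let $q,t$ be indeterminates and $z=(z_1,\dots,z_n)$. The transposition $s_i$ ($1\le i\le n-1$) acts on functions by exchanging $z_i,z_{i+1}$ and on compositions by exchanging the $i$-th and $(i+1)$-st entries (the symmetric group $S_n$ acts on compositions accordingly). Put $$T_i:=t+\frac{tz_i-z_{i+1}}{z_i-z_{i+1}}(s_i-1),\qquad (\omega_0 f)(z_1,\dots,z_n):=f(qz_n,z_1,\dots,z_{n-1}),$$ $$Y_i:=t^{-n+i}\,T_i\cdots T_{n-1}\,\omega_0\,T_1^{-1}\cdots T_{i-1}^{-1}\qquad(1\le i\le n).$$ A composition is $\eta=(\eta_1,\dots,\eta_n)\in\mathbb Z_{\ge0}^n$; $|\eta|=\sum\eta_i$; $\eta^+$ is the partition obtained by permuting the entries of $\eta$; $l'_\eta(i):=\#\{j<i:\eta_j\ge\eta_i\}+\#\{j>i:\eta_j>\eta_i\}$ and $\overline\eta_i:=q^{\eta_i}t^{-l'_\eta(i)}$. For compositions of equal modulus, $\mu<\eta$ iff $\mu\ne\eta$ and $\sum_{i=1}^p(\eta_i-\mu_i)\ge0$ for all $1\le p\le n$; and $\mu\prec\eta$ iff $\mu^+<\eta^+$, or $\mu^+=\eta^+$ and $\mu<\eta$. The nonsymmetric Macdonald polynomial $E_\eta=E_\eta(z;q,t)$ is the unique polynomial with coefficients in $\mathbb Q(q,t)$ of the form $E_\eta=z^\eta+\sum_{\nu\prec\eta}b_{\eta\nu}z^\nu$ with $Y_iE_\eta=\overline\eta_iE_\eta$ for all $i$. Let $\mathrm{diag}(\eta)=\{(i,j):1\le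 i\le n,\ 1\le j\le\eta_i\}$. For $s=(i,j)\in\mathrm{diag}(\eta)$ let $a_\eta(s):=\eta_i-j$ and $l_\eta(s):=\#\{k<i:\ j\le\eta_k+1\le\eta_i\}+\#\{k>i:\ j\le\eta_k\le\eta_i\}$. Put $$d_\eta:=\prod_{s\in\mathrm{diag}(\eta)}(1-q^{a_\eta(s)+1}t^{l_\eta(s)+1}),\qquad d'_\eta:=\prod_{s\in\mathrm{diag}(\eta)}(1-q^{a_\eta(s)+1}t^{l_\eta(s)}).$$ Subsets $I,J\subseteq\{1,\dots,n-1\}$ are admissible if they are disjoint, $i\pm1\notin J$ for $i\in I$, and $j\pm1\notin I$ for $j\in J$. Let $W_I,W_J,W_{I\cup J}\subseteq S_n$ be the subgroups generated by the $s_k$ with $k\in I$, $k\in J$, $k\in I\cup J$; every $\omega\in W_{I\cup J}$ is uniquely $\omega=\omega_I\omega_J$ with $\omega_I\in W_I$, $\omega_J\in W_J$. $l(\cdot)$ is the length function on $S_n$; for a reduced word $\sigma=s_{i_l}\cdots s_{i_1}$ put $T_\sigma:=T_{i_l}\cdots T_{i_1}$. Let $$O_{I,J}:=\sum_{\omega\in W_{I\cup J}}\left(-\tfrac1t\right)^{l(\omega_J)}T_\omega .$$ For $\eta^*$ with $\eta^*_i\ge\eta^*_{i+1}$ ($i\in I$) and $\eta^*_j>\eta^*_{j+1}$ ($j\in J$), the Macdonald polynomial with prescribed symmetry $S^{(I,J)}_{\eta^*}(z;q,t)$ is the polynomial with coefficient of $z^{\eta^*}$ equal to $1$ such that, for every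 $\eta\in W_{I\cup J}(\eta^* )$, $O_{I,J}E_\eta=a^{(I,J)}_\eta S^{(I,J)}_{\eta^*}$ for some nonzero $a^{(I,J)}_\eta\in\mathbb Q(q,t)$. For $\eta\in W_{I\cup J}(\eta^* )$ and $\epsilon_I,\epsilon_J\in\{+,0,-\}$, $\eta^{(\epsilon_I,\epsilon_J)}$ denotes the element of $W_{I\cup J}(\eta)$ obtained as follows. The entries in the positions moved by $W_I$ are rearranged (by an element of $W_I$) to be weakly decreasing along $I$ (i.e. $i$-th entry $\ge$ $(i+1)$-st entry for all $i\in I$) if $\epsilon_I=+$, weakly increasing along $I$ if $\epsilon_I=-$, and are left unchanged if $\epsilon_I=0$. The entries in the positions moved by $W_J$ are rearranged (by an element of $W_J$) to be strictly decreasing along $J$ if $\epsilon_J=+$, strictly increasing along $J$ if $\epsilon_J=-$, and are left unchanged if $\epsilon_J=0$. Finally $$M_{I,\eta}:=\sum_{\sigma'\in W_I,\ \sigma'(\eta)=\eta^{(+,0)}}t^{\,l(\sigma')}.$$ *)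

theory Defs
  imports
    "HOL-Library.Poly_Mapping"
    "HOL-Computational_Algebra.Polynomial"
    "HOL-Computational_Algebra.Fraction_Field"
    "HOL-Algebra.Generated_Groups"
    "HOL-Algebra.Sym_Groups"
begin

section \<open>Coefficients, compositions, polynomials\<close>

text \<open>The field of rational functions over the rationals in two indeterminates:
  \<open>q\<close> is the inner and \<open>t\<close> the outer polynomial variable.\<close>

type_synonym qt = "rat poly poly fract"

definition q :: qt where "q = Fract [:[:0, 1:]:] 1"

definition t :: qt where "t = Fract [:0, 1:] 1"

text \<open>A composition with \<open>n\<close> entries is an exponent vector supported in \<open>{1..n}\<close>;
  it doubles as the monomial exponent of \<open>z\<^sup>\<eta>\<close>.\<close>

type_synonym exponent = "nat \<Rightarrow>\<^sub>0 nat"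

type_synonym zpoly = "exponent \<Rightarrow>\<^sub>0 qt"

abbreviation entry :: "exponent \<Rightarrow> nat \<Rightarrow> nat" where
  "entry \<equiv> Poly_Mapping.lookup"

abbreviation zcoeff :: "zpoly \<Rightarrow> exponent \<Rightarrow> qt" where
  "zcoeff \<equiv> Poly_Mapping.lookup"

definition is_composition :: "nat \<Rightarrow> exponent \<Rightarrow> bool" where
  "is_composition n \<eta> \<longleftrightarrow> Poly_Mapping.keys \<eta> \<subseteq> {1..n}"

definition modulus :: "nat \<Rightarrow> exponent \<Rightarrow> nat" where
  "modulus n \<eta> = (\<Sum>i=1..n. entry \<eta> i)"

definition Const :: "qt \<Rightarrow> zpoly" where
  "Const c = Poly_Mapping.single 0 c"

definition Z :: "nat \<Rightarrow> zpoly" where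
  "Z i = Poly_Mapping.single (Poly_Mapping.single i 1) 1"

text \<open>Substitution of the polynomial \<open>g i\<close> for the variable \<open>z\<^sub>i\<close>.\<close>

definition subst_vars :: "(nat \<Rightarrow> zpoly) \<Rightarrow> zpoly \<Rightarrow> zpoly" where
  "subst_vars g f =
     (\<Sum>\<nu>\<in>Poly_Mapping.keys f.
        Const (zcoeff f \<nu>) * (\<Prod>i\<in>Poly_Mapping.keys \<nu>. g i ^ entry \<nu> i))"


section \<open>The symmetric group\<close>

definition adj :: "nat \<Rightarrow> nat \<Rightarrow> nat" where
  "adj i = transpose i (i + 1)"

definition parabolic :: "nat \<Rightarrow> nat set \<Rightarrow> (nat \<Rightarrow> nat) set" where
  "parabolic n K = generate (sym_group n) (adj ` K)"

text \<open>The left action on compositions: the \<open>i\<close>-th entry of \<open>\<sigma>(\<eta>)\<close> is the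
  \<open>\<sigma>\<^sup>-\<^sup>1(i)\<close>-th entry of \<open>\<eta>\<close>, so that \<open>adj i\<close> exchanges the entries \<open>i\<close> and \<open>i + 1\<close>.\<close>

definition act :: "(nat \<Rightarrow> nat) \<Rightarrow> exponent \<Rightarrow> exponent" where
  "act \<sigma> \<eta> = Poly_Mapping.map_key (inv' \<sigma>) \<eta>"

definition par_orbit :: "nat \<Rightarrow> nat set \<Rightarrow> exponent \<Rightarrow> exponent set" where
  "par_orbit n K \<eta> = (\<lambda>\<sigma>. act \<sigma> \<eta>) ` parabolic n K"

text \<open>The word \<open>[k\<^sub>1, \<dots>, k\<^sub>m]\<close> stands for the product of the \<open>adj k\<^sub>j\<close> in this order.\<close>

definition word_perm :: "nat list \<Rightarrow> nat \<Rightarrow> nat" where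
  "word_perm ks = foldr (\<lambda>k \<sigma>. adj k \<circ> \<sigma>) ks id"

definition is_word :: "nat \<Rightarrow> (nat \<Rightarrow> nat) \<Rightarrow> nat list \<Rightarrow> bool" where
  "is_word n \<sigma> ks \<longleftrightarrow> set ks \<subseteq> {1..<n} \<and> word_perm ks = \<sigma>"

definition perm_length :: "nat \<Rightarrow> (nat \<Rightarrow> nat) \<Rightarrow> nat" where
  "perm_length n \<sigma> = (LEAST m. \<exists>ks. is_word n \<sigma> ks \<and> length ks = m)"

definition is_reduced_word :: "nat \<Rightarrow> (nat \<Rightarrow> nat) \<Rightarrow> nat list \<Rightarrow> bool" where
  "is_reduced_word n \<sigma> ks \<longleftrightarrow> is_word n \<sigma> ks \<and> length ks = perm_length n \<sigma>"


section \<open>Demazure-Lusztig and Cherednik operators\<close>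

definition swap_vars :: "nat \<Rightarrow> zpoly \<Rightarrow> zpoly" where
  "swap_vars i = subst_vars (\<lambda>j. Z (adj i j))"

text \<open>The exact quotient of \<open>s\<^sub>i f - f\<close> by \<open>z\<^sub>i - z\<^sub>i\<^sub>+\<^sub>1\<close>; it exists because the numerator
  vanishes for \<open>z\<^sub>i = z\<^sub>i\<^sub>+\<^sub>1\<close>, and is unique because \<^typ>\<open>zpoly\<close> is an integral domain.\<close>

definition divided_diff :: "nat \<Rightarrow> zpoly \<Rightarrow> zpoly" where
  "divided_diff i f = (THE h. (Z i - Z (i + 1)) * h = swap_vars i f - f)"

definition T :: "nat \<Rightarrow> zpoly \<Rightarrow> zpoly" where
  "T i f = Const t * f + (Const t * Z i - Z (i + 1)) * divided_diff i f"

definition \<omega>\<^sub>0 :: "nat \<Rightarrow> zpoly \<Rightarrow> zpoly" where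
  "\<omega>\<^sub>0 n = subst_vars (\<lambda>i. if i = 1 then Const q * Z n else Z (i - 1))"

text \<open>The inverse of \<^term>\<open>T i\<close> may be taken as a map on all of \<^typ>\<open>zpoly\<close>: by the quadratic
  relation \<open>(T\<^sub>i - t)(T\<^sub>i + 1) = 0\<close> the operator is bijective, and its inverse preserves the
  polynomials in \<open>z\<^sub>1, \<dots>, z\<^sub>n\<close> whenever \<open>i < n\<close>.\<close>

definition Y :: "nat \<Rightarrow> nat \<Rightarrow> zpoly \<Rightarrow> zpoly" where
  "Y n i f = Const (t powi (int i - int n)) *
     foldr T [i..<n] (\<omega>\<^sub>0 n (foldr (\<lambda>j. inv' (T j)) [1..<i] f))"

text \<open>By the braid relations the choice of the reduced word does not matter.\<close>

definition T_perm :: "nat \<Rightarrow> (nat \<Rightarrow> nat) \<Rightarrow> zpoly \<Rightarrow> zpoly" where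
  "T_perm n \<sigma> = foldr T (SOME ks. is_reduced_word n \<sigma> ks)"


section \<open>Nonsymmetric Macdonald polynomials\<close>

definition sorted_comp :: "nat \<Rightarrow> exponent \<Rightarrow> exponent" where
  "sorted_comp n \<eta> = (THE \<mu>. (\<exists>\<sigma>. \<sigma> permutes {1..n} \<and> \<mu> = act \<sigma> \<eta>) \<and>
     (\<forall>i\<in>{1..<n}. entry \<mu> i \<ge> entry \<mu> (i + 1)))"

definition dom_less :: "nat \<Rightarrow> exponent \<Rightarrow> exponent \<Rightarrow> bool" where
  "dom_less n \<mu> \<eta> \<longleftrightarrow> modulus n \<mu> = modulus n \<eta> \<and> \<mu> \<noteq> \<eta> \<and>
     (\<forall>p\<in>{1..n}. (\<Sum>i=1..p. int (entry \<eta> i) - int (entry \<mu> i)) \<ge> 0)"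

definition comp_prec :: "nat \<Rightarrow> exponent \<Rightarrow> exponent \<Rightarrow> bool" where
  "comp_prec n \<mu> \<eta> \<longleftrightarrow> dom_less n (sorted_comp n \<mu>) (sorted_comp n \<eta>) \<or>
     sorted_comp n \<mu> = sorted_comp n \<eta> \<and> dom_less n \<mu> \<eta>"

definition coleg :: "nat \<Rightarrow> exponent \<Rightarrow> nat \<Rightarrow> nat" where
  "coleg n \<eta> i = card {j \<in> {1..n}. j < i \<and> entry \<eta> j \<ge> entry \<eta> i}
                 + card {j \<in> {1..n}. j > i \<and> entry \<eta> j > entry \<eta> i}"

definition eigval :: "nat \<Rightarrow> exponent \<Rightarrow> nat \<Rightarrow> qt" where
  "eigval n \<eta> i = q ^ entry \<eta> i * t powi (- int (coleg n \<eta> i))"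

definition is_nonsym_Macdonald :: "nat \<Rightarrow> exponent \<Rightarrow> zpoly \<Rightarrow> bool" where
  "is_nonsym_Macdonald n \<eta> f \<longleftrightarrow>
     zcoeff f \<eta> = 1 \<and>
     (\<forall>\<nu>\<in>Poly_Mapping.keys f. \<nu> = \<eta> \<or> is_composition n \<nu> \<and> comp_prec n \<nu> \<eta>) \<and>
     (\<forall>i\<in>{1..n}. Y n i f = Const (eigval n \<eta> i) * f)"

definition E :: "nat \<Rightarrow> exponent \<Rightarrow> zpoly" where
  "E n \<eta> = (THE f. is_nonsym_Macdonald n \<eta> f)"


section \<open>Arm and leg products\<close>

definition diagram :: "nat \<Rightarrow> exponent \<Rightarrow> (nat \<times> nat) set" where
  "diagram n \<eta> = (SIGMA i:{1..n}. {1..entry \<eta> i})"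

definition arm :: "exponent \<Rightarrow> nat \<times> nat \<Rightarrow> nat" where
  "arm \<eta> = (\<lambda>(i, j). entry \<eta> i - j)"

definition leg :: "nat \<Rightarrow> exponent \<Rightarrow> nat \<times> nat \<Rightarrow> nat" where
  "leg n \<eta> = (\<lambda>(i, j).
      card {k \<in> {1..n}. k < i \<and> j \<le> entry \<eta> k + 1 \<and> entry \<eta> k + 1 \<le> entry \<eta> i}
    + card {k \<in> {1..n}. k > i \<and> j \<le> entry \<eta> k \<and> entry \<eta> k \<le> entry \<eta> i})"

definition d :: "nat \<Rightarrow> exponent \<Rightarrow> qt" where
  "d n \<eta> = (\<Prod>s\<in>diagram n \<eta>. 1 - q ^ (arm \<eta> s + 1) * t ^ (leg n \<eta> s + 1))"

definition d' :: "nat \<Rightarrow> exponent \<Rightarrow> qt" where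
  "d' n \<eta> = (\<Prod>s\<in>diagram n \<eta>. 1 - q ^ (arm \<eta> s + 1) * t ^ leg n \<eta> s)"


section \<open>Prescribed symmetry\<close>

definition admissible :: "nat \<Rightarrow> nat set \<Rightarrow> nat set \<Rightarrow> bool" where
  "admissible n I J \<longleftrightarrow> I \<subseteq> {1..n - 1} \<and> J \<subseteq> {1..n - 1} \<and> I \<inter> J = {} \<and>
     (\<forall>i\<in>I. i + 1 \<notin> J \<and> i - 1 \<notin> J) \<and> (\<forall>j\<in>J. j + 1 \<notin> I \<and> j - 1 \<notin> I)"

text \<open>The factor \<open>\<omega>\<^sub>J\<close> of the decomposition \<open>\<omega> = \<omega>\<^sub>I \<omega>\<^sub>J\<close>.\<close>

definition J_part :: "nat \<Rightarrow> nat set \<Rightarrow> nat set \<Rightarrow> (nat \<Rightarrow> nat) \<Rightarrow> nat \<Rightarrow> nat" where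
  "J_part n I J \<omega> = (THE \<omega>J. \<omega>J \<in> parabolic n J \<and> (\<exists>\<omega>I\<in>parabolic n I. \<omega> = \<omega>I \<circ> \<omega>J))"

definition O_op :: "nat \<Rightarrow> nat set \<Rightarrow> nat set \<Rightarrow> zpoly \<Rightarrow> zpoly" where
  "O_op n I J f = (\<Sum>\<omega>\<in>parabolic n (I \<union> J).
     Const ((- 1 / t) ^ perm_length n (J_part n I J \<omega>)) * T_perm n \<omega> f)"

definition S_poly :: "nat \<Rightarrow> nat set \<Rightarrow> nat set \<Rightarrow> exponent \<Rightarrow> zpoly" where
  "S_poly n I J \<eta>s = (THE S. zcoeff S \<eta>s = 1 \<and>
     (\<forall>\<eta>\<in>par_orbit n (I \<union> J) \<eta>s. \<exists>a. a \<noteq> 0 \<and> O_op n I J (E n \<eta>) = Const a * S))"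

text \<open>The constant of proportionality \<open>a\<^sub>\<eta>\<close>; the composition \<open>\<eta>s\<close> is the starred one.\<close>

definition sym_const :: "nat \<Rightarrow> nat set \<Rightarrow> nat set \<Rightarrow> exponent \<Rightarrow> exponent \<Rightarrow> qt" where
  "sym_const n I J \<eta>s \<eta> = (THE a. O_op n I J (E n \<eta>) = Const a * S_poly n I J \<eta>s)"

datatype arrangement = Pl | Ze | Mi

primrec arrange_weak :: "nat \<Rightarrow> nat set \<Rightarrow> arrangement \<Rightarrow> exponent \<Rightarrow> exponent" where
  "arrange_weak n I Pl \<eta> =
     (THE \<mu>. \<mu> \<in> par_orbit n I \<eta> \<and> (\<forall>i\<in>I. entry \<mu> i \<ge> entry \<mu> (i + 1)))"
| "arrange_weak n I Ze \<eta> = \<eta>"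
| "arrange_weak n I Mi \<eta> =
     (THE \<mu>. \<mu> \<in> par_orbit n I \<eta> \<and> (\<forall>i\<in>I. entry \<mu> i \<le> entry \<mu> (i + 1)))"

primrec arrange_strict :: "nat \<Rightarrow> nat set \<Rightarrow> arrangement \<Rightarrow> exponent \<Rightarrow> exponent" where
  "arrange_strict n J Pl \<eta> =
     (THE \<mu>. \<mu> \<in> par_orbit n J \<eta> \<and> (\<forall>j\<in>J. entry \<mu> j > entry \<mu> (j + 1)))"
| "arrange_strict n J Ze \<eta> = \<eta>"
| "arrange_strict n J Mi \<eta> =
     (THE \<mu>. \<mu> \<in> par_orbit n J \<eta> \<and> (\<forall>j\<in>J. entry \<mu> j < entry \<mu> (j + 1)))"

text \<open>For admissible \<open>I\<close> and \<open>J\<close> the two groups move disjoint sets of positions, so the order of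
  the two rearrangements is immaterial.\<close>

definition arrange ::
    "nat \<Rightarrow> nat set \<Rightarrow> nat set \<Rightarrow> exponent \<Rightarrow> arrangement \<Rightarrow> arrangement \<Rightarrow> exponent" where
  "arrange n I J \<eta> \<epsilon>I \<epsilon>J = arrange_strict n J \<epsilon>J (arrange_weak n I \<epsilon>I \<eta>)"

definition M :: "nat \<Rightarrow> nat set \<Rightarrow> nat set \<Rightarrow> exponent \<Rightarrow> qt" where
  "M n I J \<eta> = (\<Sum>\<sigma> | \<sigma> \<in> parabolic n I \<and> act \<sigma> \<eta> = arrange n I J \<eta> Pl Ze. t ^ perm_length n \<sigma>)"

end

(* The intertwiners T_i + c (for eta_i < eta_{i+1}) and Phi = z_n omega_0 permute the joint
   eigenspaces of the Y_i. Starting from 1 they produce, for every composition, a joint eigenvector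
   that is triangular with respect to the Bruhat order of the affine symmetric group, which both
   intertwiners respect (the order of the definition is too coarse for this, but is implied).
   Since these vectors span and their eigenvalues are distinct, they are the E_eta, and T_i E_eta is
   an explicit combination of E_eta and E_{s_i eta}.

   The symmetrizer O satisfies O T_i = t O for i in I and O T_j = - O for j in J. Applied to
   T_i E_eta this makes all O E_eta in an orbit proportional, with ratios that are rational functions
   of the quotient of the i-th and (i+1)-st eigenvalues; d and d' change by such factors when two
   adjacent entries are exchanged, so both sides of the formula satisfy the same recursion.
   It remains to compare them at one point. At the increasing arrangement of eta* no monomial of
   E_eta other than the leading one contributes to the coefficient of z^eta* in O E_eta; this
   coefficient obeys the recursion of M_{I,eta} up to sign, and at eta* itself it is the sum of
   t^l(sigma) over the stabilizer of eta* in W_I. *)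

theory Submission
  imports Defs
begin

section \<open>Polynomials and substitutions\<close>

text \<open>Three of the six products in the formula, those at the arrangements (-,+) and (-,-), are
  constant on the orbit: they make the quotient equal to 1 at the increasing arrangement. The other
  three carry the recursion. Let x be the quotient of the i-th by the (i+1)-st eigenvalue of a
  composition whose i-th entry is the larger one. For i in I, \<open>d'\<close> at
  \<open>\<eta>\<close> and \<open>d'\<close> at its (0,+) arrangement change by the same factor and
  cancel, because sorting along J does not disturb the eigenvalues at positions outside J; what
  remains is (1 - t x)/(1 - x) from \<open>d\<close> and 1/t from \<open>M\<close>. For i in J the
  (0,+) arrangement stays put, so \<open>d'\<close> at \<open>\<eta>\<close> alone yields (1 -
  x/t)/(1 - x), and the sign comes from the permutation in W_J. Two inductions traverse the orbit in
  opposite directions. Coefficients of symmetrized monomials are followed from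
  \<open>\<eta>s\<close>, where reduced words only meet weakly decreasing pairs and the expansion of
  \<open>T\<close> is simplest. Symmetrized Macdonald polynomials are followed from the increasing
  arrangement, which is the minimum of the orbit for \<open>below\<close>, so that triangularity
  isolates one monomial there.\<close>

definition zmon :: "exponent \<Rightarrow> zpoly" where
  "zmon \<nu> = Poly_Mapping.single \<nu> 1"

lemma Const_0 [simp]: "Const 0 = 0"
  and Const_1 [simp]: "Const 1 = 1"
  by (simp_all add: Const_def)

lemma Const_add: "Const (a + b) = Const a + Const b"
  and Const_mult: "Const (a * b) = Const a * Const b"
  and Const_diff: "Const (a - b) = Const a - Const b"
  and Const_uminus: "Const (- a) = - Const a"
  by (simp_all add: Const_def single_add mult_single single_diff single_uminus)

lemma Const_power: "Const (a ^ k) = Const a ^ k"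
  by (induction k) (simp_all add: Const_mult)

lemma Const_eq_iff [simp]: "Const a = Const b \<longleftrightarrow> a = b"
  unfolding Const_def by (meson inj_single injD)

lemma Const_eq_0_iff [simp]: "Const a = 0 \<longleftrightarrow> a = 0"
  using Const_eq_iff[of a 0] by simp

lemma Const_inverse_mult: "a \<noteq> 0 \<Longrightarrow> Const (1 / a) * Const a = 1"
  by (simp flip: Const_mult)

lemma zcoeff_Const_mult [simp]: "zcoeff (Const c * f) \<nu> = c * zcoeff f \<nu>"
proof -
  have "Const c * f = Poly_Mapping.map ((*) c) f"
    by (simp add: mult_map_scale_conv_mult Const_def)
  then show ?thesis
    by (simp add: map.rep_eq when_def)
qed

lemma zcoeff_zmon: "zcoeff (zmon \<nu>) \<mu> = (if \<mu> = \<nu> then 1 else 0)"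
  by (simp add: zmon_def lookup_single when_def)

lemma keys_zmon [simp]: "Poly_Mapping.keys (zmon \<nu>) = {\<nu>}"
  by (simp add: zmon_def)

lemma keys_Const_mult: "Poly_Mapping.keys (Const c * f) \<subseteq> Poly_Mapping.keys f"
  by (auto simp: in_keys_iff)

lemma keys_sum_subset:
  fixes f :: "'a \<Rightarrow> zpoly"
  shows "Poly_Mapping.keys (sum f A) \<subseteq> (\<Union>x\<in>A. Poly_Mapping.keys (f x))"
proof
  fix \<nu> assume "\<nu> \<in> Poly_Mapping.keys (sum f A)"
  then have "(\<Sum>x\<in>A. zcoeff (f x) \<nu>) \<noteq> 0"
    by (simp add: in_keys_iff lookup_sum)
  then obtain x where "x \<in> A" "zcoeff (f x) \<nu> \<noteq> 0"
    by (metis (mono_tags, lifting) sum.neutral)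
  then show "\<nu> \<in> (\<Union>x\<in>A. Poly_Mapping.keys (f x))"
    by (auto simp: in_keys_iff)
qed

lemma zmon_mult: "zmon \<mu> * zmon \<nu> = zmon (\<mu> + \<nu>)"
  by (simp add: zmon_def mult_single)

lemma zmon_0: "zmon 0 = 1"
  by (simp add: zmon_def)

lemma Z_eq_zmon: "Z i = zmon (Poly_Mapping.single i 1)"
  by (simp add: Z_def zmon_def)

lemma zpoly_expansion:
  assumes "finite A" "Poly_Mapping.keys f \<subseteq> A"
  shows "f = (\<Sum>\<nu>\<in>A. Const (zcoeff f \<nu>) * zmon \<nu>)"
proof (rule poly_mapping_eqI)
  fix \<mu>
  have "zcoeff (\<Sum>\<nu>\<in>A. Const (zcoeff f \<nu>) * zmon \<nu>) \<mu> = (\<Sum>\<nu>\<in>A. if \<mu> = \<nu> then zcoeff f \<nu> else 0)"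
    by (simp add: lookup_sum zcoeff_zmon if_distrib cong: if_cong)
  also have "\<dots> = zcoeff f \<mu>"
    using assms by (auto simp: in_keys_iff subset_iff)
  finally show "zcoeff f \<mu> = zcoeff (\<Sum>\<nu>\<in>A. Const (zcoeff f \<nu>) * zmon \<nu>) \<mu>" ..
qed

text \<open>Linear properties need checking on monomials only. The first premise is limited to the
  support of \<open>f\<close>, so that restrictions on exponents remain available.\<close>

lemma zpoly_span_induct:
  assumes "\<And>\<nu>. \<nu> \<in> Poly_Mapping.keys f \<Longrightarrow> V (zmon \<nu>)"
    and "V 0" "\<And>f g. V f \<Longrightarrow> V g \<Longrightarrow> V (f + g)" "\<And>c f. V f \<Longrightarrow> V (Const c * f)"
  shows "V f"
proof -
  have "V (\<Sum>\<nu>\<in>A. Const (zcoeff f \<nu>) * zmon \<nu>)" if "finite A" "A \<subseteq> Poly_Mapping.keys f" for A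
    using that by (induction A rule: finite_induct) (auto intro!: assms)
  from this[of "Poly_Mapping.keys f"] show ?thesis
    using zpoly_expansion[of "Poly_Mapping.keys f" f] by simp
qed


section \<open>Substitutions as algebra homomorphisms\<close>

definition power_prod :: "(nat \<Rightarrow> zpoly) \<Rightarrow> exponent \<Rightarrow> zpoly" where
  "power_prod g \<nu> = (\<Prod>i\<in>Poly_Mapping.keys \<nu>. g i ^ entry \<nu> i)"

lemma power_prod_superset:
  assumes "finite A" "Poly_Mapping.keys \<nu> \<subseteq> A"
  shows "power_prod g \<nu> = (\<Prod>i\<in>A. g i ^ entry \<nu> i)"
  unfolding power_prod_def
  by (rule prod.mono_neutral_left) (use assms in \<open>auto simp: in_keys_iff\<close>)

lemma power_prod_add: "power_prod g (\<mu> + \<nu>) = power_prod g \<mu> * power_prod g \<nu>"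
proof -
  let ?A = "Poly_Mapping.keys \<mu> \<union> Poly_Mapping.keys \<nu>"
  have "Poly_Mapping.keys (\<mu> + \<nu>) \<subseteq> ?A"
    by (rule keys_add)
  then show ?thesis
    by (simp add: power_prod_superset[of ?A] lookup_add power_add prod.distrib)
qed

lemma subst_vars_eq: "subst_vars g f = (\<Sum>\<nu>\<in>Poly_Mapping.keys f. Const (zcoeff f \<nu>) * power_prod g \<nu>)"
  by (simp add: subst_vars_def power_prod_def)

lemma subst_vars_superset:
  assumes "finite A" "Poly_Mapping.keys f \<subseteq> A"
  shows "subst_vars g f = (\<Sum>\<nu>\<in>A. Const (zcoeff f \<nu>) * power_prod g \<nu>)"
  unfolding subst_vars_eq
  by (rule sum.mono_neutral_left) (use assms in \<open>auto simp: in_keys_iff\<close>)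

lemma subst_vars_add: "subst_vars g (f + h) = subst_vars g f + subst_vars g h"
proof -
  let ?A = "Poly_Mapping.keys f \<union> Poly_Mapping.keys h"
  have "Poly_Mapping.keys (f + h) \<subseteq> ?A"
    by (rule keys_add)
  then show ?thesis
    by (simp add: subst_vars_superset[of ?A] lookup_add Const_add distrib_right sum.distrib)
qed

lemma subst_vars_Const_mult: "subst_vars g (Const c * f) = Const c * subst_vars g f"
proof -
  have "Poly_Mapping.keys (Const c * f) \<subseteq> Poly_Mapping.keys f"
    by (rule keys_Const_mult)
  then show ?thesis
    by (simp add: subst_vars_superset[of "Poly_Mapping.keys f"] Const_mult sum_distrib_left mult.assoc)
qed

lemma subst_vars_zmon: "subst_vars g (zmon \<nu>) = power_prod g \<nu>"
  by (simp add: subst_vars_eq zcoeff_zmon)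

lemma subst_vars_0: "subst_vars g 0 = 0"
  by (simp add: subst_vars_eq)

lemma subst_vars_mult: "subst_vars g (f * h) = subst_vars g f * subst_vars g h"
proof (rule zpoly_span_induct[of f], goal_cases)
  case (1 \<nu>)
  show ?case
  proof (rule zpoly_span_induct[of h], goal_cases)
    case (1 \<mu>)
    then show ?case by (simp add: zmon_mult subst_vars_zmon power_prod_add)
  next
    case (4 c f)
    have "zmon \<nu> * (Const c * f) = Const c * (zmon \<nu> * f)" by (simp add: ac_simps)
    then show ?case using 4 by (simp add: subst_vars_Const_mult mult.left_commute)
  qed (simp_all add: subst_vars_0 subst_vars_add distrib_left)
next
  case (4 c f)
  then show ?case by (simp add: subst_vars_Const_mult mult.assoc)
qed (simp_all add: subst_vars_0 subst_vars_add distrib_right)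

text \<open>Algebra endomorphisms over the coefficient field. Identities between compositions of
  \<open>swap_vars\<close> and \<open>\<omega>\<^sub>0\<close> are checked on the variables by
  \<open>zhom_eq\<close>.\<close>

definition zhom :: "(zpoly \<Rightarrow> zpoly) \<Rightarrow> bool" where
  "zhom F \<longleftrightarrow> (\<forall>f g. F (f + g) = F f + F g) \<and> (\<forall>f g. F (f * g) = F f * F g) \<and> (\<forall>c. F (Const c) = Const c)"

lemma zhom_add: "zhom F \<Longrightarrow> F (f + g) = F f + F g"
  and zhom_mult: "zhom F \<Longrightarrow> F (f * g) = F f * F g"
  and zhom_Const: "zhom F \<Longrightarrow> F (Const c) = Const c"
  by (simp_all add: zhom_def)

lemma zhom_0: "zhom F \<Longrightarrow> F 0 = 0"
  using zhom_Const[of F 0] by simp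

lemma zhom_1: "zhom F \<Longrightarrow> F 1 = 1"
  using zhom_Const[of F 1] by simp

lemma zhom_diff: "zhom F \<Longrightarrow> F (f - g) = F f - F g"
  by (metis add_diff_cancel_right' diff_add_cancel zhom_add)

lemma zhom_power: "zhom F \<Longrightarrow> F (f ^ k) = F f ^ k"
  by (induction k) (simp_all add: zhom_1 zhom_mult)

lemma zhom_prod: "zhom F \<Longrightarrow> F (prod f A) = (\<Prod>x\<in>A. F (f x))"
  by (induction A rule: infinite_finite_induct) (simp_all add: zhom_1 zhom_mult)

lemma zhom_sum: "zhom F \<Longrightarrow> F (sum f A) = (\<Sum>x\<in>A. F (f x))"
  by (induction A rule: infinite_finite_induct) (simp_all add: zhom_0 zhom_add)

lemmas zhom_simps = zhom_add zhom_mult zhom_Const zhom_diff zhom_power zhom_0 zhom_1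

lemma zhom_subst_vars: "zhom (subst_vars g)"
proof -
  have "subst_vars g (Const c) = Const c" for c
    using subst_vars_Const_mult[of g c 1] subst_vars_zmon[of g 0]
    by (simp add: zmon_0 power_prod_def)
  then show ?thesis
    by (simp add: zhom_def subst_vars_add subst_vars_mult)
qed

lemma subst_vars_Z: "subst_vars g (Z i) = g i"
  by (simp add: Z_eq_zmon subst_vars_zmon power_prod_def)

lemma subst_vars_Z_id: "subst_vars Z f = f"
proof -
  have "zmon \<nu> = power_prod Z \<nu>" for \<nu>
  proof -
    have "(\<Prod>i\<in>A. Z i ^ entry \<nu> i) = zmon (\<Sum>i\<in>A. Poly_Mapping.single i (entry \<nu> i))" if "finite A" for A
    proof -
      have *: "Z i ^ k = zmon (Poly_Mapping.single i k)" for i k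
        by (induction k) (simp_all add: zmon_0 Z_eq_zmon zmon_mult flip: single_add)
      show ?thesis using that
        by (induction A rule: finite_induct) (simp_all add: zmon_0 zmon_mult *)
    qed
    moreover have "(\<Sum>i\<in>Poly_Mapping.keys \<nu>. Poly_Mapping.single i (entry \<nu> i)) = \<nu>"
    proof (rule poly_mapping_eqI)
      fix k
      have "entry (\<Sum>i\<in>Poly_Mapping.keys \<nu>. Poly_Mapping.single i (entry \<nu> i)) k
          = (\<Sum>i\<in>Poly_Mapping.keys \<nu>. if i = k then entry \<nu> i else 0)"
        by (auto simp: lookup_sum lookup_single when_def intro: sum.cong)
      then show "entry (\<Sum>i\<in>Poly_Mapping.keys \<nu>. Poly_Mapping.single i (entry \<nu> i)) k = entry \<nu> k"
        by (auto simp: in_keys_iff)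
    qed
    ultimately show ?thesis by (simp add: power_prod_def)
  qed
  then show ?thesis
    using zpoly_expansion[of "Poly_Mapping.keys f" f] by (simp add: subst_vars_eq)
qed

lemma zmon_eq_power_prod: "zmon \<nu> = power_prod Z \<nu>"
  using subst_vars_Z_id[of "zmon \<nu>"] by (simp add: subst_vars_zmon)

lemma zhom_zmon: "zhom F \<Longrightarrow> F (zmon \<nu>) = (\<Prod>i\<in>Poly_Mapping.keys \<nu>. F (Z i) ^ entry \<nu> i)"
  by (simp add: zmon_eq_power_prod power_prod_def zhom_prod zhom_power)


text \<open>The type has infinitely many variables, and \<open>\<omega>\<^sub>0\<close> rotates only
  the first \<open>n\<close> of them: it sends \<open>Z (n + 1)\<close> to \<open>Z n\<close>.
  Relations that wrap around the rotation are therefore restricted to this subring.\<close>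

definition npoly :: "nat \<Rightarrow> zpoly set" where
  "npoly n = {f. \<forall>\<nu>\<in>Poly_Mapping.keys f. is_composition n \<nu>}"

lemma is_composition_iff: "is_composition n \<nu> \<longleftrightarrow> (\<forall>k. k \<notin> {1..n} \<longrightarrow> entry \<nu> k = 0)"
  by (auto simp: is_composition_def in_keys_iff)

lemma npoly_add: "f \<in> npoly n \<Longrightarrow> g \<in> npoly n \<Longrightarrow> f + g \<in> npoly n"
  using keys_add[of f g] by (auto simp: npoly_def)

lemma npoly_Const_mult: "f \<in> npoly n \<Longrightarrow> Const c * f \<in> npoly n"
  using keys_Const_mult[of c f] by (auto simp: npoly_def)

lemma zhom_eq_on_npoly:
  assumes "zhom F" "zhom G" "f \<in> npoly n" "\<And>i. i \<in> {1..n} \<Longrightarrow> F (Z i) = G (Z i)"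
  shows "F f = G f"
proof (rule zpoly_span_induct[of f], goal_cases)
  case (1 \<nu>)
  then have "Poly_Mapping.keys \<nu> \<subseteq> {1..n}"
    using assms(3) by (simp add: npoly_def is_composition_def)
  then show ?case
    by (auto simp: zhom_zmon assms(1,2) intro!: prod.cong arg_cong[where f = "\<lambda>x. x ^ _"] assms(4))
qed (simp_all add: zhom_simps assms)

lemma zhom_eq:
  assumes "zhom F" "zhom G" "\<And>i. F (Z i) = G (Z i)"
  shows "F f = G f"
  by (rule zpoly_span_induct[of f]) (simp_all add: zhom_zmon zhom_simps assms)


section \<open>Adjacent transpositions on exponents and on variables\<close>

lemma adj_adj [simp]: "adj i (adj i k) = k"
  by (simp add: adj_def)

lemma adj_comp_self [simp]: "adj i \<circ> adj i = id"
  by (simp add: fun_eq_iff)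

lemma bij_adj: "bij (adj i)"
  by (simp add: adj_def)

lemma inv_adj [simp]: "inv' (adj i) = adj i"
  by (simp add: adj_def)

lemma adj_left [simp]: "adj i i = Suc i"
  and adj_right [simp]: "adj i (Suc i) = i"
  by (simp_all add: adj_def)

lemma adj_other: "k \<noteq> i \<Longrightarrow> k \<noteq> Suc i \<Longrightarrow> adj i k = k"
  by (simp add: adj_def)

lemma adj_eq: "adj i k = (if k = i then Suc i else if k = Suc i then i else k)"
  by (auto simp: adj_def transpose_def)

lemma entry_act: "bij \<sigma> \<Longrightarrow> entry (act \<sigma> \<nu>) k = entry \<nu> (inv' \<sigma> k)"
  unfolding act_def by (simp add: map_key.rep_eq bij_imp_bij_inv bij_is_inj)

lemma entry_act_adj [simp]: "entry (act (adj i) \<nu>) k = entry \<nu> (adj i k)"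
  by (simp add: entry_act bij_adj)

lemma act_id [simp]: "act id \<nu> = \<nu>"
  by (rule poly_mapping_eqI) (simp add: entry_act inv_id)

lemma act_comp: "bij \<sigma> \<Longrightarrow> bij \<tau> \<Longrightarrow> act (\<sigma> \<circ> \<tau>) \<nu> = act \<sigma> (act \<tau> \<nu>)"
  by (rule poly_mapping_eqI) (simp add: entry_act bij_comp o_inv_distrib)

lemma act_adj_adj [simp]: "act (adj i) (act (adj i) \<nu>) = \<nu>"
  by (simp add: bij_adj flip: act_comp)

lemma act_adj_eq_iff: "act (adj i) \<nu> = \<nu> \<longleftrightarrow> entry \<nu> i = entry \<nu> (Suc i)"
proof
  assume "act (adj i) \<nu> = \<nu>"
  then show "entry \<nu> i = entry \<nu> (Suc i)"
    by (metis adj_left entry_act_adj)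
next
  assume "entry \<nu> i = entry \<nu> (Suc i)"
  then show "act (adj i) \<nu> = \<nu>"
    by (intro poly_mapping_eqI) (simp add: adj_eq)
qed

lemma zhom_swap_vars: "zhom (swap_vars i)"
  by (simp add: swap_vars_def zhom_subst_vars)

lemma swap_vars_Z [simp]: "swap_vars i (Z j) = Z (adj i j)"
  by (simp add: swap_vars_def subst_vars_Z)

lemmas swap_vars_simps = zhom_simps[OF zhom_swap_vars]

lemma swap_vars_zmon: "swap_vars i (zmon \<nu>) = zmon (act (adj i) \<nu>)"
proof -
  have "Poly_Mapping.keys (act (adj i) \<nu>) = adj i ` Poly_Mapping.keys \<nu>"
    by (force simp: in_keys_iff)
  moreover have "inj_on (adj i) A" for A
    by (meson bij_adj bij_is_inj inj_on_subset subset_UNIV)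
  ultimately show ?thesis
    by (simp add: zhom_zmon[OF zhom_swap_vars] zmon_eq_power_prod[of "act _ _"] power_prod_def prod.reindex)
qed

lemma swap_vars_swap_vars [simp]: "swap_vars i (swap_vars i f) = f"
  by (rule zhom_eq[of _ "\<lambda>f. f"]) (auto simp: swap_vars_simps zhom_def)

lemma swap_vars_commute:
  assumes "Suc i < j"
  shows "swap_vars i (swap_vars j f) = swap_vars j (swap_vars i f)"
  by (rule zhom_eq) (use assms in \<open>auto simp: zhom_def swap_vars_simps adj_eq\<close>)

lemma swap_vars_braid:
  "swap_vars i (swap_vars (Suc i) (swap_vars i f)) = swap_vars (Suc i) (swap_vars i (swap_vars (Suc i) f))"
  by (rule zhom_eq) (auto simp: zhom_def swap_vars_simps adj_eq)

lemma is_composition_act_adj: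
  assumes "is_composition n \<nu>" "i \<in> {1..<n}"
  shows "is_composition n (act (adj i) \<nu>)"
  using assms by (auto simp: is_composition_iff adj_eq)

lemma Z_eq_iff [simp]: "Z i = Z j \<longleftrightarrow> i = j"
  unfolding Z_def by (metis keys_single singleton_inject zero_neq_one)


section \<open>Demazure-Lusztig operators\<close>

text \<open>The braid relation as an identity of rational functions in which the images of f under
  the copy of S_3 are independent symbols: 1 and 2 in a name stand for the two transpositions, the
  one written last acting first. Here g, h, k are the stages of T_1 T_2 T_1 f, and p, r, k' those of
  T_2 T_1 T_2 f.\<close>

lemma braid_identity_field:
  fixes x y w v :: "'a::field"
  assumes "x \<noteq> y" "x \<noteq> w" "y \<noteq> w"
    and "g = ((v * x - y) * f1 + (1 - v) * y * f) / (x - y)"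
    and "g2 = ((v * x - w) * f21 + (1 - v) * w * f2) / (x - w)"
    and "g1 = ((v * y - x) * f + (1 - v) * x * f1) / (y - x)"
    and "g12 = ((v * y - w) * f121 + (1 - v) * w * f12) / (y - w)"
    and "h = ((v * y - w) * g2 + (1 - v) * w * g) / (y - w)"
    and "h1 = ((v * x - w) * g12 + (1 - v) * w * g1) / (x - w)"
    and "k = ((v * x - y) * h1 + (1 - v) * y * h) / (x - y)"
    and "p = ((v * y - w) * f2 + (1 - v) * w * f) / (y - w)"
    and "p1 = ((v * x - w) * f12 + (1 - v) * w * f1) / (x - w)"
    and "p2 = ((v * w - y) * f + (1 - v) * y * f2) / (w - y)"
    and "p21 = ((v * x - y) * f121 + (1 - v) * y * f21) / (x - y)"
    and "r = ((v * x - y) * p1 + (1 - v) * y * p) / (x - y)"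
    and "r2 = ((v * x - w) * p21 + (1 - v) * w * p2) / (x - w)"
    and "k' = ((v * y - w) * r2 + (1 - v) * w * r) / (y - w)"
  shows "k = k'"
proof -
  have nz: "x - y \<noteq> 0" "y - w \<noteq> 0" "x - w \<noteq> 0" using assms(1-3) by auto
  \<comment> \<open>Orienting the differences leaves three denominators to clear.\<close>
  have neg: "y - x = - (x - y)" "w - y = - (y - w)" by simp_all
  show ?thesis
    unfolding assms(4-) neg using nz
    by (simp add: divide_simps del: minus_diff_eq right_minus_eq) algebra
qed

text \<open>Polynomials form only a domain, so the equations are given with denominators cleared;
  the embedding into the fraction field leads back to \<open>braid_identity_field\<close>.\<close>

lemma braid_identity:
  fixes x y w v :: "'a::idom"
  assumes "x \<noteq> y" "x \<noteq> w" "y \<noteq> w"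
    and "(x - y) * g = (v * x - y) * f1 + (1 - v) * y * f"
    and "(x - w) * g2 = (v * x - w) * f21 + (1 - v) * w * f2"
    and "(y - x) * g1 = (v * y - x) * f + (1 - v) * x * f1"
    and "(y - w) * g12 = (v * y - w) * f121 + (1 - v) * w * f12"
    and "(y - w) * h = (v * y - w) * g2 + (1 - v) * w * g"
    and "(x - w) * h1 = (v * x - w) * g12 + (1 - v) * w * g1"
    and "(x - y) * k = (v * x - y) * h1 + (1 - v) * y * h"
    and "(y - w) * p = (v * y - w) * f2 + (1 - v) * w * f"
    and "(x - w) * p1 = (v * x - w) * f12 + (1 - v) * w * f1"
    and "(w - y) * p2 = (v * w - y) * f + (1 - v) * y * f2"
    and "(x - y) * p21 = (v * x - y) * f121 + (1 - v) * y * f21"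
    and "(x - y) * r = (v * x - y) * p1 + (1 - v) * y * p"
    and "(x - w) * r2 = (v * x - w) * p21 + (1 - v) * w * p2"
    and "(y - w) * k' = (v * y - w) * r2 + (1 - v) * w * r"
  shows "k = k'"
proof -
  let ?F = "\<lambda>a. Fract a (1::'a)"
  have quotient: "?F c = ((?F v * ?F a1 - ?F a2) * ?F c1 + (1 - ?F v) * ?F a2 * ?F c2) / (?F a1 - ?F a2)"
    if "(a1 - a2) * c = (v * a1 - a2) * c1 + (1 - v) * a2 * c2" "a1 \<noteq> a2" for a1 a2 c c1 c2
  proof -
    have "?F ((a1 - a2) * c) = ?F ((v * a1 - a2) * c1 + (1 - v) * a2 * c2)"
      using that by simp
    then have "(?F a1 - ?F a2) * ?F c = (?F v * ?F a1 - ?F a2) * ?F c1 + (1 - ?F v) * ?F a2 * ?F c2"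
      by (simp add: One_fract_def)
    moreover have "?F a1 - ?F a2 \<noteq> 0"
      using that(2) by (simp add: eq_fract Zero_fract_def)
    ultimately show ?thesis
      by (metis nonzero_mult_div_cancel_left)
  qed
  have ne: "?F x \<noteq> ?F y" "?F x \<noteq> ?F w" "?F y \<noteq> ?F w"
    using assms(1-3) by (simp_all add: eq_fract)
  have "?F k = ?F k'"
    by (rule braid_identity_field[OF ne
        quotient[OF assms(4) assms(1)]
        quotient[OF assms(5) assms(2)]
        quotient[OF assms(6) assms(1)[symmetric]]
        quotient[OF assms(7) assms(3)]
        quotient[OF assms(8) assms(3)]
        quotient[OF assms(9) assms(2)]
        quotient[OF assms(10) assms(1)]
        quotient[OF assms(11) assms(3)]
        quotient[OF assms(12) assms(2)]
        quotient[OF assms(13) assms(3)[symmetric]]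
        quotient[OF assms(14) assms(1)]
        quotient[OF assms(15) assms(1)]
        quotient[OF assms(16) assms(2)]
        quotient[OF assms(17) assms(3)]])
  then show ?thesis by (simp add: eq_fract)
qed

text \<open>Separates the two exponents on which \<open>T i\<close> acts, so that statements about
  monomials become computations in two variables.\<close>

definition set_pair :: "exponent \<Rightarrow> nat \<Rightarrow> nat \<Rightarrow> nat \<Rightarrow> exponent" where
  "set_pair \<nu> i a b = Poly_Mapping.update i a (Poly_Mapping.update (Suc i) b \<nu>)"

lemma entry_set_pair: "entry (set_pair \<nu> i a b) k = (if k = i then a else if k = Suc i then b else entry \<nu> k)"
  by (auto simp: set_pair_def lookup_update)

lemma set_pair_self [simp]: "set_pair \<nu> i (entry \<nu> i) (entry \<nu> (Suc i)) = \<nu>"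
  by (rule poly_mapping_eqI) (simp add: entry_set_pair)

lemma act_adj_eq_set_pair: "act (adj i) \<nu> = set_pair \<nu> i (entry \<nu> (Suc i)) (entry \<nu> i)"
  by (rule poly_mapping_eqI) (simp add: entry_set_pair adj_eq)

lemma act_adj_set_pair: "act (adj i) (set_pair \<nu> i a b) = set_pair \<nu> i b a"
  by (rule poly_mapping_eqI) (simp add: entry_set_pair adj_eq)

lemma Z_power: "Z i ^ k = zmon (Poly_Mapping.single i k)"
  by (induction k) (simp_all add: zmon_0 Z_eq_zmon zmon_mult flip: single_add)

lemma zmon_set_pair: "zmon (set_pair \<nu> i a b) = zmon (set_pair \<nu> i 0 0) * (Z i ^ a * Z (Suc i) ^ b)"
proof -
  have "set_pair \<nu> i a b = set_pair \<nu> i 0 0 + (Poly_Mapping.single i a + Poly_Mapping.single (Suc i) b)"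
    by (rule poly_mapping_eqI) (simp add: entry_set_pair lookup_add lookup_single when_def)
  then show ?thesis by (simp add: Z_power zmon_mult)
qed

lemma Z_diff_nonzero [simp]: "i \<noteq> j \<Longrightarrow> Z i - Z j \<noteq> 0"
  by simp

lemma Z_diff_dvd_swap_diff: "Z i - Z (Suc i) dvd swap_vars i f - f"
proof (rule zpoly_span_induct[of f], goal_cases)
  case (1 \<nu>)
  define a b where "a = entry \<nu> i" and "b = entry \<nu> (Suc i)"
  let ?m = "zmon (set_pair \<nu> i 0 0)" and ?x = "Z i" and ?y = "Z (Suc i)"
  have z: "zmon \<nu> = ?m * (?x ^ a * ?y ^ b)"
    using zmon_set_pair[of \<nu> i a b] by (simp add: a_def b_def)
  have sz: "swap_vars i (zmon \<nu>) = ?m * (?x ^ b * ?y ^ a)"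
    using zmon_set_pair[of \<nu> i b a] by (simp add: swap_vars_zmon act_adj_eq_set_pair a_def b_def)
  \<comment> \<open>Adding and subtracting x^(a+b) leaves differences of equal powers, each
    divisible by x - y.\<close>
  have "swap_vars i (zmon \<nu>) - zmon \<nu> = ?m * (?x ^ a * (?x ^ b - ?y ^ b) - ?x ^ b * (?x ^ a - ?y ^ a))"
    unfolding sz unfolding z by (simp add: algebra_simps)
  moreover have dvd: "?x - ?y dvd ?x ^ k - ?y ^ k" for k
    unfolding power_diff_sumr2 by (rule dvd_triv_left)
  have "?x - ?y dvd ?m * (?x ^ a * (?x ^ b - ?y ^ b) - ?x ^ b * (?x ^ a - ?y ^ a))"
    by (rule dvd_mult, rule dvd_diff; rule dvd_mult; rule dvd)
  ultimately show ?case by (simp only:)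
next
  case (3 f g)
  have "swap_vars i (f + g) - (f + g) = (swap_vars i f - f) + (swap_vars i g - g)"
    by (simp add: swap_vars_simps)
  then show ?case using 3 by (simp only: dvd_add)
next
  case (4 c f)
  have "swap_vars i (Const c * f) - Const c * f = Const c * (swap_vars i f - f)"
    by (simp add: swap_vars_simps right_diff_distrib)
  then show ?case using 4 by (simp only: dvd_mult)
qed (simp add: swap_vars_simps)

lemma divided_diff: "(Z i - Z (Suc i)) * divided_diff i f = swap_vars i f - f"
proof -
  obtain h where h: "(Z i - Z (Suc i)) * h = swap_vars i f - f"
    using Z_diff_dvd_swap_diff[of i f] by (metis dvdE)
  show ?thesis unfolding divided_diff_def
  proof (rule theI2[of _ h])
    fix h' assume "(Z i - Z (i + 1)) * h' = swap_vars i f - f"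
    then show "h' = h" using h by (metis Suc_eq_plus1 Z_diff_nonzero mult_left_cancel n_not_Suc_n)
  qed (use h in simp_all)
qed

text \<open>With the denominator cleared the divided difference disappears. Operator identities
  become polynomial identities, and \<open>T_eqI\<close> cancels the common factor again.\<close>

lemma T_eq: "(Z i - Z (Suc i)) * T i f
    = (Const t * Z i - Z (Suc i)) * swap_vars i f + (1 - Const t) * Z (Suc i) * f"
proof -
  have "(Z i - Z (Suc i)) * T i f = (Z i - Z (Suc i)) * Const t * f
      + (Const t * Z i - Z (Suc i)) * ((Z i - Z (Suc i)) * divided_diff i f)"
    by (simp add: T_def algebra_simps)
  then show ?thesis unfolding divided_diff by (simp add: algebra_simps)
qed

lemma T_eqI:
  assumes "(Z i - Z (Suc i)) * g
    = (Const t * Z i - Z (Suc i)) * swap_vars i f + (1 - Const t) * Z (Suc i) * f"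
  shows "T i f = g"
  using assms T_eq[of i f] by (metis Z_diff_nonzero mult_left_cancel n_not_Suc_n)

lemma T_add: "T i (f + g) = T i f + T i g"
  by (rule T_eqI) (simp add: distrib_left T_eq swap_vars_simps)

lemma T_mult_sym: "swap_vars i g = g \<Longrightarrow> T i (g * f) = g * T i f"
  by (rule T_eqI) (simp add: mult.left_commute[of _ g] T_eq swap_vars_simps distrib_left)

lemma T_Const_mult: "T i (Const c * f) = Const c * T i f"
  by (rule T_mult_sym) (simp add: swap_vars_simps)

lemma T_0: "T i 0 = 0"
  using T_Const_mult[of i 0 0] by simp

lemma T_sum: "T i (sum f A) = (\<Sum>x\<in>A. T i (f x))"
  by (induction A rule: infinite_finite_induct) (simp_all add: T_0 T_add)

lemma T_sym: "swap_vars i f = f \<Longrightarrow> T i f = Const t * f"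
  by (rule T_eqI) (simp add: algebra_simps)

lemma swap_T: "(Z i - Z (Suc i)) * swap_vars i (T i f)
    = (Z i - Const t * Z (Suc i)) * f - (1 - Const t) * Z i * swap_vars i f"
proof -
  have "swap_vars i ((Z i - Z (Suc i)) * T i f) = swap_vars i ((Const t * Z i - Z (Suc i)) * swap_vars i f + (1 - Const t) * Z (Suc i) * f)"
    by (simp only: T_eq)
  then have "(Z (Suc i) - Z i) * swap_vars i (T i f)
     = (Const t * Z (Suc i) - Z i) * f + (1 - Const t) * Z i * swap_vars i f"
    by (simp add: swap_vars_simps)
  then show ?thesis by (simp add: algebra_simps)
qed

text \<open>The quadratic Hecke relation (T - t)(T + 1) = 0, obtained by applying \<open>s_i\<close>
  to \<open>T_eq\<close> and eliminating \<open>swap_vars i (T i f)\<close>.\<close>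

lemma T_T: "T i (T i f) = Const (t - 1) * T i f + Const t * f"
proof (rule T_eqI)
  let ?x = "Z i" and ?y = "Z (Suc i)" and ?g = "T i f" and ?v = "Const t"
  have "(?x - ?y) * ((?x - ?y) * (Const (t - 1) * ?g + ?v * f))
      = (?x - ?y) * ((?v * ?x - ?y) * swap_vars i ?g + (1 - ?v) * ?y * ?g)"
    using T_eq[of i f] swap_T[of i f] unfolding Const_diff Const_1 by algebra
  then show "(?x - ?y) * (Const (t - 1) * ?g + ?v * f)
      = (?v * ?x - ?y) * swap_vars i ?g + (1 - ?v) * ?y * ?g"
    by (metis Z_diff_nonzero mult_left_cancel n_not_Suc_n)
qed

lemma swap_vars_T:
  "(Z (adj j i) - Z (adj j (Suc i))) * swap_vars j (T i f)
    = (Const t * Z (adj j i) - Z (adj j (Suc i))) * swap_vars j (swap_vars i f)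
      + (1 - Const t) * Z (adj j (Suc i)) * swap_vars j f"
proof -
  have "swap_vars j ((Z i - Z (Suc i)) * T i f) = swap_vars j ((Const t * Z i - Z (Suc i)) * swap_vars i f + (1 - Const t) * Z (Suc i) * f)"
    by (simp only: T_eq)
  then show ?thesis by (simp add: swap_vars_simps)
qed

lemma T_commute:
  assumes "Suc i < j"
  shows "T i (T j f) = T j (T i f)"
proof (rule T_eqI)
  let ?x = "Z i" and ?y = "Z (Suc i)" and ?z = "Z j" and ?w = "Z (Suc j)" and ?v = "Const t"
  have [simp]: "adj i j = j" "adj i (Suc j) = Suc j" "adj j i = i" "adj j (Suc i) = Suc i"
    using assms by (simp_all add: adj_eq)
  have "(?z - ?w) * ((?x - ?y) * T j (T i f))
      = (?x - ?y) * ((?v * ?z - ?w) * swap_vars j (T i f) + (1 - ?v) * ?w * T i f)"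
    by (simp add: mult.left_commute[of "?z - ?w"] T_eq)
  also have "\<dots> = (?z - ?w) * ((?v * ?x - ?y) * swap_vars i (T j f) + (1 - ?v) * ?y * T j f)"
    using swap_vars_T[of j i f] swap_vars_T[of i j f] T_eq[of i f] T_eq[of j f]
      swap_vars_commute[OF assms, of f] by simp algebra
  finally show "(?x - ?y) * T j (T i f)
      = (?v * ?x - ?y) * swap_vars i (T j f) + (1 - ?v) * ?y * T j f"
    by (metis Z_diff_nonzero mult_left_cancel n_not_Suc_n)
qed

lemma T_braid: "T i (T (Suc i) (T i f)) = T (Suc i) (T i (T (Suc i) f))"
proof (rule braid_identity[of "Z i" "Z (Suc i)" "Z (Suc (Suc i))"])
  let ?s = "swap_vars i" and ?u = "swap_vars (Suc i)"
  have [simp]: "adj (Suc i) i = i" "adj i (Suc (Suc i)) = Suc (Suc i)"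
    by (simp_all add: adj_eq)
  show "(Z i - Z (Suc (Suc i))) * ?u (T i f) = (Const t * Z i - Z (Suc (Suc i))) * ?u (?s f) + (1 - Const t) * Z (Suc (Suc i)) * ?u f"
    using swap_vars_T[of "Suc i" i f] by simp
  show "(Z (Suc i) - Z i) * ?s (T i f) = (Const t * Z (Suc i) - Z i) * f + (1 - Const t) * Z i * ?s f"
    using swap_vars_T[of i i f] by simp
  show "(Z i - Z (Suc (Suc i))) * ?s (T (Suc i) f) = (Const t * Z i - Z (Suc (Suc i))) * ?s (?u f) + (1 - Const t) * Z (Suc (Suc i)) * ?s f"
    using swap_vars_T[of i "Suc i" f] by simp
  show "(Z (Suc (Suc i)) - Z (Suc i)) * ?u (T (Suc i) f) = (Const t * Z (Suc (Suc i)) - Z (Suc i)) * f + (1 - Const t) * Z (Suc i) * ?u f"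
    using swap_vars_T[of "Suc i" "Suc i" f] by simp
  show "(Z (Suc i) - Z (Suc (Suc i))) * ?s (?u (T i f)) = (Const t * Z (Suc i) - Z (Suc (Suc i))) * ?s (?u (?s f)) + (1 - Const t) * Z (Suc (Suc i)) * ?s (?u f)"
    using arg_cong[OF swap_vars_T[of "Suc i" i f], of ?s] by (simp add: swap_vars_simps)
  show "(Z i - Z (Suc i)) * ?u (?s (T (Suc i) f)) = (Const t * Z i - Z (Suc i)) * ?s (?u (?s f)) + (1 - Const t) * Z (Suc i) * ?u (?s f)"
    using arg_cong[OF swap_vars_T[of i "Suc i" f], of ?u] by (simp add: swap_vars_simps swap_vars_braid)
  show "(Z i - Z (Suc (Suc i))) * ?s (T (Suc i) (T i f)) = (Const t * Z i - Z (Suc (Suc i))) * ?s (?u (T i f)) + (1 - Const t) * Z (Suc (Suc i)) * ?s (T i f)"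
    using swap_vars_T[of i "Suc i" "T i f"] by simp
  show "(Z i - Z (Suc (Suc i))) * ?u (T i (T (Suc i) f)) = (Const t * Z i - Z (Suc (Suc i))) * ?u (?s (T (Suc i) f)) + (1 - Const t) * Z (Suc (Suc i)) * ?u (T (Suc i) f)"
    using swap_vars_T[of "Suc i" i "T (Suc i) f"] by simp
  show "(Z i - Z (Suc i)) * T i f = (Const t * Z i - Z (Suc i)) * ?s f + (1 - Const t) * Z (Suc i) * f"
    and "(Z (Suc i) - Z (Suc (Suc i))) * T (Suc i) (T i f) = (Const t * Z (Suc i) - Z (Suc (Suc i))) * ?u (T i f) + (1 - Const t) * Z (Suc (Suc i)) * T i f"
    and "(Z (Suc i) - Z (Suc (Suc i))) * T (Suc i) f = (Const t * Z (Suc i) - Z (Suc (Suc i))) * ?u f + (1 - Const t) * Z (Suc (Suc i)) * f"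
    and "(Z i - Z (Suc i)) * T i (T (Suc i) f) = (Const t * Z i - Z (Suc i)) * ?s (T (Suc i) f) + (1 - Const t) * Z (Suc i) * T (Suc i) f"
    by (rule T_eq)+
qed (simp_all add: T_eq)

lemma t_nonzero [simp]: "t \<noteq> 0" and q_nonzero [simp]: "q \<noteq> 0"
  by (simp_all add: t_def q_def eq_fract Zero_fract_def)

text \<open>The quadratic relation solved for the inverse.\<close>

definition T_inv :: "nat \<Rightarrow> zpoly \<Rightarrow> zpoly" where
  "T_inv i f = Const (1 / t) * (T i f + Const (1 - t) * f)"

lemma T_T_inv [simp]: "T i (T_inv i f) = f"
proof -
  have "T i (T_inv i f) = Const (1 / t) * (Const t * f + Const (t - 1 + (1 - t)) * T i f)"
    unfolding T_inv_def by (simp only: T_add T_Const_mult T_T Const_add distrib_right) (simp only: add_ac)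
  then show ?thesis by (simp add: Const_inverse_mult flip: mult.assoc)
qed

lemma T_inv_T [simp]: "T_inv i (T i f) = f"
proof -
  have "T_inv i (T i f) = Const (1 / t) * (Const t * f + Const (t - 1 + (1 - t)) * T i f)"
    unfolding T_inv_def by (simp only: T_T Const_add distrib_right) (simp only: add_ac)
  then show ?thesis by (simp add: Const_inverse_mult flip: mult.assoc)
qed

lemma inv_T: "inv' (T i) = T_inv i"
  by (rule inv_equality) simp_all

lemma T_inv_add: "T_inv i (f + g) = T_inv i f + T_inv i g"
  by (simp add: T_inv_def T_add algebra_simps)

lemma T_inv_Const_mult: "T_inv i (Const c * f) = Const c * T_inv i f"
  by (simp add: T_inv_def T_Const_mult distrib_left mult.left_commute)

lemma T_inv_mult_sym: "swap_vars i g = g \<Longrightarrow> T_inv i (g * f) = g * T_inv i f"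
  by (simp add: T_inv_def T_mult_sym distrib_left mult.left_commute)

lemma T_inv_T_commute: "Suc i < j \<or> Suc j < i \<Longrightarrow> T_inv i (T j f) = T j (T_inv i f)"
  by (metis T_T_inv T_commute T_inv_T)

text \<open>The cross relation T_i z_i T_i = t z_(i+1) of the affine Hecke algebra. It moves the
  variable in \<open>Phi\<close> past the operators that make up \<open>Y\<close>.\<close>

lemma T_Z_left: "T i (Z i * f) = Const t * Z (Suc i) * T_inv i f"
proof (rule T_eqI)
  have "Const t * T_inv i f = T i f + Const (1 - t) * f"
    by (simp add: T_inv_def flip: Const_mult mult.assoc)
  then have "(Z i - Z (Suc i)) * (Const t * Z (Suc i) * T_inv i f)
     = Z (Suc i) * ((Z i - Z (Suc i)) * T i f + (Z i - Z (Suc i)) * (Const (1 - t) * f))"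
    by algebra
  then show "(Z i - Z (Suc i)) * (Const t * Z (Suc i) * T_inv i f)
     = (Const t * Z i - Z (Suc i)) * swap_vars i (Z i * f) + (1 - Const t) * Z (Suc i) * (Z i * f)"
    unfolding T_eq by (simp add: swap_vars_simps Const_diff algebra_simps)
qed

text \<open>The interior lattice points of the segment from \<open>\<nu>\<close> to its image under
  \<open>adj i\<close>: the lower terms of \<open>T i (zmon \<nu>)\<close>.\<close>

definition mids :: "nat \<Rightarrow> exponent \<Rightarrow> exponent set" where
  "mids i \<nu> = {set_pair \<nu> i a b | a b. a + b = entry \<nu> i + entry \<nu> (Suc i) \<and>
      min (entry \<nu> i) (entry \<nu> (Suc i)) < a \<and> min (entry \<nu> i) (entry \<nu> (Suc i)) < b}"

text \<open>After a symmetric monomial is split off, the divided difference is a geometric sum. The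
  remainder is recorded as symmetric because \<open>T i\<close> then acts on it as \<open>t\<close>,
  which settles the opposite case in \<open>T_zmon_lt\<close>.\<close>

lemma T_zmon_gt:
  assumes "entry \<nu> (Suc i) < entry \<nu> i"
  obtains r where "Poly_Mapping.keys r \<subseteq> mids i \<nu>" "swap_vars i r = r"
    "T i (zmon \<nu>) = zmon (act (adj i) \<nu>) + r"
proof -
  define b where "b = entry \<nu> (Suc i)"
  obtain e where e: "entry \<nu> i = Suc (b + e)"
    using assms unfolding b_def by (metis less_iff_Suc_add)
  \<comment> \<open>The quotient of (1 - t) (xy)^(b+1) (x^e - y^e) by x - y.\<close>
  define r where "r = Const (1 - t) * (\<Sum>p<e. zmon (set_pair \<nu> i (b + p + 1) (b + e - p)))"
  let ?x = "Z i" and ?y = "Z (Suc i)" and ?m = "zmon (set_pair \<nu> i 0 0)"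
  have "Poly_Mapping.keys r \<subseteq> (\<Union>p\<in>{..<e}. {set_pair \<nu> i (b + p + 1) (b + e - p)})"
    unfolding r_def using keys_Const_mult keys_sum_subset by (fastforce split: if_splits)
  also have "\<dots> \<subseteq> mids i \<nu>"
  proof (rule UN_least)
    fix p assume "p \<in> {..<e}"
    then have "set_pair \<nu> i (b + p + 1) (b + e - p) \<in> mids i \<nu>"
      unfolding mids_def mem_Collect_eq e b_def[symmetric]
      by (intro exI[of _ "b + p + 1"] exI[of _ "b + e - p"]) auto
    then show "{set_pair \<nu> i (b + p + 1) (b + e - p)} \<subseteq> mids i \<nu>" by simp
  qed
  finally have "Poly_Mapping.keys r \<subseteq> mids i \<nu>" .
  moreover have "swap_vars i r = r"
  proof -
    have "swap_vars i r = Const (1 - t) * (\<Sum>p<e. zmon (set_pair \<nu> i (b + e - p) (b + p + 1)))"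
      by (simp add: r_def swap_vars_simps zhom_sum[OF zhom_swap_vars] swap_vars_zmon act_adj_set_pair)
    also have "(\<Sum>p<e. zmon (set_pair \<nu> i (b + e - p) (b + p + 1)))
        = (\<Sum>p<e. zmon (set_pair \<nu> i (b + p + 1) (b + e - p)))"
      by (rule sum.reindex_bij_witness[of _ "\<lambda>p. e - Suc p" "\<lambda>p. e - Suc p"])
        (auto simp: Suc_diff_Suc)
    finally show ?thesis by (simp add: r_def)
  qed
  moreover have "T i (zmon \<nu>) = zmon (act (adj i) \<nu>) + r"
  proof (rule T_eqI)
    have z: "zmon \<nu> = ?m * (?x * ?y) ^ b * (?x * ?x ^ e)"
      using zmon_set_pair[of \<nu> i "entry \<nu> i" "entry \<nu> (Suc i)"] unfolding set_pair_self
      by (simp add: e b_def[symmetric] power_add power_mult_distrib ac_simps)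
    have sz: "zmon (act (adj i) \<nu>) = ?m * (?x * ?y) ^ b * (?y * ?y ^ e)"
      unfolding act_adj_eq_set_pair
      using zmon_set_pair[of \<nu> i "entry \<nu> (Suc i)" "entry \<nu> i"]
      by (simp add: e b_def[symmetric] power_add power_mult_distrib ac_simps)
    have "(\<Sum>p<e. zmon (set_pair \<nu> i (b + p + 1) (b + e - p)))
       = (\<Sum>p<e. ?m * (?x * ?y) ^ b * (?x * ?y) * (?y ^ (e - Suc p) * ?x ^ p))"
    proof (rule sum.cong[OF refl])
      fix p assume "p \<in> {..<e}"
      then obtain k where k: "e - Suc p = k" "b + e - p = b + Suc k" by simp
      show "zmon (set_pair \<nu> i (b + p + 1) (b + e - p)) = ?m * (?x * ?y) ^ b * (?x * ?y) * (?y ^ (e - Suc p) * ?x ^ p)"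
        unfolding k zmon_set_pair[of \<nu> i "b + p + 1" "b + Suc k"]
        by (simp add: power_add power_mult_distrib ac_simps)
    qed
    then have "(?x - ?y) * r = Const (1 - t) * (?m * (?x * ?y) ^ b * (?x * ?y) * ((?x - ?y) * (\<Sum>p<e. ?y ^ (e - Suc p) * ?x ^ p)))"
      by (simp add: r_def sum_distrib_left ac_simps)
    also have "(?x - ?y) * (\<Sum>p<e. ?y ^ (e - Suc p) * ?x ^ p) = ?x ^ e - ?y ^ e"
      by (rule power_diff_sumr2[symmetric])
    finally have "(?x - ?y) * r = (1 - Const t) * (?y * zmon \<nu> - ?x * zmon (act (adj i) \<nu>))"
      unfolding z sz Const_diff Const_1
      by (simp only: right_diff_distrib left_diff_distrib mult_1_left mult_1_right) (simp only: mult_ac)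
    then show "(?x - ?y) * (zmon (act (adj i) \<nu>) + r)
      = (Const t * ?x - ?y) * swap_vars i (zmon \<nu>) + (1 - Const t) * ?y * zmon \<nu>"
      unfolding swap_vars_zmon by (simp add: algebra_simps)
  qed
  ultimately show ?thesis by (rule that)
qed

lemma act_adj_mem_mids: "\<mu> \<in> mids i \<nu> \<Longrightarrow> act (adj i) \<mu> \<in> mids i \<nu>"
  unfolding mids_def mem_Collect_eq by (metis act_adj_set_pair add.commute)

lemma mids_act_adj: "mids i (act (adj i) \<nu>) = mids i \<nu>"
proof -
  have "set_pair (act (adj i) \<nu>) i a b = set_pair \<nu> i a b" for a b
    by (rule poly_mapping_eqI) (simp add: entry_set_pair adj_eq)
  then show ?thesis
    by (simp add: mids_def min.commute add.commute)
qed

lemma self_notin_mids [simp]: "\<nu> \<notin> mids i \<nu>"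
proof
  assume "\<nu> \<in> mids i \<nu>"
  then obtain a b where ab: "\<nu> = set_pair \<nu> i a b"
    "min (entry \<nu> i) (entry \<nu> (Suc i)) < a" "min (entry \<nu> i) (entry \<nu> (Suc i)) < b"
    by (auto simp: mids_def)
  from ab(1) have "entry \<nu> i = a" "entry \<nu> (Suc i) = b"
    by (metis entry_set_pair n_not_Suc_n)+
  with ab(2,3) show False by (simp add: min_def split: if_splits)
qed

lemma act_adj_notin_mids [simp]: "act (adj i) \<nu> \<notin> mids i \<nu>"
  using act_adj_mem_mids[of "act (adj i) \<nu>" i \<nu>] by auto

lemma T_zmon_eq: "entry \<nu> i = entry \<nu> (Suc i) \<Longrightarrow> T i (zmon \<nu>) = Const t * zmon \<nu>"
  by (rule T_sym) (metis swap_vars_zmon act_adj_eq_iff)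

text \<open>Apply \<open>T i\<close> to the expansion of the exchanged monomial: the left side is
  known from the quadratic relation, and the symmetric remainder is multiplied by
  \<open>t\<close>.\<close>

lemma T_zmon_lt:
  assumes "entry \<nu> i < entry \<nu> (Suc i)"
  obtains r where "Poly_Mapping.keys r \<subseteq> mids i \<nu>" "swap_vars i r = r"
    "T i (zmon \<nu>) = Const t * zmon (act (adj i) \<nu>) + Const (t - 1) * zmon \<nu> - r"
proof -
  obtain r where r: "Poly_Mapping.keys r \<subseteq> mids i \<nu>" "swap_vars i r = r"
    "T i (zmon (act (adj i) \<nu>)) = zmon \<nu> + r"
    using T_zmon_gt[of "act (adj i) \<nu>" i] assms by (auto simp: mids_act_adj)
  have "T i (zmon \<nu>) = T i (T i (zmon (act (adj i) \<nu>))) - T i r"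
    by (simp add: r(3) T_add)
  also have "\<dots> = Const t * zmon (act (adj i) \<nu>) + Const (t - 1) * zmon \<nu> - r"
    unfolding T_T unfolding r(3) T_sym[OF r(2)] by (simp add: Const_diff algebra_simps)
  finally show ?thesis using r(1,2) that by blast
qed

lemma keys_T_zmon: "Poly_Mapping.keys (T i (zmon \<nu>)) \<subseteq> {\<nu>, act (adj i) \<nu>} \<union> mids i \<nu>"
proof (cases "entry \<nu> i" "entry \<nu> (Suc i)" rule: linorder_cases)
  case less
  then obtain r where r: "Poly_Mapping.keys r \<subseteq> mids i \<nu>"
    "T i (zmon \<nu>) = Const t * zmon (act (adj i) \<nu>) + Const (t - 1) * zmon \<nu> - r"
    by (rule T_zmon_lt)
  show ?thesis
  proof
    fix \<mu> assume "\<mu> \<in> Poly_Mapping.keys (T i (zmon \<nu>))"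
    then show "\<mu> \<in> {\<nu>, act (adj i) \<nu>} \<union> mids i \<nu>"
      using r(1) by (auto simp: r(2) in_keys_iff lookup_add lookup_minus zcoeff_zmon split: if_splits)
  qed
next
  case equal
  then show ?thesis by (auto simp: T_zmon_eq in_keys_iff zcoeff_zmon split: if_splits)
next
  case greater
  then obtain r where r: "Poly_Mapping.keys r \<subseteq> mids i \<nu>" "T i (zmon \<nu>) = zmon (act (adj i) \<nu>) + r"
    by (rule T_zmon_gt)
  show ?thesis
  proof
    fix \<mu> assume "\<mu> \<in> Poly_Mapping.keys (T i (zmon \<nu>))"
    then show "\<mu> \<in> {\<nu>, act (adj i) \<nu>} \<union> mids i \<nu>"
      using r(1) by (auto simp: r(2) in_keys_iff lookup_add zcoeff_zmon split: if_splits)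
  qed
qed

lemma keys_T:
  "Poly_Mapping.keys (T i f) \<subseteq> (\<Union>\<nu>\<in>Poly_Mapping.keys f. {\<nu>, act (adj i) \<nu>} \<union> mids i \<nu>)"
proof -
  have "T i f = T i (\<Sum>\<nu>\<in>Poly_Mapping.keys f. Const (zcoeff f \<nu>) * zmon \<nu>)"
    using zpoly_expansion[of "Poly_Mapping.keys f" f] by simp
  also have "\<dots> = (\<Sum>\<nu>\<in>Poly_Mapping.keys f. Const (zcoeff f \<nu>) * T i (zmon \<nu>))"
    by (simp only: T_sum T_Const_mult)
  finally have "Poly_Mapping.keys (T i f) \<subseteq> (\<Union>\<nu>\<in>Poly_Mapping.keys f. Poly_Mapping.keys (Const (zcoeff f \<nu>) * T i (zmon \<nu>)))"
    by (simp only: keys_sum_subset)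
  also have "\<dots> \<subseteq> (\<Union>\<nu>\<in>Poly_Mapping.keys f. {\<nu>, act (adj i) \<nu>} \<union> mids i \<nu>)"
    by (intro UN_mono order_refl subset_trans[OF keys_Const_mult keys_T_zmon])
  finally show ?thesis .
qed

lemma is_composition_mids:
  assumes "is_composition n \<nu>" "i \<in> {1..<n}" "\<mu> \<in> mids i \<nu>"
  shows "is_composition n \<mu>"
  using assms by (auto simp: is_composition_iff mids_def entry_set_pair)

lemma npoly_T:
  assumes "f \<in> npoly n" "i \<in> {1..<n}"
  shows "T i f \<in> npoly n"
  unfolding npoly_def
proof (intro CollectI ballI)
  fix \<mu> assume "\<mu> \<in> Poly_Mapping.keys (T i f)"
  then obtain \<nu> where "\<nu> \<in> Poly_Mapping.keys f" "\<mu> \<in> {\<nu>, act (adj i) \<nu>} \<union> mids i \<nu>"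
    using keys_T by blast
  moreover from this(1) have "is_composition n \<nu>"
    using assms(1) by (simp add: npoly_def)
  ultimately show "is_composition n \<mu>"
    using assms(2) is_composition_mids is_composition_act_adj by blast
qed

lemma npoly_T_inv: "f \<in> npoly n \<Longrightarrow> i \<in> {1..<n} \<Longrightarrow> T_inv i f \<in> npoly n"
  unfolding T_inv_def by (intro npoly_Const_mult npoly_add npoly_T)


section \<open>Cherednik operators\<close>

lemma zhom_\<omega>\<^sub>0: "zhom (\<omega>\<^sub>0 n)"
  by (simp add: \<omega>\<^sub>0_def zhom_subst_vars)

lemmas \<omega>\<^sub>0_simps = zhom_simps[OF zhom_\<omega>\<^sub>0]

lemma \<omega>\<^sub>0_Z: "\<omega>\<^sub>0 n (Z i) = (if i = 1 then Const q * Z n else Z (i - 1))"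
  by (simp add: \<omega>\<^sub>0_def subst_vars_Z)

text \<open>The rotation lowers the index of a Demazure-Lusztig operator by one; both sides are
  compared through the substitutions they contain.\<close>

lemma \<omega>\<^sub>0_T:
  assumes "1 \<le> i" "Suc i < n"
  shows "\<omega>\<^sub>0 n (T (Suc i) f) = T i (\<omega>\<^sub>0 n f)"
proof (rule T_eqI[symmetric])
  have swap: "\<omega>\<^sub>0 n (swap_vars (Suc i) f) = swap_vars i (\<omega>\<^sub>0 n f)"
    by (rule zhom_eq) (use assms in \<open>auto simp: zhom_def swap_vars_simps \<omega>\<^sub>0_simps \<omega>\<^sub>0_Z adj_eq\<close>)
  have "\<omega>\<^sub>0 n ((Z (Suc i) - Z (Suc (Suc i))) * T (Suc i) f) = \<omega>\<^sub>0 n ((Const t * Z (Suc i) - Z (Suc (Suc i))) * swap_vars (Suc i) f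
      + (1 - Const t) * Z (Suc (Suc i)) * f)"
    by (simp only: T_eq)
  then show "(Z i - Z (Suc i)) * \<omega>\<^sub>0 n (T (Suc i) f) = (Const t * Z i - Z (Suc i)) * swap_vars i (\<omega>\<^sub>0 n f)
      + (1 - Const t) * Z (Suc i) * \<omega>\<^sub>0 n f"
    using assms by (simp add: \<omega>\<^sub>0_simps \<omega>\<^sub>0_Z swap)
qed

lemma \<omega>\<^sub>0_T_inv: "1 \<le> i \<Longrightarrow> Suc i < n \<Longrightarrow> \<omega>\<^sub>0 n (T_inv (Suc i) f) = T_inv i (\<omega>\<^sub>0 n f)"
  by (simp add: T_inv_def \<omega>\<^sub>0_simps \<omega>\<^sub>0_T)

text \<open>The case in which the index wraps around. Two rotations turn z_1, z_2 into q z_(n-1), q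
  z_n, and the common factor q cancels because \<open>T\<close> is homogeneous of degree 0.\<close>

lemma \<omega>\<^sub>0_\<omega>\<^sub>0_T:
  assumes "2 \<le> n" "f \<in> npoly n"
  shows "\<omega>\<^sub>0 n (\<omega>\<^sub>0 n (T 1 f)) = T (n - 1) (\<omega>\<^sub>0 n (\<omega>\<^sub>0 n f))"
proof (rule T_eqI[symmetric])
  obtain m where n: "n = Suc (Suc m)" using assms(1) by (metis One_nat_def Suc_1 Suc_le_D Suc_le_mono)
  have "zhom (\<lambda>f. \<omega>\<^sub>0 n (\<omega>\<^sub>0 n (swap_vars 1 f)))" "zhom (\<lambda>f. swap_vars (n - 1) (\<omega>\<^sub>0 n (\<omega>\<^sub>0 n f)))"
    by (simp_all add: zhom_def swap_vars_simps \<omega>\<^sub>0_simps)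
  then have swap: "\<omega>\<^sub>0 n (\<omega>\<^sub>0 n (swap_vars 1 f)) = swap_vars (n - 1) (\<omega>\<^sub>0 n (\<omega>\<^sub>0 n f))"
    by (rule zhom_eq_on_npoly[OF _ _ assms(2)])
      (auto simp: n swap_vars_simps \<omega>\<^sub>0_simps \<omega>\<^sub>0_Z adj_eq numeral_2_eq_2)
  then have swap': "\<omega>\<^sub>0 (Suc (Suc m)) (\<omega>\<^sub>0 (Suc (Suc m)) (swap_vars (Suc 0) f)) = swap_vars (Suc m) (\<omega>\<^sub>0 (Suc (Suc m)) (\<omega>\<^sub>0 (Suc (Suc m)) f))"
    by (simp add: n)
  have "\<omega>\<^sub>0 n (\<omega>\<^sub>0 n ((Z 1 - Z 2) * T 1 f)) = \<omega>\<^sub>0 n (\<omega>\<^sub>0 n ((Const t * Z 1 - Z 2) * swap_vars 1 f + (1 - Const t) * Z 2 * f))"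
    using T_eq[of 1 f] by (simp add: numeral_2_eq_2)
  then have "(Const q * Z (Suc m) - Const q * Z (Suc (Suc m))) * \<omega>\<^sub>0 n (\<omega>\<^sub>0 n (T 1 f))
     = (Const t * (Const q * Z (Suc m)) - Const q * Z (Suc (Suc m))) * swap_vars (n - 1) (\<omega>\<^sub>0 n (\<omega>\<^sub>0 n f))
      + (1 - Const t) * (Const q * Z (Suc (Suc m))) * \<omega>\<^sub>0 n (\<omega>\<^sub>0 n f)"
    by (simp add: \<omega>\<^sub>0_simps \<omega>\<^sub>0_Z n swap')
  then have "Const q * ((Z (Suc m) - Z (Suc (Suc m))) * \<omega>\<^sub>0 n (\<omega>\<^sub>0 n (T 1 f)))
     = Const q * ((Const t * Z (Suc m) - Z (Suc (Suc m))) * swap_vars (n - 1) (\<omega>\<^sub>0 n (\<omega>\<^sub>0 n f))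
      + (1 - Const t) * Z (Suc (Suc m)) * \<omega>\<^sub>0 n (\<omega>\<^sub>0 n f))"
    by algebra
  then have "(Z (Suc m) - Z (Suc (Suc m))) * \<omega>\<^sub>0 n (\<omega>\<^sub>0 n (T 1 f))
     = (Const t * Z (Suc m) - Z (Suc (Suc m))) * swap_vars (n - 1) (\<omega>\<^sub>0 n (\<omega>\<^sub>0 n f))
      + (1 - Const t) * Z (Suc (Suc m)) * \<omega>\<^sub>0 n (\<omega>\<^sub>0 n f)"
    by (simp only: mult_cancel_left Const_eq_0_iff q_nonzero simp_thms)
  then show "(Z (n - 1) - Z (Suc (n - 1))) * \<omega>\<^sub>0 n (\<omega>\<^sub>0 n (T 1 f))
     = (Const t * Z (n - 1) - Z (Suc (n - 1))) * swap_vars (n - 1) (\<omega>\<^sub>0 n (\<omega>\<^sub>0 n f))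
      + (1 - Const t) * Z (Suc (n - 1)) * \<omega>\<^sub>0 n (\<omega>\<^sub>0 n f)"
    by (simp add: n)
qed

lemma \<omega>\<^sub>0_\<omega>\<^sub>0_T_inv:
  "2 \<le> n \<Longrightarrow> f \<in> npoly n \<Longrightarrow> \<omega>\<^sub>0 n (\<omega>\<^sub>0 n (T_inv 1 f)) = T_inv (n - 1) (\<omega>\<^sub>0 n (\<omega>\<^sub>0 n f))"
  using \<omega>\<^sub>0_\<omega>\<^sub>0_T[of n f] by (simp add: T_inv_def \<omega>\<^sub>0_simps)


section \<open>Relations between the Cherednik and Demazure-Lusztig operators\<close>

lemma Y_eq: "Y n i f = Const (t powi (int i - int n)) *
     foldr T [i..<n] (\<omega>\<^sub>0 n (foldr T_inv [1..<i] f))"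
  by (simp add: Y_def inv_T)

lemma foldr_T_add: "foldr T ks (f + g) = foldr T ks f + foldr T ks g"
  by (induction ks) (simp_all add: T_add)

lemma foldr_T_Const_mult: "foldr T ks (Const c * f) = Const c * foldr T ks f"
  by (induction ks) (simp_all add: T_Const_mult)

lemma foldr_T_mult_sym: "(\<And>k. k \<in> set ks \<Longrightarrow> swap_vars k g = g) \<Longrightarrow> foldr T ks (g * f) = g * foldr T ks f"
  by (induction ks) (simp_all add: T_mult_sym)

lemma foldr_T_inv_add: "foldr T_inv ks (f + g) = foldr T_inv ks f + foldr T_inv ks g"
  by (induction ks) (simp_all add: T_inv_add)

lemma foldr_T_inv_Const_mult: "foldr T_inv ks (Const c * f) = Const c * foldr T_inv ks f"
  by (induction ks) (simp_all add: T_inv_Const_mult)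

lemma foldr_T_inv_mult_sym: "(\<And>k. k \<in> set ks \<Longrightarrow> swap_vars k g = g) \<Longrightarrow> foldr T_inv ks (g * f) = g * foldr T_inv ks f"
  by (induction ks) (simp_all add: T_inv_mult_sym)

lemma npoly_foldr_T_inv: "f \<in> npoly n \<Longrightarrow> set ks \<subseteq> {1..<n} \<Longrightarrow> foldr T_inv ks f \<in> npoly n"
  by (induction ks) (simp_all add: npoly_T_inv)

lemma foldr_T_commute:
  "(\<And>k. k \<in> set ks \<Longrightarrow> Suc k < i \<or> Suc i < k) \<Longrightarrow> T i (foldr T ks f) = foldr T ks (T i f)"
proof (induction ks)
  case (Cons k ks)
  then have "T i (T k (foldr T ks f)) = T k (T i (foldr T ks f))"
    by (metis T_commute list.set_intros(1))
  with Cons show ?case by simp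
qed simp

lemma foldr_T_inv_commute:
  "(\<And>k. k \<in> set ks \<Longrightarrow> Suc k < i \<or> Suc i < k) \<Longrightarrow> T i (foldr T_inv ks f) = foldr T_inv ks (T i f)"
proof (induction ks)
  case (Cons k ks)
  then have "T i (T_inv k (foldr T_inv ks f)) = T_inv k (T i (foldr T_inv ks f))"
    by (metis T_inv_T_commute list.set_intros(1))
  with Cons show ?case by simp
qed simp

lemma \<omega>\<^sub>0_foldr_T:
  "set ks \<subseteq> {1..<n - 1} \<Longrightarrow> \<omega>\<^sub>0 n (foldr T (map Suc ks) f) = foldr T ks (\<omega>\<^sub>0 n f)"
  by (induction ks) (auto simp: \<omega>\<^sub>0_T)

lemma \<omega>\<^sub>0_foldr_T_inv:
  "set ks \<subseteq> {1..<n - 1} \<Longrightarrow> \<omega>\<^sub>0 n (foldr T_inv (map Suc ks) f) = foldr T_inv ks (\<omega>\<^sub>0 n f)"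
  by (induction ks) (auto simp: \<omega>\<^sub>0_T_inv)

lemma Y_add: "Y n i (f + g) = Y n i f + Y n i g"
  by (simp add: Y_eq foldr_T_inv_add \<omega>\<^sub>0_simps foldr_T_add distrib_left)

lemma Y_Const_mult: "Y n i (Const c * f) = Const c * Y n i f"
  by (simp add: Y_eq foldr_T_inv_Const_mult \<omega>\<^sub>0_simps foldr_T_Const_mult mult.left_commute)

lemma Y_0: "Y n i 0 = 0"
  using Y_Const_mult[of n i 0 0] by simp

lemma Y_sum: "Y n i (sum f A) = (\<Sum>x\<in>A. Y n i (f x))"
  by (induction A rule: infinite_finite_induct) (simp_all add: Y_0 Y_add)

text \<open>\<open>Y n (Suc i)\<close> ends in the inverse of \<open>T i\<close>, which cancels, and
  the \<open>T i\<close> on the left is the first factor of \<open>Y n i\<close>; the factor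
  \<open>t\<close> is the difference of the normalising powers.\<close>

lemma T_Y_T:
  assumes "i \<in> {1..<n}"
  shows "T i (Y n (Suc i) (T i f)) = Const t * Y n i f"
proof -
  have "[1..<Suc i] = [1..<i] @ [i]" "[i..<n] = i # [Suc i..<n]"
    using assms by (auto simp: upt_conv_Cons)
  moreover have "t powi (int (Suc i) - int n) = t * t powi (int i - int n)"
    using power_int_add_1'[of t "int i - int n"] by (simp add: algebra_simps)
  ultimately show ?thesis
    by (simp add: Y_eq T_Const_mult Const_mult mult.assoc del: upt_Suc)
qed

lemma upt_split: "i \<le> j \<Longrightarrow> j \<le> k \<Longrightarrow> [i..<k] = [i..<j] @ [j..<k]"
  by (metis le_add_diff_inverse upt_add_eq_append)

text \<open>\<open>T i\<close> commutes with all factors except its neighbours, where one braid move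
  lowers its index. Passing \<open>\<omega>\<^sub>0\<close> raises the index again, which gives
  \<open>T_Y_commute\<close>.\<close>

lemma T_foldr_upt:
  assumes "j < i" "i < n"
  shows "T i (foldr T [j..<n] f) = foldr T [j..<n] (T (i - 1) f)"
proof -
  obtain k where i: "i = Suc k" using assms(1) by (cases i) auto
  have upt: "[j..<n] = [j..<k] @ k # Suc k # [Suc (Suc k)..<n]"
    using assms i upt_split[of j k n] by (simp add: upt_conv_Cons)
  have "T (Suc k) (foldr T [j..<k] g) = foldr T [j..<k] (T (Suc k) g)"
    "T k (foldr T [Suc (Suc k)..<n] g) = foldr T [Suc (Suc k)..<n] (T k g)" for g
    by (rule foldr_T_commute; auto)+
  then show ?thesis
    unfolding upt i by (simp add: T_braid[symmetric])
qed

lemma T_foldr_T_inv_upt: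
  assumes "1 \<le> i" "Suc i < j"
  shows "T (Suc i) (foldr T_inv [1..<j] f) = foldr T_inv [1..<j] (T i f)"
proof -
  have upt: "[1..<j] = [1..<i] @ i # Suc i # [Suc (Suc i)..<j]"
    using assms upt_split[of 1 i j] by (simp add: upt_conv_Cons)
  \<comment> \<open>The braid relation with two factors moved to the other side; the same index
    shift for inverse operators.\<close>
  have braid: "T (Suc i) (T_inv i (T_inv (Suc i) g)) = T_inv i (T_inv (Suc i) (T i g))" for g
    using T_braid[of i "T_inv i (T_inv (Suc i) g)"] by (metis T_T_inv T_inv_T)
  have "T (Suc i) (foldr T_inv [1..<i] g) = foldr T_inv [1..<i] (T (Suc i) g)"
    "T i (foldr T_inv [Suc (Suc i)..<j] g) = foldr T_inv [Suc (Suc i)..<j] (T i g)" for g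
    by (rule foldr_T_inv_commute; auto)+
  then show ?thesis
    unfolding upt by (simp add: braid)
qed

lemma T_Y_commute:
  assumes "i \<in> {1..<n}" "j \<in> {1..n}" "j \<noteq> i" "j \<noteq> Suc i"
  shows "T i (Y n j f) = Y n j (T i f)"
proof (cases "j < i")
  case True
  then have "1 \<le> i - 1" "Suc (i - 1) = i" using assms by auto
  then have "T i (foldr T [j..<n] (\<omega>\<^sub>0 n g)) = foldr T [j..<n] (\<omega>\<^sub>0 n (T i g))" for g
    using T_foldr_upt[OF True, of n] \<omega>\<^sub>0_T[of "i - 1" n g] assms by simp
  moreover have "T i (foldr T_inv [1..<j] f) = foldr T_inv [1..<j] (T i f)"
    by (rule foldr_T_inv_commute) (use True in auto)
  ultimately show ?thesis
    by (simp add: Y_eq T_Const_mult)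
next
  case False
  then have ij: "Suc i < j" using assms by simp
  then have "T i (foldr T [j..<n] g) = foldr T [j..<n] (T i g)" for g
    by (intro foldr_T_commute) auto
  moreover have "T i (\<omega>\<^sub>0 n g) = \<omega>\<^sub>0 n (T (Suc i) g)" for g
    using ij assms \<omega>\<^sub>0_T[of i n] by simp
  ultimately show ?thesis
    using ij assms T_foldr_T_inv_upt[of i j f] by (simp add: Y_eq T_Const_mult)
qed

section \<open>Relations between the Cherednik operators and the degree-raising operator\<close>

definition Phi :: "nat \<Rightarrow> zpoly \<Rightarrow> zpoly" where
  "Phi n f = Z n * \<omega>\<^sub>0 n f"

lemma Phi_Const_mult: "Phi n (Const c * f) = Const c * Phi n f"
  by (simp add: Phi_def \<omega>\<^sub>0_simps mult.left_commute)

lemma swap_vars_Z_other: "k \<noteq> i \<Longrightarrow> k \<noteq> Suc i \<Longrightarrow> swap_vars i (Z k) = Z k"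
  by (simp add: adj_other)

text \<open>The last factor T_(n-1) of \<open>Y n i\<close> meets z_(n-1), the image of z_n under
  \<open>\<omega>\<^sub>0\<close>, and becomes t z_n times its inverse. Moved through two rotations
  this inverse becomes that of T_1, exactly the factor which \<open>Y n (Suc i)\<close> has in
  addition.\<close>

lemma Y_Phi:
  assumes "i \<in> {1..<n}" "f \<in> npoly n"
  shows "Y n i (Phi n f) = Phi n (Y n (Suc i) f)"
proof -
  obtain m where n: "n = Suc (Suc m)" using assms(1)
    by (cases n; cases "n - 1") auto
  \<comment> \<open>The inverse factors of \<open>Y n (Suc i)\<close> without that of T_1, which is
    recovered at the end by wrapping around.\<close>
  define g where "g = foldr T_inv (map Suc [1..<i]) f"
  have g: "g \<in> npoly n"
    unfolding g_def by (rule npoly_foldr_T_inv) (use assms in auto)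
  have upt1: "foldr T_inv [1..<Suc i] f = T_inv 1 g"
    using assms by (simp add: g_def upt_conv_Cons map_Suc_upt del: upt_Suc)
  have upt2: "[i..<n] = [i..<Suc m] @ [Suc m]" "[Suc i..<n] = map Suc [i..<Suc m]"
    using assms by (auto simp: n map_Suc_upt)
  have "foldr T_inv [1..<i] (Phi n f) = Z n * foldr T_inv [1..<i] (\<omega>\<^sub>0 n f)"
    unfolding Phi_def by (rule foldr_T_inv_mult_sym) (use assms in \<open>auto intro!: swap_vars_Z_other simp del: swap_vars_Z\<close>)
  also have "foldr T_inv [1..<i] (\<omega>\<^sub>0 n f) = \<omega>\<^sub>0 n g"
    unfolding g_def by (rule \<omega>\<^sub>0_foldr_T_inv[symmetric]) (use assms in auto)
  finally have "\<omega>\<^sub>0 n (foldr T_inv [1..<i] (Phi n f)) = Z (Suc m) * \<omega>\<^sub>0 n (\<omega>\<^sub>0 n g)"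
    by (simp add: \<omega>\<^sub>0_simps \<omega>\<^sub>0_Z n)
  then have "foldr T [i..<n] (\<omega>\<^sub>0 n (foldr T_inv [1..<i] (Phi n f)))
     = foldr T [i..<Suc m] (T (Suc m) (Z (Suc m) * \<omega>\<^sub>0 n (\<omega>\<^sub>0 n g)))"
    by (simp add: upt2(1))
  also have "T (Suc m) (Z (Suc m) * \<omega>\<^sub>0 n (\<omega>\<^sub>0 n g)) = Const t * (Z n * T_inv (n - 1) (\<omega>\<^sub>0 n (\<omega>\<^sub>0 n g)))"
    by (simp add: T_Z_left n mult.assoc)
  also have "T_inv (n - 1) (\<omega>\<^sub>0 n (\<omega>\<^sub>0 n g)) = \<omega>\<^sub>0 n (\<omega>\<^sub>0 n (T_inv 1 g))"
    using \<omega>\<^sub>0_\<omega>\<^sub>0_T_inv[of n g] g n by simp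
  also have "foldr T [i..<Suc m] (Const t * (Z n * \<omega>\<^sub>0 n (\<omega>\<^sub>0 n (T_inv 1 g))))
     = Const t * (Z n * foldr T [i..<Suc m] (\<omega>\<^sub>0 n (\<omega>\<^sub>0 n (T_inv 1 g))))"
    unfolding foldr_T_Const_mult
    by (subst foldr_T_mult_sym) (auto simp: n adj_other)
  also have "foldr T [i..<Suc m] (\<omega>\<^sub>0 n (\<omega>\<^sub>0 n (T_inv 1 g))) = \<omega>\<^sub>0 n (foldr T [Suc i..<n] (\<omega>\<^sub>0 n (T_inv 1 g)))"
    unfolding upt2(2) by (rule \<omega>\<^sub>0_foldr_T[symmetric]) (use assms n in auto)
  finally have "foldr T [i..<n] (\<omega>\<^sub>0 n (foldr T_inv [1..<i] (Phi n f)))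
     = Const t * (Z n * \<omega>\<^sub>0 n (foldr T [Suc i..<n] (\<omega>\<^sub>0 n (foldr T_inv [1..<Suc i] f))))"
    by (simp only: upt1)
  moreover have "t powi (int (Suc i) - int n) = t * t powi (int i - int n)"
    using power_int_add_1'[of t "int i - int n"] by (simp add: algebra_simps)
  ultimately show ?thesis
    unfolding Y_eq Phi_def by (simp add: \<omega>\<^sub>0_simps Const_mult ac_simps del: upt_Suc)
qed

lemma T_inv_Z_right: "T_inv i (Z (Suc i) * f) = Const (1 / t) * (Z i * T i f)"
proof -
  have "T i (Const (1 / t) * (Z i * T i f)) = Z (Suc i) * f"
    unfolding T_Const_mult T_Z_left by (simp add: Const_inverse_mult flip: mult.assoc)
  then show ?thesis by (metis T_inv_T)
qed

lemma foldr_T_inv_Z: "1 \<le> m \<Longrightarrow> foldr T_inv [1..<m] (Z m * f) = Const ((1 / t) ^ (m - 1)) * (Z 1 * foldr T [1..<m] f)"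
proof (induction m arbitrary: f rule: nat_induct_at_least)
  case (Suc m)
  then obtain k where m: "m = Suc k" by (cases m) auto
  have "foldr T_inv [1..<Suc m] (Z (Suc m) * f) = foldr T_inv [1..<m] (Const (1 / t) * (Z m * T m f))"
    using Suc.hyps by (simp add: T_inv_Z_right)
  also have "\<dots> = Const (1 / t) * (Const ((1 / t) ^ (m - 1)) * (Z 1 * foldr T [1..<m] (T m f)))"
    by (simp only: foldr_T_inv_Const_mult Suc.IH)
  finally show ?case using Suc.hyps by (simp add: m flip: Const_mult mult.assoc)
qed simp

text \<open>All inverse factors are absorbed by the variable, which travels from z_n to z_1 and
  turns them into T_1, ..., T_(n-1). The rotation then sends z_1 to q z_n, whence the factor
  q.\<close>

lemma Y_Phi_last:
  assumes "1 \<le> n"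
  shows "Y n n (Phi n f) = Const q * Phi n (Y n 1 f)"
proof -
  have "(1 / t) ^ (n - 1) = t powi (1 - int n)"
    using assms by (simp add: power_int_def of_nat_diff nat_diff_distrib' power_inverse divide_inverse)
  then have "Y n n (Phi n f) = \<omega>\<^sub>0 n (Const (t powi (1 - int n)) * (Z 1 * foldr T [1..<n] (\<omega>\<^sub>0 n f)))"
    using foldr_T_inv_Z[OF assms, of "\<omega>\<^sub>0 n f"] by (simp add: Y_eq Phi_def)
  also have "\<dots> = Const q * Phi n (Y n 1 f)"
    by (simp add: \<omega>\<^sub>0_simps \<omega>\<^sub>0_Z Phi_def Y_eq ac_simps)
  finally show ?thesis .
qed


section \<open>The Bruhat order on compositions\<close>

text \<open>A permutation-invariant quantity; comparing it for all thresholds \<open>c\<close>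
  yields dominance of the sorted compositions without sorting them
  (\<open>decreasing_partial_sum_le\<close>).\<close>

definition excess :: "nat \<Rightarrow> nat \<Rightarrow> exponent \<Rightarrow> nat" where
  "excess n c \<nu> = (\<Sum>k=1..n. entry \<nu> k - c)"

text \<open>Extended by \<open>\<eta>\<^sub>k\<^sub>+\<^sub>n = \<eta>\<^sub>k + 1\<close>, a composition becomes a sequence indexed by the integers, and the
  affine rank counts the positions \<open>k \<le> p\<close> with \<open>\<eta>\<^sub>k \<ge> c\<close>. Comparing these numbers gives the Bruhat
  order of the affine symmetric group; the operator \<open>shift\<close> below becomes a mere translation.\<close>

definition affine_rank :: "nat \<Rightarrow> nat \<Rightarrow> nat \<Rightarrow> exponent \<Rightarrow> nat" where
  "affine_rank n c p \<nu> = excess n c \<nu> + (\<Sum>k=1..p. of_bool (c \<le> entry \<nu> k))"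

definition below :: "nat \<Rightarrow> exponent \<Rightarrow> exponent \<Rightarrow> bool" where
  "below n \<nu> \<eta> \<longleftrightarrow> is_composition n \<nu> \<and> modulus n \<nu> = modulus n \<eta> \<and>
     (\<forall>c. \<forall>p\<le>n. affine_rank n c p \<nu> \<le> affine_rank n c p \<eta>)"

lemma affine_rank_0: "affine_rank n c 0 \<nu> = excess n c \<nu>"
  by (simp add: affine_rank_def)

lemma affine_rank_Suc: "affine_rank n c (Suc p) \<nu> = affine_rank n c p \<nu> + of_bool (c \<le> entry \<nu> (Suc p))"
  by (simp add: affine_rank_def)

text \<open>Periodicity of the extended sequence: a full period further to the right the threshold
  rises by one.\<close>

lemma affine_rank_last: "affine_rank n (Suc c) n \<nu> = excess n c \<nu>"
  unfolding affine_rank_def excess_def sum.distrib[symmetric]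
  by (rule sum.cong) (auto simp: of_bool_def)

lemma below_refl: "is_composition n \<nu> \<Longrightarrow> below n \<nu> \<nu>"
  by (simp add: below_def)

lemma below_trans:
  assumes "below n \<mu> \<nu>" "below n \<nu> \<eta>"
  shows "below n \<mu> \<eta>"
  unfolding below_def
proof (intro conjI allI impI)
  fix c p assume "p \<le> n"
  then show "affine_rank n c p \<mu> \<le> affine_rank n c p \<eta>"
    using assms by (meson below_def order_trans)
qed (use assms in \<open>simp_all add: below_def\<close>)

lemma below_excess: "below n \<nu> \<eta> \<Longrightarrow> excess n c \<nu> \<le> excess n c \<eta>"
  unfolding below_def by (metis affine_rank_0 le0)

lemma composition_eqI:
  assumes "is_composition n \<mu>" "is_composition n \<nu>" "\<And>k. k \<in> {1..n} \<Longrightarrow> entry \<mu> k = entry \<nu> k"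
  shows "\<mu> = \<nu>"
  by (rule poly_mapping_eqI) (use assms in \<open>metis is_composition_iff\<close>)

lemma below_antisym:
  assumes "below n \<mu> \<nu>" "below n \<nu> \<mu>"
  shows "\<mu> = \<nu>"
proof (rule composition_eqI[of n])
  fix k assume "k \<in> {1..n}"
  then obtain p where k: "k = Suc p" "Suc p \<le> n" by (cases k) auto
  have "affine_rank n c p' \<mu> = affine_rank n c p' \<nu>" if "p' \<le> n" for c p'
    using assms that by (simp add: below_def order_antisym)
  then have "of_bool (c \<le> entry \<mu> k) = (of_bool (c \<le> entry \<nu> k) :: nat)" for c
    using k affine_rank_Suc[of n c p] by (metis Suc_leD add_left_cancel)
  then have "c \<le> entry \<mu> k \<longleftrightarrow> c \<le> entry \<nu> k" for c
    by (metis of_bool_eq_iff)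
  then show "entry \<mu> k = entry \<nu> k"
    by (metis order_antisym order_refl)
qed (use assms in \<open>auto simp: below_def\<close>)

lemma finite_below: "finite {\<nu>. below n \<nu> \<eta>}"
proof -
  let ?N = "modulus n \<eta>"
  have "{\<nu>. below n \<nu> \<eta>} \<subseteq> {\<nu>. Poly_Mapping.keys \<nu> \<subseteq> {1..n} \<and> (\<forall>k. entry \<nu> k \<le> ?N)}"
  proof
    fix \<nu> assume "\<nu> \<in> {\<nu>. below n \<nu> \<eta>}"
    then have *: "is_composition n \<nu>" "modulus n \<nu> = ?N" by (auto simp: below_def)
    then have "entry \<nu> k \<le> ?N" for k
      using member_le_sum[of k "{1..n}" "entry \<nu>"]
      by (cases "k \<in> {1..n}") (auto simp: modulus_def is_composition_iff)
    then show "\<nu> \<in> {\<nu>. Poly_Mapping.keys \<nu> \<subseteq> {1..n} \<and> (\<forall>k. entry \<nu> k \<le> ?N)}"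
      using * by (simp add: is_composition_def)
  qed
  moreover have "finite {\<nu> :: exponent. Poly_Mapping.keys \<nu> \<subseteq> {1..n} \<and> (\<forall>k. entry \<nu> k \<le> ?N)}" (is "finite ?S")
  proof -
    have "finite {f :: nat \<Rightarrow> nat. \<forall>k. (k \<in> {1..n} \<longrightarrow> f k \<in> {..?N}) \<and> (k \<notin> {1..n} \<longrightarrow> f k = 0)}"
      (is "finite ?F") by (rule finite_set_of_finite_funs) simp_all
    moreover have "entry ` ?S \<subseteq> ?F"
    proof (rule image_subsetI)
      fix \<nu> assume "\<nu> \<in> ?S"
      then have \<nu>: "\<forall>k. entry \<nu> k \<le> ?N" "Poly_Mapping.keys \<nu> \<subseteq> {1..n}" by simp_all
      have "\<forall>k. k \<notin> {1..n} \<longrightarrow> entry \<nu> k = 0"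
        using \<nu>(2) by (metis in_keys_iff subsetD)
      with \<nu>(1) show "entry \<nu> \<in> ?F" by simp
    qed
    ultimately have "finite (entry ` ?S)" by (rule finite_subset[rotated])
    moreover have "inj_on entry ?S"
      by (rule inj_onI) (rule poly_mapping_eq_iff[THEN iffD2])
    ultimately show ?thesis by (rule finite_imageD)
  qed
  ultimately show ?thesis by (rule finite_subset)
qed

lemma sum_adj:
  assumes "i \<in> {1..<n}"
  shows "(\<Sum>k=1..n. f (adj i k)) = (\<Sum>k=1..n. f k)"
  by (rule sum.reindex_bij_witness[of _ "adj i" "adj i"]) (use assms in \<open>auto simp: adj_eq\<close>)

lemma modulus_act_adj: "i \<in> {1..<n} \<Longrightarrow> modulus n (act (adj i) \<nu>) = modulus n \<nu>"
  unfolding modulus_def entry_act_adj by (rule sum_adj)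

lemma excess_act_adj: "i \<in> {1..<n} \<Longrightarrow> excess n c (act (adj i) \<nu>) = excess n c \<nu>"
  unfolding excess_def entry_act_adj by (rule sum_adj)

lemma affine_rank_act_adj:
  assumes "i \<in> {1..<n}" "p \<noteq> i"
  shows "affine_rank n c p (act (adj i) \<nu>) = affine_rank n c p \<nu>"
proof -
  have "(\<Sum>k=1..p. of_bool (c \<le> entry \<nu> (adj i k))) = (\<Sum>k=1..p. of_bool (c \<le> entry \<nu> k) :: nat)"
  proof (cases "p < i")
    case True
    then show ?thesis by (intro sum.cong) (auto simp: adj_eq)
  next
    case False
    then show ?thesis using assms by (intro sum_adj[of i p]) auto
  qed
  then show ?thesis using assms by (simp add: affine_rank_def excess_act_adj)
qed

lemma affine_rank_act_adj_same:
  assumes "i \<in> {1..<n}"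
  shows "affine_rank n c i (act (adj i) \<nu>) = affine_rank n c (i - 1) \<nu> + of_bool (c \<le> entry \<nu> (Suc i))"
proof -
  obtain j where "i = Suc j" using assms by (cases i) auto
  then show ?thesis using affine_rank_act_adj[OF assms, of "i - 1" c \<nu>] by (simp add: affine_rank_Suc)
qed

text \<open>The lifting property of the Bruhat order. It fails for the dominance order on a single
  orbit, which is why \<^const>\<open>below\<close> is used instead.\<close>

lemma below_act_adj:
  assumes "i \<in> {1..<n}" "below n \<nu> \<eta>" "entry \<eta> i \<le> entry \<eta> (Suc i)"
  shows "below n (act (adj i) \<nu>) (act (adj i) \<eta>)" "below n \<nu> (act (adj i) \<eta>)"
proof -
  obtain j where i: "i = Suc j" using assms by (cases i) auto
  have le: "affine_rank n c p \<nu> \<le> affine_rank n c p \<eta>" if "p \<le> n" for c p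
    using assms(2) that by (simp add: below_def)
  \<comment> \<open>The exchange affects the rank at position i only; it is bounded through the
    ranks at i - 1, i and i + 1.\<close>
  have 1: "affine_rank n c i (act (adj i) \<nu>) \<le> affine_rank n c i (act (adj i) \<eta>)" for c
    using le[of j c] le[of i c] le[of "Suc i" c] assms(1,3)
    unfolding affine_rank_act_adj_same[OF assms(1)]
    by (auto simp: i affine_rank_Suc of_bool_def split: if_splits)
  have 2: "affine_rank n c i \<nu> \<le> affine_rank n c i (act (adj i) \<eta>)" for c
    using le[of j c] le[of i c] assms(1,3)
    unfolding affine_rank_act_adj_same[OF assms(1)]
    by (auto simp: i affine_rank_Suc of_bool_def split: if_splits)
  have comp: "is_composition n \<nu>" "modulus n \<nu> = modulus n \<eta>"
    using assms(2) by (auto simp: below_def)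
  show "below n (act (adj i) \<nu>) (act (adj i) \<eta>)"
    unfolding below_def using assms(1) comp 1 le
    by (metis affine_rank_act_adj is_composition_act_adj modulus_act_adj)
  show "below n \<nu> (act (adj i) \<eta>)"
    unfolding below_def using assms(1) comp 2 le
    by (metis affine_rank_act_adj modulus_act_adj)
qed

lemma sum_pair:
  fixes f :: "nat \<Rightarrow> nat"
  assumes "i \<in> {1..<n}"
  shows "(\<Sum>k=1..n. f k) = f i + f (Suc i) + (\<Sum>k\<in>{1..n} - {i, Suc i}. f k)"
  using sum.subset_diff[of "{i, Suc i}" "{1..n}" f] assms by simp

text \<open>Convexity of the truncated difference: for a fixed sum, the more spread out pair (with
  smaller entry b') dominates at every threshold.\<close>

lemma diff_sum_convex:
  fixes a b :: nat
  assumes "a + b = a' + b'" "b' \<le> a" "b' \<le> b"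
  shows "(a - c) + (b - c) \<le> (a' - c) + (b' - c)"
  using assms by linarith

text \<open>An indicator acts like raising the entry by one, so the positional part of the rank
  falls under the same convexity argument.\<close>

lemma diff_add_of_bool: "x - c + of_bool (c \<le> x) = Suc x - (c::nat)"
  by auto

lemma mids_excess:
  assumes "i \<in> {1..<n}" "\<mu> \<in> mids i \<nu>"
  shows "excess n c \<mu> \<le> excess n c \<nu>" "\<exists>c. excess n c \<mu> < excess n c \<nu>"
proof -
  obtain a b where \<mu>: "\<mu> = set_pair \<nu> i a b" "a + b = entry \<nu> i + entry \<nu> (Suc i)"
    "min (entry \<nu> i) (entry \<nu> (Suc i)) < a" "min (entry \<nu> i) (entry \<nu> (Suc i)) < b"
    using assms(2) by (auto simp: mids_def)
  have rest: "(\<Sum>k\<in>{1..n} - {i, Suc i}. entry \<mu> k - c) = (\<Sum>k\<in>{1..n} - {i, Suc i}. entry \<nu> k - c)" for c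
    by (rule sum.cong) (auto simp: \<mu>(1) entry_set_pair)
  have ent: "entry \<mu> i = a" "entry \<mu> (Suc i) = b" by (simp_all add: \<mu>(1) entry_set_pair)
  have "(a - c) + (b - c) \<le> (entry \<nu> i - c) + (entry \<nu> (Suc i) - c)"
  proof (cases "entry \<nu> i \<le> entry \<nu> (Suc i)")
    case True
    then show ?thesis
      using diff_sum_convex[of a b "entry \<nu> (Suc i)" "entry \<nu> i" c] \<mu>(2-4) by simp
  next
    case False
    then show ?thesis
      using diff_sum_convex[of a b "entry \<nu> i" "entry \<nu> (Suc i)" c] \<mu>(2-4) by simp
  qed
  then show "excess n c \<mu> \<le> excess n c \<nu>"
    unfolding excess_def sum_pair[OF assms(1)] rest ent by (rule add_right_mono)
  \<comment> \<open>At this threshold nothing of the inner pair is left over, while the larger entry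
    of the outer pair still exceeds it.\<close>
  define c where "c = max a b"
  have "a - c = 0" "b - c = 0" by (simp_all add: c_def)
  moreover have "c < max (entry \<nu> i) (entry \<nu> (Suc i))"
    using \<mu>(2-4) by (simp add: c_def max_def min_def split: if_splits)
  then have "0 < (entry \<nu> i - c) + (entry \<nu> (Suc i) - c)"
    by (simp add: max_def split: if_splits)
  ultimately have "excess n c \<mu> < excess n c \<nu>"
    unfolding excess_def sum_pair[OF assms(1)] rest ent by simp
  then show "\<exists>c. excess n c \<mu> < excess n c \<nu>" ..
qed

text \<open>Convexity at every threshold: before position i only the excess differs, at i one entry
  carries an indicator, and from i + 1 on both do.\<close>

lemma mids_below:
  assumes "i \<in> {1..<n}" "\<mu> \<in> mids i \<nu>" "is_composition n \<nu>" "entry \<nu> (Suc i) \<le> entry \<nu> i"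
  shows "below n \<mu> \<nu>"
proof -
  obtain a b where \<mu>: "\<mu> = set_pair \<nu> i a b" "a + b = entry \<nu> i + entry \<nu> (Suc i)"
    "entry \<nu> (Suc i) < a" "entry \<nu> (Suc i) < b"
    using assms(2,4) by (auto simp: mids_def)
  have ent: "entry \<mu> i = a" "entry \<mu> (Suc i) = b" by (simp_all add: \<mu>(1) entry_set_pair)
  have rest: "(\<Sum>k\<in>{1..p} - {i, Suc i}. f (entry \<mu> k)) = (\<Sum>k\<in>{1..p} - {i, Suc i}. f (entry \<nu> k))"
    for f :: "nat \<Rightarrow> nat" and p
    by (rule sum.cong) (auto simp: \<mu>(1) entry_set_pair)
  have "affine_rank n c p \<mu> \<le> affine_rank n c p \<nu>" if "p \<le> n" for c p
  proof -
    consider "p < i" | "p = i" | "Suc i \<le> p" by linarith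
    then show ?thesis
    proof cases
      case 1
      then have "(\<Sum>k=1..p. of_bool (c \<le> entry \<mu> k)) = (\<Sum>k=1..p. of_bool (c \<le> entry \<nu> k) :: nat)"
        by (intro sum.cong) (auto simp: \<mu>(1) entry_set_pair)
      then show ?thesis
        using mids_excess(1)[OF assms(1,2)] by (simp add: affine_rank_def)
    next
      case 2
      obtain j where j: "i = Suc j" using assms(1) by (cases i) auto
      have "(\<Sum>k=1..j. of_bool (c \<le> entry \<mu> k)) = (\<Sum>k=1..j. of_bool (c \<le> entry \<nu> k) :: nat)"
        by (intro sum.cong) (auto simp: \<mu>(1) entry_set_pair j)
      moreover have "(a - c + of_bool (c \<le> a)) + (b - c)
          \<le> (entry \<nu> i - c + of_bool (c \<le> entry \<nu> i)) + (entry \<nu> (Suc i) - c)"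
        unfolding diff_add_of_bool by (rule diff_sum_convex) (use \<mu>(2-4) in auto)
      moreover have "affine_rank n c i \<nu>' = entry \<nu>' i - c + (entry \<nu>' (Suc i) - c)
          + (\<Sum>k\<in>{1..n} - {i, Suc i}. entry \<nu>' k - c)
          + (\<Sum>k=1..j. of_bool (c \<le> entry \<nu>' k)) + of_bool (c \<le> entry \<nu>' i)" for \<nu>'
        unfolding j affine_rank_Suc affine_rank_def excess_def sum_pair[OF assms(1)[unfolded j]] by simp
      ultimately show ?thesis
        unfolding 2 using ent rest[where p = n and f = "\<lambda>x. x - c"] by simp
    next
      case 3
      have p: "i \<in> {1..<p}" using 3 assms(1) by auto
      have "(a - c + of_bool (c \<le> a)) + (b - c + of_bool (c \<le> b))
          \<le> (entry \<nu> i - c + of_bool (c \<le> entry \<nu> i)) + (entry \<nu> (Suc i) - c + of_bool (c \<le> entry \<nu> (Suc i)))"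
        unfolding diff_add_of_bool by (rule diff_sum_convex) (use \<mu>(2-4) in auto)
      then have le: "a - c + (b - c) + (of_bool (c \<le> a) + of_bool (c \<le> b))
          \<le> entry \<nu> i - c + (entry \<nu> (Suc i) - c) + (of_bool (c \<le> entry \<nu> i) + of_bool (c \<le> entry \<nu> (Suc i)))"
        by (simp only: ac_simps)
      have split: "affine_rank n c p \<nu>' = (entry \<nu>' i - c + (entry \<nu>' (Suc i) - c)
          + (of_bool (c \<le> entry \<nu>' i) + of_bool (c \<le> entry \<nu>' (Suc i))))
          + ((\<Sum>k\<in>{1..n} - {i, Suc i}. entry \<nu>' k - c) + (\<Sum>k\<in>{1..p} - {i, Suc i}. of_bool (c \<le> entry \<nu>' k)))" for \<nu>'
        using sum_pair[OF assms(1), of "\<lambda>k. entry \<nu>' k - c"] sum_pair[OF p, of "\<lambda>k. of_bool (c \<le> entry \<nu>' k)"]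
        unfolding affine_rank_def excess_def by linarith
      show ?thesis
        unfolding split[of \<mu>] split[of \<nu>] ent rest[of "\<lambda>x. x - c"] rest[of "\<lambda>x. of_bool (c \<le> x)"]
        using le by (rule add_right_mono)
    qed
  qed
  moreover have "modulus n \<mu> = modulus n \<nu>"
    unfolding modulus_def sum_pair[OF assms(1)] ent using rest[of "\<lambda>x. x" n] \<mu>(2) by simp
  ultimately show ?thesis
    using is_composition_mids[OF assms(3,1,2)] by (simp add: below_def)
qed

lemma sum_head:
  fixes f :: "nat \<Rightarrow> nat"
  shows "(\<Sum>k=1..Suc p. f k) = f 1 + (\<Sum>k=1..p. f (Suc k))"
  by (simp add: sum.atLeast_Suc_atMost sum.shift_bounds_cl_Suc_ivl del: sum.cl_ivl_Suc)

text \<open>Every monomial of \<open>T i\<close> applied to something below \<open>\<eta>\<close>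
  stays below the raised composition. An intermediate exponent is compared through whichever of
  \<open>\<nu>\<close> and its exchange has the larger entry first.\<close>

lemma below_T_raise:
  assumes "i \<in> {1..<n}" "below n \<nu> \<eta>" "entry \<eta> i \<le> entry \<eta> (Suc i)"
    and "\<mu> \<in> {\<nu>, act (adj i) \<nu>} \<union> mids i \<nu>"
  shows "below n \<mu> (act (adj i) \<eta>)"
proof -
  note b = below_act_adj[OF assms(1-3)]
  show ?thesis
  proof (cases "\<mu> \<in> mids i \<nu>")
    case True
    have \<nu>: "is_composition n \<nu>" using assms(2) by (simp add: below_def)
    show ?thesis
    proof (cases "entry \<nu> (Suc i) \<le> entry \<nu> i")
      case le: True
      show ?thesis by (rule below_trans[OF mids_below[OF assms(1) True \<nu> le] b(2)])
    next
      case False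
      then have "below n \<mu> (act (adj i) \<nu>)"
        using assms(1) True \<nu> by (intro mids_below) (auto simp: mids_act_adj is_composition_act_adj)
      then show ?thesis using b(1) by (rule below_trans)
    qed
  qed (use assms(4) b in auto)
qed


section \<open>The rotation of exponents underlying \<open>Phi\<close>\<close>

definition shift :: "nat \<Rightarrow> exponent \<Rightarrow> exponent" where
  "shift n \<nu> = (\<Sum>k\<in>{1..n}. Poly_Mapping.single k (if k = n then Suc (entry \<nu> 1) else entry \<nu> (Suc k)))"

lemma entry_shift:
  "entry (shift n \<nu>) k = (if k \<in> {1..n} then if k = n then Suc (entry \<nu> 1) else entry \<nu> (Suc k) else 0)"
proof -
  have "entry (shift n \<nu>) k = (\<Sum>j\<in>{1..n}. if j = k then if k = n then Suc (entry \<nu> 1) else entry \<nu> (Suc k) else 0)"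
    unfolding shift_def lookup_sum by (rule sum.cong) (auto simp: lookup_single when_def)
  then show ?thesis by (simp del: One_nat_def)
qed

lemma is_composition_shift: "is_composition n (shift n \<nu>)"
  by (auto simp: is_composition_iff entry_shift)

lemma sum_shift:
  fixes f :: "nat \<Rightarrow> nat"
  assumes "1 \<le> n"
  shows "(\<Sum>k=1..n. f (entry (shift n \<nu>) k)) + f (entry \<nu> 1) = (\<Sum>k=1..n. f (entry \<nu> k)) + f (Suc (entry \<nu> 1))"
proof -
  obtain m where n: "n = Suc m" using assms by (cases n) auto
  have "(\<Sum>k=1..m. f (entry (shift n \<nu>) k)) = (\<Sum>k=1..m. f (entry \<nu> (Suc k)))"
    by (rule sum.cong) (auto simp: entry_shift n)
  then have 1: "(\<Sum>k=1..n. f (entry (shift n \<nu>) k)) = (\<Sum>k=1..m. f (entry \<nu> (Suc k))) + f (Suc (entry \<nu> 1))"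
    by (simp add: n entry_shift)
  show ?thesis
    unfolding 1 unfolding n sum_head by simp
qed

lemma affine_rank_shift:
  assumes "p < n"
  shows "affine_rank n c p (shift n \<nu>) = affine_rank n c (Suc p) \<nu>"
proof -
  have "excess n c (shift n \<nu>) = excess n c \<nu> + of_bool (c \<le> entry \<nu> 1)"
    using sum_shift[of n "\<lambda>x. x - c" \<nu>] assms by (auto simp: excess_def of_bool_def)
  moreover have "(\<Sum>k=1..p. of_bool (c \<le> entry (shift n \<nu>) k)) = (\<Sum>k=1..p. of_bool (c \<le> entry \<nu> (Suc k)) :: nat)"
    by (rule sum.cong) (use assms in \<open>auto simp: entry_shift\<close>)
  ultimately show ?thesis unfolding affine_rank_def sum_head by simp
qed

lemma modulus_shift: "1 \<le> n \<Longrightarrow> modulus n (shift n \<nu>) = Suc (modulus n \<nu>)"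
  using sum_shift[of n "\<lambda>x. x" \<nu>] by (simp add: modulus_def)

lemma below_shift:
  assumes "1 \<le> n" "below n \<nu> \<eta>"
  shows "below n (shift n \<nu>) (shift n \<eta>)"
proof -
  have le: "affine_rank n c p \<nu> \<le> affine_rank n c p \<eta>" if "p \<le> n" for c p
    using assms(2) that by (simp add: below_def)
  have m: "modulus n (shift n \<nu>) = modulus n (shift n \<eta>)"
    using assms by (simp add: modulus_shift below_def)
  have "affine_rank n c p (shift n \<nu>) \<le> affine_rank n c p (shift n \<eta>)" if "p \<le> n" for c p
  \<comment> \<open>The translation formula covers p < n. At p = n, threshold 0 gives the modulus
    plus n, and a positive threshold is reduced by periodicity to position 0.\<close>
  proof (cases "p < n")
    case True
    then show ?thesis using le[of "Suc p" c] by (simp add: affine_rank_shift)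
  next
    case False
    show ?thesis
    proof (cases c)
      case 0
      then show ?thesis using m by (simp add: affine_rank_def excess_def modulus_def)
    next
      case (Suc b)
      have "p = n" using that False by simp
      then show ?thesis
        using affine_rank_shift[of 0 n b \<nu>] affine_rank_shift[of 0 n b \<eta>] le[of 1 b] assms(1)
        by (simp add: Suc affine_rank_last affine_rank_0)
    qed
  qed
  with m show ?thesis by (simp add: below_def is_composition_shift)
qed

lemma shift_inject:
  assumes "1 \<le> n" "is_composition n \<mu>" "is_composition n \<nu>" "shift n \<mu> = shift n \<nu>"
  shows "\<mu> = \<nu>"
proof (rule composition_eqI[OF assms(2,3)])
  fix k assume k: "k \<in> {1..n}"
  have "entry (shift n \<mu>) (if k = 1 then n else k - 1) = entry (shift n \<nu>) (if k = 1 then n else k - 1)"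
    by (simp only: assms(4))
  then show "entry \<mu> k = entry \<nu> k"
    using k assms(1) by (auto simp: entry_shift split: if_splits)
qed

lemma Phi_zmon:
  assumes "1 \<le> n" "is_composition n \<nu>"
  shows "Phi n (zmon \<nu>) = Const (q ^ entry \<nu> 1) * zmon (shift n \<nu>)"
proof -
  obtain m where n: "n = Suc m" using assms by (cases n) auto
  have keys: "Poly_Mapping.keys \<nu> \<subseteq> {1..n}" "Poly_Mapping.keys (shift n \<nu>) \<subseteq> {1..n}"
    using assms is_composition_shift unfolding is_composition_def by blast+
  have "\<omega>\<^sub>0 n (zmon \<nu>) = \<omega>\<^sub>0 n (\<Prod>i\<in>{1..n}. Z i ^ entry \<nu> i)"
    unfolding zmon_eq_power_prod using power_prod_superset[OF _ keys(1)] by simp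
  also have "\<dots> = (\<Prod>i\<in>{1..n}. \<omega>\<^sub>0 n (Z i) ^ entry \<nu> i)"
    by (simp only: zhom_prod[OF zhom_\<omega>\<^sub>0] \<omega>\<^sub>0_simps)
  also have "\<dots> = \<omega>\<^sub>0 n (Z 1) ^ entry \<nu> 1 * (\<Prod>k\<in>{1..m}. \<omega>\<^sub>0 n (Z (Suc k)) ^ entry \<nu> (Suc k))"
    unfolding n by (simp add: prod.atLeast_Suc_atMost prod.shift_bounds_cl_Suc_ivl del: prod.cl_ivl_Suc)
  also have "\<dots> = Const (q ^ entry \<nu> 1) * Z n ^ entry \<nu> 1 * (\<Prod>k\<in>{1..m}. Z k ^ entry \<nu> (Suc k))"
    by (simp add: \<omega>\<^sub>0_Z power_mult_distrib Const_power)
  finally have 1: "Phi n (zmon \<nu>) = Const (q ^ entry \<nu> 1) * (Z n ^ Suc (entry \<nu> 1) * (\<Prod>k\<in>{1..m}. Z k ^ entry \<nu> (Suc k)))"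
    by (simp add: Phi_def ac_simps)
  have "zmon (shift n \<nu>) = (\<Prod>k\<in>{1..n}. Z k ^ entry (shift n \<nu>) k)"
    unfolding zmon_eq_power_prod by (rule power_prod_superset) (use keys in auto)
  also have "\<dots> = (\<Prod>k\<in>{1..m}. Z k ^ entry (shift n \<nu>) k) * Z n ^ entry (shift n \<nu>) n"
    by (simp add: n)
  also have "(\<Prod>k\<in>{1..m}. Z k ^ entry (shift n \<nu>) k) = (\<Prod>k\<in>{1..m}. Z k ^ entry \<nu> (Suc k))"
    by (rule prod.cong) (auto simp: entry_shift n)
  finally show ?thesis using 1 by (simp add: entry_shift n ac_simps)
qed


section \<open>Sorting, and comparison with the defining order\<close>

lemma act_permutes_entry: "\<sigma> permutes A \<Longrightarrow> entry (act \<sigma> \<nu>) k = entry \<nu> (inv' \<sigma> k)"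
  by (rule entry_act) (rule permutes_bij)

lemma sum_act:
  assumes "\<sigma> permutes {1..n}"
  shows "(\<Sum>k=1..n. f (entry (act \<sigma> \<nu>) k)) = (\<Sum>k=1..n. f (entry \<nu> k))"
  unfolding act_permutes_entry[OF assms]
  using sum.permute[OF permutes_inv[OF assms], of "\<lambda>k. f (entry \<nu> k)"] by (simp add: comp_def)

lemma is_composition_act:
  assumes "\<sigma> permutes {1..n}" "is_composition n \<nu>"
  shows "is_composition n (act \<sigma> \<nu>)"
  using assms unfolding is_composition_iff act_permutes_entry[OF assms(1)]
  by (metis permutes_inv permutes_not_in)

definition sorted_along :: "bool \<Rightarrow> nat set \<Rightarrow> exponent \<Rightarrow> bool" where
  "sorted_along up K \<mu> \<longleftrightarrow>
     (\<forall>i\<in>K. if up then entry \<mu> i \<le> entry \<mu> (Suc i) else entry \<mu> (Suc i) \<le> entry \<mu> i)"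

text \<open>A measure that strictly drops whenever an adjacent pair in the wrong order is exchanged;
  the two sets of coefficients serve the two directions of sorting.\<close>

definition sort_weight :: "nat \<Rightarrow> bool \<Rightarrow> exponent \<Rightarrow> nat" where
  "sort_weight n up \<mu> = (\<Sum>k=1..n. (if up then n - k else k) * entry \<mu> k)"

lemma sort_weight_act_adj:
  assumes i: "i \<in> {1..<n}"
    and less: "if up then entry \<mu> (Suc i) < entry \<mu> i else entry \<mu> i < entry \<mu> (Suc i)"
  shows "sort_weight n up (act (adj i) \<mu>) < sort_weight n up \<mu>"
proof -
  define c where "c k = (if up then n - k else k)" for k
  have "(\<Sum>k\<in>{1..n} - {i, Suc i}. c k * entry (act (adj i) \<mu>) k) = (\<Sum>k\<in>{1..n} - {i, Suc i}. c k * entry \<mu> k)"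
    by (rule sum.cong) (auto simp: adj_other)
  moreover have "c i * entry \<mu> (Suc i) + c (Suc i) * entry \<mu> i < c i * entry \<mu> i + c (Suc i) * entry \<mu> (Suc i)"
  proof (cases up)
    case True
    obtain m where "n - i = Suc m" "n - Suc i = m" using i by (metis Suc_diff_Suc atLeastLessThan_iff)
    then show ?thesis using less True by (simp add: c_def)
  qed (use less in \<open>simp add: c_def\<close>)
  ultimately show ?thesis
    unfolding sort_weight_def c_def[symmetric] sum_pair[OF i] by simp
qed

text \<open>An arrangement of minimal \<open>sort_weight\<close> is sorted. The set \<open>W\<close>
  is kept abstract to cover both the full symmetric group and parabolic subgroups.\<close>

lemma sorted_along_exists:
  assumes K: "K \<subseteq> {1..<n}" and W: "id \<in> W" "\<And>\<sigma>. \<sigma> \<in> W \<Longrightarrow> bij \<sigma>"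
    and closed: "\<And>i \<sigma>. i \<in> K \<Longrightarrow> \<sigma> \<in> W \<Longrightarrow> adj i \<circ> \<sigma> \<in> W"
  shows "\<exists>\<sigma>\<in>W. sorted_along up K (act \<sigma> \<mu>)"
proof -
  define w where "w \<sigma> = sort_weight n up (act \<sigma> \<mu>)" for \<sigma>
  define \<sigma> where "\<sigma> = arg_min w (\<lambda>\<sigma>. \<sigma> \<in> W)"
  have \<sigma>: "\<sigma> \<in> W" and min: "\<And>\<tau>. \<tau> \<in> W \<Longrightarrow> w \<sigma> \<le> w \<tau>"
    using arg_min_nat_lemma[of "\<lambda>\<sigma>. \<sigma> \<in> W" id w] W(1) unfolding \<sigma>_def by blast+
  have "if up then entry (act \<sigma> \<mu>) i \<le> entry (act \<sigma> \<mu>) (Suc i) else entry (act \<sigma> \<mu>) (Suc i) \<le> entry (act \<sigma> \<mu>) i"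
    if "i \<in> K" for i
  proof (rule ccontr)
    assume "\<not> ?thesis"
    then have "if up then entry (act \<sigma> \<mu>) (Suc i) < entry (act \<sigma> \<mu>) i else entry (act \<sigma> \<mu>) i < entry (act \<sigma> \<mu>) (Suc i)"
      by (cases up) simp_all
    moreover have "i \<in> {1..<n}" using that K by blast
    ultimately have "sort_weight n up (act (adj i) (act \<sigma> \<mu>)) < w \<sigma>"
      unfolding w_def by (intro sort_weight_act_adj)
    moreover have "act (adj i \<circ> \<sigma>) \<mu> = act (adj i) (act \<sigma> \<mu>)"
      by (rule act_comp[OF bij_adj W(2)[OF \<sigma>]])
    ultimately show False
      using min[OF closed[OF that \<sigma>]] by (simp add: w_def)
  qed
  then show ?thesis using \<sigma> unfolding sorted_along_def by blast
qed

abbreviation decreasing :: "nat \<Rightarrow> exponent \<Rightarrow> bool" where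
  "decreasing n \<equiv> sorted_along False {1..<n}"

lemma decreasing_iff: "decreasing n \<mu> \<longleftrightarrow> (\<forall>i\<in>{1..<n}. entry \<mu> i \<ge> entry \<mu> (i + 1))"
  by (simp add: sorted_along_def)

lemma decreasing_le:
  assumes "decreasing n \<mu>" "1 \<le> i" "i \<le> j" "j \<le> n"
  shows "entry \<mu> j \<le> entry \<mu> i"
  using assms(3,4)
proof (induction j rule: dec_induct)
  case (step j)
  then have "entry \<mu> (Suc j) \<le> entry \<mu> j"
    using assms(1,2) by (simp add: sorted_along_def)
  then show ?case using step by simp
qed simp

text \<open>One bound for each threshold, attained for decreasing sequences at the p-th entry
  (\<open>decreasing_partial_sum\<close>). This duality turns inequalities between excesses into
  inequalities between partial sums.\<close>

lemma partial_sum_le: "p \<le> n \<Longrightarrow> (\<Sum>k=1..p. entry \<mu> k) \<le> p * c + excess n c \<mu>"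
proof -
  assume "p \<le> n"
  have "(\<Sum>k=1..p. entry \<mu> k) \<le> (\<Sum>k=1..p. c + (entry \<mu> k - c))"
    by (rule sum_mono) auto
  also have "\<dots> = p * c + (\<Sum>k=1..p. entry \<mu> k - c)"
    by (simp add: sum.distrib)
  also have "(\<Sum>k=1..p. entry \<mu> k - c) \<le> (\<Sum>k=1..n. entry \<mu> k - c)"
    by (rule sum_mono2) (use \<open>p \<le> n\<close> in auto)
  finally show ?thesis by (simp add: excess_def)
qed

lemma decreasing_partial_sum:
  assumes "decreasing n \<mu>" "p \<in> {1..n}"
  shows "(\<Sum>k=1..p. entry \<mu> k) = p * entry \<mu> p + excess n (entry \<mu> p) \<mu>"
proof -
  have "excess n (entry \<mu> p) \<mu> = (\<Sum>k=1..p. entry \<mu> k - entry \<mu> p)"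
    unfolding excess_def
    by (rule sum.mono_neutral_right) (use assms decreasing_le[of n \<mu> p] in auto)
  moreover have "(\<Sum>k=1..p. entry \<mu> k) = (\<Sum>k=1..p. entry \<mu> p + (entry \<mu> k - entry \<mu> p))"
    by (rule sum.cong) (use assms decreasing_le[of n \<mu> _ p] in auto)
  ultimately show ?thesis by (simp add: sum.distrib)
qed

lemma decreasing_partial_sum_le:
  assumes "decreasing n \<mu>'" "\<And>c. excess n c \<mu> \<le> excess n c \<mu>'" "p \<le> n"
  shows "(\<Sum>k=1..p. entry \<mu> k) \<le> (\<Sum>k=1..p. entry \<mu>' k)"
proof (cases "p = 0")
  case False
  then have p: "p \<in> {1..n}" using assms(3) by simp
  show ?thesis
    using partial_sum_le[OF assms(3), of \<mu> "entry \<mu>' p"] assms(2)[of "entry \<mu>' p"]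
    unfolding decreasing_partial_sum[OF assms(1) p] by linarith
qed simp

lemma decreasing_unique:
  assumes "decreasing n \<mu>" "decreasing n \<mu>'" "\<And>c. excess n c \<mu> = excess n c \<mu>'"
    and "is_composition n \<mu>" "is_composition n \<mu>'"
  shows "\<mu> = \<mu>'"
proof (rule composition_eqI[OF assms(4,5)])
  fix k assume k: "k \<in> {1..n}"
  have eq: "(\<Sum>k=1..p. entry \<mu> k) = (\<Sum>k=1..p. entry \<mu>' k)" if "p \<le> n" for p
    using decreasing_partial_sum_le[OF assms(1), of \<mu>' p] decreasing_partial_sum_le[OF assms(2), of \<mu> p]
      assms(3) that by simp
  obtain j where "k = Suc j" using k by (cases k) auto
  then show "entry \<mu> k = entry \<mu>' k"
    using eq[of j] eq[of k] k by simp
qed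

lemma sorted_comp:
  assumes "is_composition n \<eta>"
  shows "\<exists>\<sigma>. \<sigma> permutes {1..n} \<and> sorted_comp n \<eta> = act \<sigma> \<eta>" "decreasing n (sorted_comp n \<eta>)"
proof -
  have "\<exists>\<sigma>\<in>{\<sigma>. \<sigma> permutes {1..n}}. decreasing n (act \<sigma> \<eta>)"
  proof (rule sorted_along_exists)
    show "adj i \<circ> \<sigma> \<in> {\<sigma>. \<sigma> permutes {1..n}}" if "i \<in> {1..<n}" "\<sigma> \<in> {\<sigma>. \<sigma> permutes {1..n}}" for i \<sigma>
      using that unfolding mem_Collect_eq adj_def by (intro permutes_compose permutes_swap_id) auto
  qed (use permutes_id permutes_bij in blast)+
  then obtain \<sigma> where \<sigma>: "\<sigma> permutes {1..n}" "decreasing n (act \<sigma> \<eta>)" by blast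
  let ?P = "\<lambda>\<mu>. (\<exists>\<sigma>. \<sigma> permutes {1..n} \<and> \<mu> = act \<sigma> \<eta>) \<and> (\<forall>i\<in>{1..<n}. entry \<mu> i \<ge> entry \<mu> (i + 1))"
  have "?P (sorted_comp n \<eta>)" unfolding sorted_comp_def
  proof (rule theI[of ?P "act \<sigma> \<eta>"])
    show "?P (act \<sigma> \<eta>)" using \<sigma> unfolding decreasing_iff by blast
  next
    fix \<mu> assume "?P \<mu>"
    then obtain \<tau> where \<tau>: "\<tau> permutes {1..n}" "\<mu> = act \<tau> \<eta>" "decreasing n \<mu>"
      unfolding decreasing_iff by blast
    have "excess n c \<mu> = excess n c (act \<sigma> \<eta>)" for c
      unfolding excess_def \<tau>(2)
      by (rule trans[OF sum_act[OF \<tau>(1)] sum_act[OF \<sigma>(1), symmetric]])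
    then show "\<mu> = act \<sigma> \<eta>"
      by (rule decreasing_unique[OF \<tau>(3) \<sigma>(2)]) (use \<tau> \<sigma> assms is_composition_act in auto)
  qed
  then show "\<exists>\<sigma>. \<sigma> permutes {1..n} \<and> sorted_comp n \<eta> = act \<sigma> \<eta>" "decreasing n (sorted_comp n \<eta>)"
    unfolding decreasing_iff by blast+
qed

lemma sorted_comp_invariants:
  assumes "is_composition n \<eta>"
  shows "excess n c (sorted_comp n \<eta>) = excess n c \<eta>" "modulus n (sorted_comp n \<eta>) = modulus n \<eta>"
proof -
  obtain \<sigma> where \<sigma>: "\<sigma> permutes {1..n}" "sorted_comp n \<eta> = act \<sigma> \<eta>"
    using sorted_comp(1)[OF assms] by blast
  show "excess n c (sorted_comp n \<eta>) = excess n c \<eta>"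
    unfolding excess_def \<sigma>(2) by (rule sum_act[OF \<sigma>(1)])
  show "modulus n (sorted_comp n \<eta>) = modulus n \<eta>"
    unfolding modulus_def \<sigma>(2) by (rule sum_act[OF \<sigma>(1)])
qed

lemma nat_eq_sum_of_bool: "x \<le> N \<Longrightarrow> (x::nat) = (\<Sum>c=1..N. of_bool (c \<le> x))"
proof -
  assume "x \<le> N"
  then have "{1..N} \<inter> {c. c \<le> x} = {1..x}" by auto
  then show ?thesis by (simp add: sum_of_bool_eq)
qed

text \<open>For different partitions the excesses give dominance. For equal partitions they cancel
  from the affine ranks; what remains counts entries at least \<open>c\<close> among the first
  \<open>p\<close>, and summing over \<open>c\<close> yields the partial sums.\<close>

lemma below_imp_comp_prec:
  assumes "is_composition n \<eta>" "below n \<nu> \<eta>" "\<nu> \<noteq> \<eta>"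
  shows "comp_prec n \<nu> \<eta>"
proof -
  have \<nu>: "is_composition n \<nu>" "modulus n \<nu> = modulus n \<eta>" using assms(2) by (auto simp: below_def)
  note inv = sorted_comp_invariants[OF \<nu>(1)] sorted_comp_invariants[OF assms(1)]
  have int_sum: "(\<Sum>i=1..p. int (entry \<mu>' i) - int (entry \<mu> i)) \<ge> 0"
    if "(\<Sum>i=1..p. entry \<mu> i) \<le> (\<Sum>i=1..p. entry \<mu>' i)" for p \<mu> \<mu>'
    using that by (simp add: sum_subtractf flip: of_nat_sum)
  show ?thesis
  proof (cases "sorted_comp n \<nu> = sorted_comp n \<eta>")
    case True
    then have ex: "excess n c \<nu> = excess n c \<eta>" for c using inv by metis
    have "(\<Sum>i=1..p. entry \<nu> i) \<le> (\<Sum>i=1..p. entry \<eta> i)" if "p \<in> {1..n}" for p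
    proof -
      \<comment> \<open>A common cut-off that writes both partial sums as finite sums over the same
        thresholds.\<close>
      let ?N = "Max (entry \<nu> ` {1..p} \<union> entry \<eta> ` {1..p})"
      have N: "entry \<nu> k \<le> ?N" "entry \<eta> k \<le> ?N" if "k \<in> {1..p}" for k
        using that by (auto intro!: Max_ge)
      have "(\<Sum>i=1..p. entry \<nu> i) = (\<Sum>i=1..p. \<Sum>c=1..?N. of_bool (c \<le> entry \<nu> i))"
        by (intro sum.cong refl nat_eq_sum_of_bool N)
      also have "\<dots> = (\<Sum>c=1..?N. \<Sum>i=1..p. of_bool (c \<le> entry \<nu> i))"
        by (rule sum.swap)
      also have "\<dots> \<le> (\<Sum>c=1..?N. \<Sum>i=1..p. of_bool (c \<le> entry \<eta> i))"
      proof (rule sum_mono)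
        fix c
        have "affine_rank n c p \<nu> \<le> affine_rank n c p \<eta>"
          using assms(2) that by (simp add: below_def)
        then show "(\<Sum>i=1..p. of_bool (c \<le> entry \<nu> i)) \<le> (\<Sum>i=1..p. of_bool (c \<le> entry \<eta> i) :: nat)"
          unfolding affine_rank_def ex by simp
      qed
      also have "\<dots> = (\<Sum>i=1..p. \<Sum>c=1..?N. of_bool (c \<le> entry \<eta> i))"
        by (rule sum.swap)
      also have "\<dots> = (\<Sum>i=1..p. entry \<eta> i)"
        by (intro sum.cong refl nat_eq_sum_of_bool[symmetric] N)
      finally show ?thesis .
    qed
    then have "dom_less n \<nu> \<eta>"
      unfolding dom_less_def using \<nu>(2) assms(3) int_sum by blast
    then show ?thesis
      unfolding comp_prec_def using True by blast
  next
    case False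
    have "(\<Sum>i=1..p. entry (sorted_comp n \<nu>) i) \<le> (\<Sum>i=1..p. entry (sorted_comp n \<eta>) i)" if "p \<in> {1..n}" for p
      by (rule decreasing_partial_sum_le[OF sorted_comp(2)[OF assms(1)]])
        (use that below_excess[OF assms(2)] sorted_comp_invariants[OF \<nu>(1)] sorted_comp_invariants[OF assms(1)] in auto)
    moreover have "modulus n (sorted_comp n \<nu>) = modulus n (sorted_comp n \<eta>)"
      using inv \<nu>(2) by simp
    ultimately have "dom_less n (sorted_comp n \<nu>) (sorted_comp n \<eta>)"
      unfolding dom_less_def using False int_sum by blast
    then show ?thesis
      unfolding comp_prec_def by blast
  qed
qed


section \<open>Existence of the nonsymmetric Macdonald polynomials\<close>

lemma qt_power_Fract: "q ^ a * t ^ b = Fract (monom (monom 1 a) b) 1"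
proof -
  have q: "q ^ a = Fract [:monom 1 a:] 1"
  proof (induction a)
    case (Suc a)
    then show ?case by (simp add: q_def monom_Suc)
  qed (simp add: One_fract_def one_pCons monom_0)
  have t: "t ^ b = Fract (monom 1 b) 1"
  proof (induction b)
    case (Suc b)
    then show ?case by (simp add: t_def monom_Suc)
  qed (simp add: One_fract_def)
  show ?thesis by (simp add: q t smult_monom)
qed

text \<open>The indeterminates satisfy no monomial relation. Distinctness of eigenvalues and
  nonvanishing of all later denominators rest on this.\<close>

lemma qt_power_eq_iff: "q ^ a * t ^ b = q ^ a' * t ^ b' \<longleftrightarrow> a = a' \<and> b = b'"
proof -
  have "a = a' \<and> b = b'" if "monom (monom 1 a) b = (monom (monom 1 a') b' :: rat poly poly)"
  proof -
    have ne: "monom 1 a \<noteq> (0 :: rat poly)" "monom 1 a' \<noteq> (0 :: rat poly)" by simp_all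
    have b: "b = b'" using arg_cong[OF that, of degree] ne by (simp add: degree_monom_eq)
    then have "monom 1 a = (monom 1 a' :: rat poly)"
      using arg_cong[OF that, of "\<lambda>p. coeff p b"] by simp
    then have "degree (monom 1 a :: rat poly) = degree (monom 1 a' :: rat poly)" by simp
    with b show ?thesis by (simp add: degree_monom_eq)
  qed
  then show ?thesis by (auto simp: qt_power_Fract eq_fract)
qed

lemma qt_power_eq_1_iff: "q ^ a * t ^ b = 1 \<longleftrightarrow> a = 0 \<and> b = 0"
  using qt_power_eq_iff[of a b 0 0] by simp

lemma eigval_eq: "eigval n \<eta> i = q ^ entry \<eta> i / t ^ coleg n \<eta> i"
  by (simp add: eigval_def power_int_minus divide_inverse)

lemma eigval_nonzero [simp]: "eigval n \<eta> i \<noteq> 0"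
  by (simp add: eigval_eq)

text \<open>The exponent of \<open>q\<close> alone already determines the entry.\<close>

lemma eigval_eqD:
  assumes "eigval n \<eta> i = eigval n \<mu> j"
  shows "entry \<eta> i = entry \<mu> j"
proof -
  have "q ^ entry \<eta> i * t ^ coleg n \<mu> j = q ^ entry \<mu> j * t ^ coleg n \<eta> i"
    using assms by (simp add: eigval_eq field_simps)
  then show ?thesis by (simp add: qt_power_eq_iff)
qed

text \<open>Merges the two counts of \<open>coleg\<close> into one set, so that colegs can be
  compared by a single bijection of positions.\<close>

definition coleg_rel :: "exponent \<Rightarrow> nat \<Rightarrow> nat \<Rightarrow> bool" where
  "coleg_rel \<eta> i j \<longleftrightarrow> j < i \<and> entry \<eta> j \<ge> entry \<eta> i \<or> j > i \<and> entry \<eta> j > entry \<eta> i"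

lemma coleg_eq_card: "coleg n \<eta> i = card {j \<in> {1..n}. coleg_rel \<eta> i j}"
proof -
  have "{j \<in> {1..n}. coleg_rel \<eta> i j} = {j \<in> {1..n}. j < i \<and> entry \<eta> j \<ge> entry \<eta> i} \<union> {j \<in> {1..n}. j > i \<and> entry \<eta> j > entry \<eta> i}"
    by (auto simp: coleg_rel_def)
  moreover have "card \<dots> = coleg n \<eta> i"
    unfolding coleg_def by (rule card_Un_disjoint) auto
  ultimately show ?thesis by simp
qed

lemma coleg_eqI:
  assumes "bij_betw \<sigma> {1..n} {1..n}" "\<And>j. j \<in> {1..n} \<Longrightarrow> coleg_rel \<mu> i' (\<sigma> j) \<longleftrightarrow> coleg_rel \<eta> i j"
  shows "coleg n \<mu> i' = coleg n \<eta> i"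
proof -
  have "{j \<in> {1..n}. coleg_rel \<mu> i' j} = \<sigma> ` {j \<in> {1..n}. coleg_rel \<eta> i j}"
  proof (intro equalityI subsetI)
    fix j assume j: "j \<in> {j \<in> {1..n}. coleg_rel \<mu> i' j}"
    then have "j \<in> \<sigma> ` {1..n}" using assms(1) by (simp add: bij_betw_def)
    then obtain k where "k \<in> {1..n}" "j = \<sigma> k" by blast
    then show "j \<in> \<sigma> ` {j \<in> {1..n}. coleg_rel \<eta> i j}"
      using j assms(2) by blast
  next
    fix j assume "j \<in> \<sigma> ` {j \<in> {1..n}. coleg_rel \<eta> i j}"
    then obtain k where k: "k \<in> {1..n}" "coleg_rel \<eta> i k" "j = \<sigma> k" by blast
    moreover have "\<sigma> k \<in> {1..n}" using assms(1) k(1) by (rule bij_betw_apply)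
    ultimately show "j \<in> {j \<in> {1..n}. coleg_rel \<mu> i' j}" using assms(2) by simp
  qed
  moreover have "inj_on \<sigma> {j \<in> {1..n}. coleg_rel \<eta> i j}"
    by (rule inj_on_subset[OF bij_betw_imp_inj_on[OF assms(1)]]) blast
  ultimately show ?thesis by (simp add: coleg_eq_card card_image)
qed

lemma bij_betw_adj: "i \<in> {1..<n} \<Longrightarrow> bij_betw (adj i) {1..n} {1..n}"
  by (rule bij_betwI[of _ _ _ "adj i"]) (auto simp: adj_eq)

text \<open>Position serves only as a tie-break in \<open>coleg\<close>; with unequal entries the
  exchange carries the counted sets along.\<close>

lemma eigval_act_adj:
  assumes "i \<in> {1..<n}" "k \<in> {1..n}" "entry \<eta> i \<noteq> entry \<eta> (Suc i)"
  shows "eigval n (act (adj i) \<eta>) k = eigval n \<eta> (adj i k)"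
proof -
  have "coleg n \<eta> (adj i k) = coleg n (act (adj i) \<eta>) k"
    by (rule coleg_eqI[OF bij_betw_adj[OF assms(1)]])
      (use assms(3) in \<open>auto simp: coleg_rel_def adj_eq\<close>)
  then show ?thesis by (simp add: eigval_def)
qed

text \<open>The first entry moves behind all others, which makes its comparisons strict; raising it
  by one compensates for that.\<close>

lemma eigval_shift:
  assumes "k \<in> {1..n}"
  shows "eigval n (shift n \<eta>) k = (if k = n then q * eigval n \<eta> 1 else eigval n \<eta> (Suc k))"
proof -
  let ?r = "\<lambda>j. if j = 1 then n else j - 1"
  have bij: "bij_betw ?r {1..n} {1..n}"
    by (rule bij_betwI[of _ _ _ "\<lambda>j. if j = n then 1 else Suc j"]) (use assms in auto)
  have "coleg n (shift n \<eta>) k = coleg n \<eta> (if k = n then 1 else Suc k)"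
    by (rule coleg_eqI[OF bij]) (use assms in \<open>auto simp: coleg_rel_def entry_shift\<close>)
  then show ?thesis
    using assms by (simp add: eigval_def entry_shift)
qed


definition is_Macdonald :: "nat \<Rightarrow> exponent \<Rightarrow> zpoly \<Rightarrow> bool" where
  "is_Macdonald n \<eta> f \<longleftrightarrow> zcoeff f \<eta> = 1 \<and> (\<forall>\<nu>\<in>Poly_Mapping.keys f. below n \<nu> \<eta>) \<and>
     (\<forall>i\<in>{1..n}. Y n i f = Const (eigval n \<eta> i) * f)"

lemma is_Macdonald_npoly: "is_Macdonald n \<eta> f \<Longrightarrow> f \<in> npoly n"
  by (auto simp: is_Macdonald_def npoly_def below_def)

lemma is_Macdonald_zero: "1 \<le> n \<Longrightarrow> is_Macdonald n 0 1"
proof -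
  assume n: "1 \<le> n"
  have T1: "T i 1 = Const t" for i
    using T_sym[of i 1] by (simp add: swap_vars_simps)
  have "foldr T ks 1 = Const (t ^ length ks)" for ks
  proof (induction ks)
    case (Cons k ks)
    have "T k (Const (t ^ length ks) * 1) = Const (t ^ length ks) * T k 1" by (rule T_Const_mult)
    then show ?case using Cons by (simp add: T1 Const_mult mult.commute)
  qed simp
  note up = this
  have Tinv1: "T_inv i 1 = Const (1 / t)" for i
    by (simp add: T_inv_def T1 flip: Const_add)
  have "foldr T_inv ks 1 = Const ((1 / t) ^ length ks)" for ks
  proof (induction ks)
    case (Cons k ks)
    have "T_inv k (Const ((1 / t) ^ length ks) * 1) = Const ((1 / t) ^ length ks) * T_inv k 1" by (rule T_inv_Const_mult)
    then show ?case using Cons by (simp only: foldr.simps comp_apply Tinv1 list.size mult_1_right)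
      (simp flip: Const_mult add: mult.commute)
  qed simp
  note down = this
  have "Y n i 1 = Const (eigval n 0 i) * 1" if "i \<in> {1..n}" for i
  proof -
    \<comment> \<open>All entries tie, and ties count only to the left.\<close>
    have "{j \<in> {1..n}. coleg_rel 0 i j} = {1..<i}"
      using that by (auto simp: coleg_rel_def)
    then have "coleg n 0 i = i - 1" by (simp add: coleg_eq_card)
    then have "eigval n 0 i = (1 / t) ^ (i - 1)"
      by (simp add: eigval_eq power_divide)
    moreover have "t powi (int i - int n) * t ^ (n - i) = 1"
    proof -
      have "t powi (int i - int n) * t powi (int n - int i) = 1"
        by (simp flip: power_int_add)
      moreover have "t powi (int n - int i) = t ^ (n - i)"
        using that by (simp add: of_nat_diff flip: power_int_of_nat)
      ultimately show ?thesis by simp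
    qed
    moreover have "foldr T [i..<n] (Const c) = Const c * Const (t ^ (n - i))" for c
      using foldr_T_Const_mult[of "[i..<n]" c 1] up[of "[i..<n]"] by simp
    ultimately show ?thesis
      using that unfolding Y_eq down \<omega>\<^sub>0_simps
      by (simp flip: Const_mult add: mult.left_commute)
  qed
  moreover have "below n 0 0" by (rule below_refl) (simp add: is_composition_def)
  moreover have "Poly_Mapping.keys (1 :: zpoly) = {0}" by simp
  ultimately show ?thesis by (simp add: is_Macdonald_def)
qed

text \<open>If \<open>f\<close> is a joint eigenvector, then so is \<open>T\<^sub>i f + c f\<close> for this value of \<open>c\<close>, and the
  eigenvalues of \<open>Y\<^sub>i\<close> and \<open>Y\<^sub>i\<^sub>+\<^sub>1\<close> get interchanged.\<close>

definition intertwine :: "nat \<Rightarrow> exponent \<Rightarrow> nat \<Rightarrow> qt" where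
  "intertwine n \<eta> i = (1 - t) * eigval n \<eta> i / (eigval n \<eta> i - eigval n \<eta> (Suc i))"

text \<open>By \<open>T_Y_T\<close> and the quadratic relation the span of \<open>f\<close> and
  \<open>T i f\<close> is invariant under \<open>Y n i\<close> and \<open>Y n (Suc i)\<close>; the
  condition on \<open>c\<close> selects the eigenvector with the two eigenvalues interchanged. The
  other \<open>Y n k\<close> commute with \<open>T i\<close>.\<close>

lemma Y_intertwine:
  assumes "i \<in> {1..<n}" "\<And>k. k \<in> {1..n} \<Longrightarrow> Y n k f = Const (y k) * f"
    and "c * (y i - y (Suc i)) = (1 - t) * y i" "k \<in> {1..n}"
  shows "Y n k (T i f + Const c * f) = Const (y (adj i k)) * (T i f + Const c * f)"
proof -
  have YT: "T i (Y n (Suc i) g) = Const t * Y n i (T_inv i g)" for g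
    using T_Y_T[OF assms(1), of "T_inv i g"] by simp
  have t: "Const t * g = Const t * h \<Longrightarrow> g = h" for g h :: zpoly by simp
  have i: "i \<in> {1..n}" "Suc i \<in> {1..n}" using assms(1) by auto
  have cc: "Const c * Const (y i) - Const c * Const (y (Suc i)) = Const (y i) - Const t * Const (y i)"
    using arg_cong[OF assms(3), of Const] by (simp add: Const_mult Const_diff algebra_simps)
  \<comment> \<open>Computed after multiplication by t, where \<open>T_Y_T\<close> applies to
    \<open>T i f\<close> and the square of \<open>T i\<close> can be reduced.\<close>
  have Yi: "Y n i (T i f) = Const (y (Suc i)) * T i f - Const ((1 - t) * y i) * f"
  proof (rule t)
    have "Const t * Y n i (T i f) = T i (Y n (Suc i) (T i (T i f)))"
      using T_Y_T[OF assms(1)] by simp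
    also have "\<dots> = Const (t - 1) * (T i (Y n (Suc i) (T i f))) + Const t * T i (Y n (Suc i) f)"
      by (simp only: T_T Y_add Y_Const_mult T_add T_Const_mult)
    also have "\<dots> = Const (t - 1) * (Const t * (Const (y i) * f)) + Const t * (Const (y (Suc i)) * T i f)"
      by (simp only: T_Y_T[OF assms(1)] assms(2)[OF i(1)] assms(2)[OF i(2)] T_Const_mult)
    also have "\<dots> = Const t * (Const (y (Suc i)) * T i f - Const ((1 - t) * y i) * f)"
      unfolding Const_mult Const_diff by algebra
    finally show "Const t * Y n i (T i f) = Const t * (Const (y (Suc i)) * T i f - Const ((1 - t) * y i) * f)" .
  qed
  have YSi: "Y n (Suc i) (T i f) = Const (y i) * T i f + Const ((1 - t) * y i) * f"
  proof -
    have "T i (Y n (Suc i) (T i f)) = Const t * (Const (y i) * f)"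
      by (simp only: T_Y_T[OF assms(1)] assms(2)[OF i(1)])
    then have "Y n (Suc i) (T i f) = Const t * (Const (y i) * T_inv i f)"
      by (metis T_inv_T T_inv_Const_mult)
    also have "\<dots> = Const (y i) * (T i f + Const (1 - t) * f)"
      unfolding T_inv_def by (simp add: mult.left_commute[of "Const t"]) (simp flip: Const_mult mult.assoc)
    finally show ?thesis by (simp add: Const_mult distrib_left ac_simps)
  qed
  consider "k = i" | "k = Suc i" | "k \<noteq> i" "k \<noteq> Suc i" by blast
  then show ?thesis
  proof cases
    case 1
    show ?thesis
      unfolding 1 Y_add Y_Const_mult Yi assms(2)[OF i(1)] adj_left using cc
      by (simp only: Const_mult Const_diff Const_1) algebra
  next
    case 2
    show ?thesis
      unfolding 2 Y_add Y_Const_mult YSi assms(2)[OF i(2)] adj_right using cc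
      by (simp only: Const_mult Const_diff Const_1) algebra
  next
    case 3
    then show ?thesis
      using T_Y_commute[OF assms(1,4) 3, of f] assms(2)[OF assms(4)]
      by (simp add: Y_add Y_Const_mult T_Const_mult adj_other distrib_left mult.left_commute)
  qed
qed

section \<open>The two raising steps and the construction of the eigenvectors\<close>

lemma zcoeff_eq_0I: "\<nu> \<notin> Poly_Mapping.keys f \<Longrightarrow> zcoeff f \<nu> = 0"
  by (simp add: in_keys_iff)

lemma zcoeff_T:
  "zcoeff (T i f) \<mu> = (\<Sum>\<nu>\<in>Poly_Mapping.keys f. zcoeff f \<nu> * zcoeff (T i (zmon \<nu>)) \<mu>)"
proof -
  have "T i f = T i (\<Sum>\<nu>\<in>Poly_Mapping.keys f. Const (zcoeff f \<nu>) * zmon \<nu>)"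
    using zpoly_expansion[of "Poly_Mapping.keys f" f] by simp
  then show ?thesis by (simp add: T_sum T_Const_mult lookup_sum)
qed

lemma zcoeff_T_zmon_lt:
  assumes "entry \<nu> i < entry \<nu> (Suc i)"
  shows "zcoeff (T i (zmon \<nu>)) (act (adj i) \<nu>) = t"
proof -
  obtain r where r: "Poly_Mapping.keys r \<subseteq> mids i \<nu>"
    "T i (zmon \<nu>) = Const t * zmon (act (adj i) \<nu>) + Const (t - 1) * zmon \<nu> - r"
    using assms by (rule T_zmon_lt)
  have "act (adj i) \<nu> \<noteq> \<nu>" using assms by (simp add: act_adj_eq_iff)
  moreover have "zcoeff r (act (adj i) \<nu>) = 0"
    by (rule zcoeff_eq_0I) (use r(1) in auto)
  ultimately show ?thesis by (simp add: r(2) lookup_add lookup_minus zcoeff_zmon)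
qed

text \<open>The eigenvalues come from \<open>Y_intertwine\<close> and triangularity from
  \<open>below_T_raise\<close>. The new leading monomial arises from the old one alone, with
  coefficient t, which explains the factor 1/t.\<close>

lemma is_Macdonald_raise:
  assumes i: "i \<in> {1..<n}" and less: "entry \<eta> i < entry \<eta> (Suc i)" and f: "is_Macdonald n \<eta> f"
  shows "is_Macdonald n (act (adj i) \<eta>) (Const (1 / t) * (T i f + Const (intertwine n \<eta> i) * f))"
proof -
  let ?g = "T i f + Const (intertwine n \<eta> i) * f" and ?s = "act (adj i) \<eta>"
  have \<eta>: "below n \<nu> \<eta>" if "\<nu> \<in> Poly_Mapping.keys f" for \<nu>
    using f that by (simp add: is_Macdonald_def)
  have "\<eta> \<in> Poly_Mapping.keys f"
    using f by (simp add: is_Macdonald_def in_keys_iff)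
  then have comp: "is_composition n \<eta>" using \<eta> by (simp add: below_def)
  have ne: "eigval n \<eta> i - eigval n \<eta> (Suc i) \<noteq> 0"
    using eigval_eqD[of n \<eta> i \<eta> "Suc i"] less by auto
  have "Y n k ?g = Const (eigval n \<eta> (adj i k)) * ?g" if "k \<in> {1..n}" for k
    by (rule Y_intertwine[OF i _ _ that]) (use f ne in \<open>simp_all add: is_Macdonald_def intertwine_def\<close>)
  then have "Y n k (Const (1 / t) * ?g) = Const (eigval n ?s k) * (Const (1 / t) * ?g)" if "k \<in> {1..n}" for k
    using that less by (simp add: Y_Const_mult eigval_act_adj[OF i that] mult.left_commute)
  moreover have "below n \<mu> ?s" if "\<mu> \<in> Poly_Mapping.keys (Const (1 / t) * ?g)" for \<mu>
  proof -
    have "\<mu> \<in> Poly_Mapping.keys ?g" using that keys_Const_mult by blast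
    then have "\<mu> \<in> Poly_Mapping.keys (T i f) \<union> Poly_Mapping.keys f"
      using keys_add[of "T i f" "Const (intertwine n \<eta> i) * f"] keys_Const_mult by blast
    then obtain \<nu> where "\<nu> \<in> Poly_Mapping.keys f" "\<mu> \<in> {\<nu>, act (adj i) \<nu>} \<union> mids i \<nu>"
      using keys_T[of i f] by blast
    then show ?thesis
      using below_T_raise[OF i \<eta>] less by simp
  qed
  moreover have "zcoeff (Const (1 / t) * ?g) ?s = 1"
  proof -
    have not_below: "\<not> below n ?s \<eta>"
    proof
      assume "below n ?s \<eta>"
      moreover have "below n \<eta> ?s"
        using below_act_adj(2)[OF i below_refl[OF comp]] less by simp
      ultimately have "?s = \<eta>" by (rule below_antisym)
      then show False using less by (simp add: act_adj_eq_iff)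
    qed
    then have f0: "zcoeff f ?s = 0" using \<eta> by (metis zcoeff_eq_0I)
    have "zcoeff f \<nu> * zcoeff (T i (zmon \<nu>)) ?s = (if \<nu> = \<eta> then t else 0)"
      if "\<nu> \<in> Poly_Mapping.keys f" for \<nu>
    proof (cases "\<nu> = \<eta>")
      case True
      then show ?thesis
        using f less by (simp add: zcoeff_T_zmon_lt is_Macdonald_def)
    next
      case False
      have "?s \<notin> {\<nu>, act (adj i) \<nu>} \<union> mids i \<nu>"
      proof
        assume "?s \<in> {\<nu>, act (adj i) \<nu>} \<union> mids i \<nu>"
        then consider "?s = \<nu>" | "?s = act (adj i) \<nu>" | "?s \<in> mids i \<nu>" by blast
        then show False
        proof cases
          case 1
          then show False using not_below \<eta>[OF that] by simp
        next
          case 2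
          then show False using False by (metis act_adj_adj)
        next
          case 3
          \<comment> \<open>Then some excess of \<open>\<eta>\<close> would be smaller than that of
            \<open>\<nu>\<close>, although \<open>\<nu>\<close> lies below
            \<open>\<eta>\<close>.\<close>
          then have "\<eta> \<in> mids i \<nu>" by (metis act_adj_adj act_adj_mem_mids)
          then show False
            using mids_excess(2)[OF i] below_excess[OF \<eta>[OF that]] by (meson not_less)
        qed
      qed
      then have "zcoeff (T i (zmon \<nu>)) ?s = 0"
        using keys_T_zmon zcoeff_eq_0I by blast
      then show ?thesis using False by simp
    qed
    then have "zcoeff (T i f) ?s = (\<Sum>\<nu>\<in>Poly_Mapping.keys f. if \<nu> = \<eta> then t else 0)"
      unfolding zcoeff_T[of i f] by (rule sum.cong[OF refl])
    also have "\<dots> = t" using \<open>\<eta> \<in> Poly_Mapping.keys f\<close> by simp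
    finally show ?thesis by (simp add: lookup_add f0)
  qed
  ultimately show ?thesis by (simp add: is_Macdonald_def)
qed

text \<open>\<open>Phi\<close> sends monomials to multiples of monomials with rotated exponents,
  injectively. The scalar undoes the power of q picked up by z_1 in the leading monomial.\<close>

lemma is_Macdonald_shift:
  assumes n: "1 \<le> n" and comp: "is_composition n \<eta>" and f: "is_Macdonald n \<eta> f"
  shows "is_Macdonald n (shift n \<eta>) (Const (1 / q ^ entry \<eta> 1) * Phi n f)"
proof -
  let ?c = "1 / q ^ entry \<eta> 1"
  have below: "below n \<nu> \<eta>" "is_composition n \<nu>" if "\<nu> \<in> Poly_Mapping.keys f" for \<nu>
    using f that by (auto simp: is_Macdonald_def below_def)
  have "Phi n f = Phi n (\<Sum>\<nu>\<in>Poly_Mapping.keys f. Const (zcoeff f \<nu>) * zmon \<nu>)"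
    using zpoly_expansion[of "Poly_Mapping.keys f" f] by simp
  also have "\<dots> = (\<Sum>\<nu>\<in>Poly_Mapping.keys f. Const (zcoeff f \<nu>) * Phi n (zmon \<nu>))"
    by (simp add: Phi_def zhom_sum[OF zhom_\<omega>\<^sub>0] \<omega>\<^sub>0_simps sum_distrib_left mult.left_commute)
  also have "\<dots> = (\<Sum>\<nu>\<in>Poly_Mapping.keys f. Const (zcoeff f \<nu> * q ^ entry \<nu> 1) * zmon (shift n \<nu>))"
    by (rule sum.cong) (simp_all add: Phi_zmon[OF n below(2)] Const_mult mult.assoc)
  finally have Phi: "zcoeff (Phi n f) \<mu> = (\<Sum>\<nu>\<in>Poly_Mapping.keys f. if \<mu> = shift n \<nu> then zcoeff f \<nu> * q ^ entry \<nu> 1 else 0)" for \<mu>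
    by (simp add: lookup_sum zcoeff_zmon if_distrib cong: if_cong)
  have "zcoeff (Phi n f) (shift n \<eta>) = (\<Sum>\<nu>\<in>Poly_Mapping.keys f. if \<nu> = \<eta> then q ^ entry \<eta> 1 else 0)"
    unfolding Phi
    by (rule sum.cong) (use f shift_inject[OF n comp below(2)] in \<open>auto simp: is_Macdonald_def\<close>)
  then have "zcoeff (Const ?c * Phi n f) (shift n \<eta>) = 1"
    using f by (simp add: is_Macdonald_def in_keys_iff)
  moreover have "below n \<mu> (shift n \<eta>)" if "\<mu> \<in> Poly_Mapping.keys (Const ?c * Phi n f)" for \<mu>
  proof -
    have "zcoeff (Phi n f) \<mu> \<noteq> 0" using that by (simp add: in_keys_iff)
    moreover have "zcoeff (Phi n f) \<mu> = 0" if "\<forall>\<nu>\<in>Poly_Mapping.keys f. \<mu> \<noteq> shift n \<nu>"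
      unfolding Phi by (intro sum.neutral) (use that in simp)
    ultimately obtain \<nu> where "\<nu> \<in> Poly_Mapping.keys f" "\<mu> = shift n \<nu>" by blast
    then show ?thesis using below_shift[OF n] below by simp
  qed
  moreover have "Y n i (Const ?c * Phi n f) = Const (eigval n (shift n \<eta>) i) * (Const ?c * Phi n f)"
    if i: "i \<in> {1..n}" for i
  proof -
    have "Y n i (Phi n f) = Const (eigval n (shift n \<eta>) i) * Phi n f"
    proof (cases "i = n")
      case True
      have "Y n n (Phi n f) = Const q * Phi n (Const (eigval n \<eta> 1) * f)"
        using f n by (simp add: Y_Phi_last is_Macdonald_def)
      then show ?thesis using True i by (simp add: Phi_Const_mult eigval_shift Const_mult mult.assoc)
    next
      case False
      then have "Y n i (Phi n f) = Phi n (Const (eigval n \<eta> (Suc i)) * f)"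
        using i f is_Macdonald_npoly[OF f] by (simp add: Y_Phi is_Macdonald_def)
      then show ?thesis using False i by (simp add: Phi_Const_mult eigval_shift)
    qed
    then show ?thesis by (simp add: Y_Const_mult mult.left_commute)
  qed
  ultimately show ?thesis unfolding is_Macdonald_def by blast
qed

text \<open>Lexicographic descent: a nonzero last entry allows undoing a \<open>shift\<close>, which
  lowers the modulus; otherwise the last nonzero entry is exchanged with the zero behind it, which
  keeps the modulus and lowers the weight.\<close>

lemma is_Macdonald_exists:
  assumes n: "1 \<le> n" and "is_composition n \<eta>"
  shows "\<exists>f. is_Macdonald n \<eta> f"
proof -
  have "wf (measures [modulus n, sort_weight n True])" by simp
  then show ?thesis using assms(2)
  proof (induction \<eta> rule: wf_induct_rule)
    case (less \<eta>)
    consider "\<eta> = 0" | "entry \<eta> n \<noteq> 0" | "\<eta> \<noteq> 0" "entry \<eta> n = 0" by blast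
    then show ?case
    proof cases
      case 1
      then show ?thesis using is_Macdonald_zero[OF n] by blast
    next
      case 2
      \<comment> \<open>The preimage under \<open>shift\<close>: the last entry, lowered by one,
        returns to the front.\<close>
      define \<mu> where "\<mu> = (\<Sum>k\<in>{1..n}. Poly_Mapping.single k (if k = 1 then entry \<eta> n - 1 else entry \<eta> (k - 1)))"
      have \<mu>: "entry \<mu> k = (if k \<in> {1..n} then if k = 1 then entry \<eta> n - 1 else entry \<eta> (k - 1) else 0)" for k
      proof -
        have "entry \<mu> k = (\<Sum>j\<in>{1..n}. if j = k then if k = 1 then entry \<eta> n - 1 else entry \<eta> (k - 1) else 0)"
          unfolding \<mu>_def lookup_sum by (rule sum.cong) (auto simp: lookup_single when_def)
        then show ?thesis by (simp del: One_nat_def)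
      qed
      have comp: "is_composition n \<mu>" by (simp add: is_composition_iff \<mu>)
      have "shift n \<mu> = \<eta>"
        by (rule composition_eqI[OF is_composition_shift less.prems])
          (use 2 n in \<open>auto simp: entry_shift \<mu>\<close>)
      moreover from this have "modulus n \<mu> < modulus n \<eta>"
        using modulus_shift[OF n, of \<mu>] by simp
      then obtain f where "is_Macdonald n \<mu> f" using less.IH comp by auto
      ultimately show ?thesis using is_Macdonald_shift[OF n comp] by blast
    next
      case 3
      have "Poly_Mapping.keys \<eta> \<subseteq> {1..n}" "Poly_Mapping.keys \<eta> \<noteq> {}"
        using less.prems 3(1) by (auto simp: is_composition_def simp del: One_nat_def)
      define i where "i = Max (Poly_Mapping.keys \<eta>)"
      have "i \<in> Poly_Mapping.keys \<eta>" unfolding i_def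
        by (rule Max_in) (use \<open>Poly_Mapping.keys \<eta> \<noteq> {}\<close> in auto)
      then have i0: "entry \<eta> i \<noteq> 0" and "i \<in> {1..n}"
        using \<open>Poly_Mapping.keys \<eta> \<subseteq> {1..n}\<close> by (simp add: in_keys_iff, blast)
      moreover have "i \<noteq> n" using i0 3(2) by metis
      ultimately have i: "i \<in> {1..<n}" "entry \<eta> i \<noteq> 0" by simp_all
      have "Suc i \<notin> Poly_Mapping.keys \<eta>"
      proof
        assume "Suc i \<in> Poly_Mapping.keys \<eta>"
        with finite_keys have "Suc i \<le> i" unfolding i_def by (rule Max_ge)
        then show False by simp
      qed
      then have Si: "entry \<eta> (Suc i) = 0" by (simp add: in_keys_iff)
      let ?\<mu> = "act (adj i) \<eta>"
      have "sort_weight n True ?\<mu> < sort_weight n True \<eta>"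
        by (rule sort_weight_act_adj[OF i(1)]) (use i(2) Si in simp)
      then obtain f where f: "is_Macdonald n ?\<mu> f"
        using less.IH[of ?\<mu>] modulus_act_adj[OF i(1)] is_composition_act_adj[OF less.prems i(1)] by auto
      have "entry ?\<mu> i < entry ?\<mu> (Suc i)" using i Si by simp
      then show ?thesis using is_Macdonald_raise[OF i(1) _ f] by auto
    qed
  qed
qed


section \<open>Uniqueness of the nonsymmetric Macdonald polynomials\<close>

text \<open>A choice that stands in for \<open>E\<close> until \<open>E_eq_Mac\<close> identifies
  the two.\<close>

definition Mac :: "nat \<Rightarrow> exponent \<Rightarrow> zpoly" where
  "Mac n \<eta> = (SOME f. is_Macdonald n \<eta> f)"

lemma is_Macdonald_Mac: "1 \<le> n \<Longrightarrow> is_composition n \<eta> \<Longrightarrow> is_Macdonald n \<eta> (Mac n \<eta>)"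
  unfolding Mac_def by (rule someI_ex) (rule is_Macdonald_exists)

text \<open>A numerical rank for \<open>below\<close>, used for induction and for picking maximal
  elements.\<close>

lemma card_below_less:
  assumes "below n \<nu> \<mu>" "\<nu> \<noteq> \<mu>" "is_composition n \<mu>"
  shows "card {\<kappa>. below n \<kappa> \<nu>} < card {\<kappa>. below n \<kappa> \<mu>}"
proof (rule psubset_card_mono[OF finite_below])
  have "{\<kappa>. below n \<kappa> \<nu>} \<subseteq> {\<kappa>. below n \<kappa> \<mu>}" using below_trans assms(1) by blast
  moreover have "\<mu> \<in> {\<kappa>. below n \<kappa> \<mu>}" "\<mu> \<notin> {\<kappa>. below n \<kappa> \<nu>}"
    using assms below_refl below_antisym by blast+
  ultimately show "{\<kappa>. below n \<kappa> \<nu>} \<subset> {\<kappa>. below n \<kappa> \<mu>}" by blast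
qed

definition Mac_span :: "nat \<Rightarrow> zpoly set" where
  "Mac_span n = {f. \<exists>A c. finite A \<and> (\<forall>\<nu>\<in>A. is_composition n \<nu>) \<and> f = (\<Sum>\<nu>\<in>A. Const (c \<nu>) * Mac n \<nu>)}"

lemma Mac_span_add:
  assumes "f \<in> Mac_span n" "g \<in> Mac_span n"
  shows "f + g \<in> Mac_span n"
proof -
  obtain A c where A: "finite A" "\<forall>\<nu>\<in>A. is_composition n \<nu>" "f = (\<Sum>\<nu>\<in>A. Const (c \<nu>) * Mac n \<nu>)"
    using assms(1) unfolding Mac_span_def by blast
  obtain B e where B: "finite B" "\<forall>\<nu>\<in>B. is_composition n \<nu>" "g = (\<Sum>\<nu>\<in>B. Const (e \<nu>) * Mac n \<nu>)"
    using assms(2) unfolding Mac_span_def by blast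
  define c' where "c' \<nu> = (if \<nu> \<in> A then c \<nu> else 0)" for \<nu>
  define e' where "e' \<nu> = (if \<nu> \<in> B then e \<nu> else 0)" for \<nu>
  have "f = (\<Sum>\<nu>\<in>A \<union> B. Const (c' \<nu>) * Mac n \<nu>)"
    unfolding A(3) by (rule sum.mono_neutral_cong_left) (use A B in \<open>auto simp: c'_def\<close>)
  moreover have "g = (\<Sum>\<nu>\<in>A \<union> B. Const (e' \<nu>) * Mac n \<nu>)"
    unfolding B(3) by (rule sum.mono_neutral_cong_left) (use A B in \<open>auto simp: e'_def\<close>)
  ultimately have "f + g = (\<Sum>\<nu>\<in>A \<union> B. Const (c' \<nu> + e' \<nu>) * Mac n \<nu>)"
    by (simp add: sum.distrib Const_add distrib_right)
  then show ?thesis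
    unfolding Mac_span_def using A(1,2) B(1,2)
    by (intro CollectI exI[of _ "A \<union> B"] exI[of _ "\<lambda>\<nu>. c' \<nu> + e' \<nu>"]) auto
qed

lemma Mac_span_Const_mult:
  assumes "f \<in> Mac_span n"
  shows "Const a * f \<in> Mac_span n"
proof -
  obtain A c where A: "finite A" "\<forall>\<nu>\<in>A. is_composition n \<nu>" "f = (\<Sum>\<nu>\<in>A. Const (c \<nu>) * Mac n \<nu>)"
    using assms unfolding Mac_span_def by blast
  then have "Const a * f = (\<Sum>\<nu>\<in>A. Const (a * c \<nu>) * Mac n \<nu>)"
    by (simp add: sum_distrib_left Const_mult mult.assoc)
  then show ?thesis
    unfolding Mac_span_def using A(1,2) by (intro CollectI exI[of _ A] exI[of _ "\<lambda>\<nu>. a * c \<nu>"]) auto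
qed

lemma Mac_span_0: "0 \<in> Mac_span n"
  unfolding Mac_span_def by (intro CollectI exI[of _ "{}"]) simp

lemma Mac_span_Mac: "is_composition n \<nu> \<Longrightarrow> Mac n \<nu> \<in> Mac_span n"
  unfolding Mac_span_def by (intro CollectI exI[of _ "{\<nu>}"] exI[of _ "\<lambda>_. 1"]) simp

lemma Mac_span_sum: "(\<And>x. x \<in> A \<Longrightarrow> f x \<in> Mac_span n) \<Longrightarrow> sum f A \<in> Mac_span n"
  by (induction A rule: infinite_finite_induct) (simp_all add: Mac_span_0 Mac_span_add)

text \<open>Unitriangularity is inverted by induction on the number of compositions below.\<close>

lemma Mac_span_zmon:
  assumes n: "1 \<le> n" and "is_composition n \<nu>"
  shows "zmon \<nu> \<in> Mac_span n"
  using assms(2)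
proof (induction "card {\<kappa>. below n \<kappa> \<nu>}" arbitrary: \<nu> rule: less_induct)
  case less
  note M = is_Macdonald_Mac[OF n less.prems]
  let ?K = "Poly_Mapping.keys (Mac n \<nu>)"
  have \<nu>: "\<nu> \<in> ?K" "zcoeff (Mac n \<nu>) \<nu> = 1" using M by (simp_all add: is_Macdonald_def in_keys_iff)
  have "Mac n \<nu> = (\<Sum>\<mu>\<in>?K. Const (zcoeff (Mac n \<nu>) \<mu>) * zmon \<mu>)"
    by (rule zpoly_expansion) simp_all
  also have "\<dots> = zmon \<nu> + (\<Sum>\<mu>\<in>?K - {\<nu>}. Const (zcoeff (Mac n \<nu>) \<mu>) * zmon \<mu>)"
    using \<nu> by (simp add: sum.remove)
  finally have "Mac n \<nu> = zmon \<nu> + (\<Sum>\<mu>\<in>?K - {\<nu>}. Const (zcoeff (Mac n \<nu>) \<mu>) * zmon \<mu>)" .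
  then have z: "zmon \<nu> = Mac n \<nu> + Const (- 1) * (\<Sum>\<mu>\<in>?K - {\<nu>}. Const (zcoeff (Mac n \<nu>) \<mu>) * zmon \<mu>)"
    unfolding Const_uminus Const_1 by algebra
  have "zmon \<mu> \<in> Mac_span n" if "\<mu> \<in> ?K - {\<nu>}" for \<mu>
  proof -
    have "below n \<mu> \<nu>" using M that by (simp add: is_Macdonald_def)
    then show ?thesis using card_below_less[of n \<mu> \<nu>] less that by (auto simp: below_def)
  qed
  then have "Mac n \<nu> + Const (- 1) * (\<Sum>\<mu>\<in>?K - {\<nu>}. Const (zcoeff (Mac n \<nu>) \<mu>) * zmon \<mu>) \<in> Mac_span n"
    by (intro Mac_span_add Mac_span_Mac Mac_span_Const_mult Mac_span_sum less.prems)
  then show ?case by (subst z)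
qed

lemma npoly_Mac_span:
  assumes "1 \<le> n" "f \<in> npoly n"
  shows "f \<in> Mac_span n"
proof -
  have "f = (\<Sum>\<nu>\<in>Poly_Mapping.keys f. Const (zcoeff f \<nu>) * zmon \<nu>)"
    by (rule zpoly_expansion) simp_all
  moreover have "\<dots> \<in> Mac_span n"
    by (intro Mac_span_sum Mac_span_Const_mult Mac_span_zmon assms(1)) (use assms(2) in \<open>simp add: npoly_def\<close>)
  ultimately show ?thesis by simp
qed

lemma Mac_independent:
  assumes n: "1 \<le> n" and A: "finite A" "\<forall>\<nu>\<in>A. is_composition n \<nu>"
    and zero: "(\<Sum>\<nu>\<in>A. Const (c \<nu>) * Mac n \<nu>) = 0"
  shows "\<forall>\<nu>\<in>A. c \<nu> = 0"
proof (rule ccontr)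
  define B where "B = {\<nu> \<in> A. c \<nu> \<noteq> 0}"
  assume "\<not> ?thesis"
  then have "B \<noteq> {}" "finite B" using A(1) by (auto simp: B_def)
  \<comment> \<open>Where this rank is maximal among the nonzero coefficients, the leading monomial
    occurs in no other summand with a nonzero coefficient.\<close>
  define w where "w \<nu> = card {\<kappa>. below n \<kappa> \<nu>}" for \<nu>
  have "Max (w ` B) \<in> w ` B" by (rule Max_in) (use \<open>B \<noteq> {}\<close> \<open>finite B\<close> in simp_all)
  then obtain \<nu> where \<nu>: "\<nu> \<in> B" "w \<nu> = Max (w ` B)" by (elim imageE) simp
  have max: "w \<mu> \<le> w \<nu>" if "\<mu> \<in> B" for \<mu>
    unfolding \<nu>(2) using that \<open>finite B\<close> by simp
  have "c \<mu> * zcoeff (Mac n \<mu>) \<nu> = (if \<mu> = \<nu> then c \<nu> else 0)" if \<mu>: "\<mu> \<in> A" for \<mu>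
  proof -
    have M: "is_Macdonald n \<mu> (Mac n \<mu>)" using is_Macdonald_Mac[OF n] A(2) \<mu> by blast
    show ?thesis
    proof (cases "\<mu> = \<nu> \<or> c \<mu> = 0")
      case True
      then show ?thesis using M by (auto simp: is_Macdonald_def)
    next
      case False
      have "zcoeff (Mac n \<mu>) \<nu> = 0"
      proof (rule ccontr)
        assume "zcoeff (Mac n \<mu>) \<nu> \<noteq> 0"
        then have "below n \<nu> \<mu>" using M by (simp add: is_Macdonald_def in_keys_iff)
        then have "w \<nu> < w \<mu>" unfolding w_def
          by (rule card_below_less) (use False A(2) \<mu> in auto)
        moreover have "\<mu> \<in> B" using False \<mu> by (simp add: B_def)
        ultimately show False using max[of \<mu>] by simp
      qed
      then show ?thesis using False by simp
    qed
  qed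
  then have "(\<Sum>\<mu>\<in>A. c \<mu> * zcoeff (Mac n \<mu>) \<nu>) = (\<Sum>\<mu>\<in>A. if \<mu> = \<nu> then c \<nu> else 0)"
    by (rule sum.cong[OF refl])
  moreover have "zcoeff (\<Sum>\<nu>\<in>A. Const (c \<nu>) * Mac n \<nu>) \<nu> = (\<Sum>\<mu>\<in>A. c \<mu> * zcoeff (Mac n \<mu>) \<nu>)"
    by (simp add: lookup_sum)
  ultimately have "c \<nu> = 0" using A(1) \<nu>(1) by (simp add: zero B_def)
  then show False using \<nu>(1) by (simp add: B_def)
qed

lemma eigenvector_expansion:
  assumes n: "1 \<le> n" and f: "f \<in> npoly n" "\<And>i. i \<in> {1..n} \<Longrightarrow> Y n i f = Const (y i) * f"
  obtains A c where "finite A" "f = (\<Sum>\<nu>\<in>A. Const (c \<nu>) * Mac n \<nu>)"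
    "\<And>\<nu>. \<nu> \<in> A \<Longrightarrow> is_composition n \<nu>"
    "\<And>\<nu> i. \<nu> \<in> A \<Longrightarrow> c \<nu> \<noteq> 0 \<Longrightarrow> i \<in> {1..n} \<Longrightarrow> eigval n \<nu> i = y i"
proof -
  obtain A c where A: "finite A" "\<forall>\<nu>\<in>A. is_composition n \<nu>" "f = (\<Sum>\<nu>\<in>A. Const (c \<nu>) * Mac n \<nu>)"
    using npoly_Mac_span[OF n f(1)] unfolding Mac_span_def by blast
  have "eigval n \<nu> i = y i" if "\<nu> \<in> A" "c \<nu> \<noteq> 0" "i \<in> {1..n}" for \<nu> i
  proof -
    have "Y n i f = (\<Sum>\<nu>\<in>A. Const (c \<nu>) * Y n i (Mac n \<nu>))"
      unfolding A(3) by (simp add: Y_sum Y_Const_mult)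
    also have "\<dots> = (\<Sum>\<nu>\<in>A. Const (c \<nu> * eigval n \<nu> i) * Mac n \<nu>)"
    proof (rule sum.cong[OF refl])
      fix \<mu> assume "\<mu> \<in> A"
      then have "Y n i (Mac n \<mu>) = Const (eigval n \<mu> i) * Mac n \<mu>"
        using is_Macdonald_Mac[OF n] A(2) that(3) by (simp add: is_Macdonald_def)
      then show "Const (c \<mu>) * Y n i (Mac n \<mu>) = Const (c \<mu> * eigval n \<mu> i) * Mac n \<mu>"
        by (simp add: Const_mult mult.assoc)
    qed
    finally have "(\<Sum>\<nu>\<in>A. Const (c \<nu> * eigval n \<nu> i) * Mac n \<nu>) - Const (y i) * f = 0"
      using f(2)[OF that(3)] by simp
    then have "(\<Sum>\<nu>\<in>A. Const (c \<nu> * (eigval n \<nu> i - y i)) * Mac n \<nu>) = 0"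
      unfolding A(3) by (simp add: Const_mult Const_diff sum_distrib_left sum_subtractf algebra_simps)
    from Mac_independent[OF n A(1,2) this] have "c \<nu> * (eigval n \<nu> i - y i) = 0"
      using that(1) by (rule bspec)
    then show ?thesis using that(2) by simp
  qed
  then show ?thesis using that A by blast
qed

lemma eigval_composition_inject:
  assumes "is_composition n \<nu>" "is_composition n \<eta>" "\<And>i. i \<in> {1..n} \<Longrightarrow> eigval n \<nu> i = eigval n \<eta> i"
  shows "\<nu> = \<eta>"
  using assms composition_eqI eigval_eqD by metis

text \<open>The joint spectrum is simple: an expansion in the \<open>Mac\<close> basis can involve
  only compositions with the prescribed eigenvalues, and these determine the composition.\<close>

lemma eigenvector_unique:
  assumes n: "1 \<le> n" and \<eta>: "is_composition n \<eta>"
    and f: "f \<in> npoly n" "\<And>i. i \<in> {1..n} \<Longrightarrow> Y n i f = Const (eigval n \<eta> i) * f"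
  obtains a where "f = Const a * Mac n \<eta>"
proof -
  obtain A c where A: "finite A" "f = (\<Sum>\<nu>\<in>A. Const (c \<nu>) * Mac n \<nu>)"
    "\<And>\<nu>. \<nu> \<in> A \<Longrightarrow> is_composition n \<nu>"
    "\<And>\<nu> i. \<nu> \<in> A \<Longrightarrow> c \<nu> \<noteq> 0 \<Longrightarrow> i \<in> {1..n} \<Longrightarrow> eigval n \<nu> i = eigval n \<eta> i"
    using eigenvector_expansion[OF n f] by blast
  have "c \<nu> = 0" if "\<nu> \<in> A" "\<nu> \<noteq> \<eta>" for \<nu>
    using eigval_composition_inject[OF A(3)[OF that(1)] \<eta>] A(4)[OF that(1)] that(2) by blast
  then have "f = (\<Sum>\<nu>\<in>A. if \<nu> = \<eta> then Const (c \<eta>) * Mac n \<eta> else 0)"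
    unfolding A(2) by (intro sum.cong) auto
  also have "\<dots> = Const (if \<eta> \<in> A then c \<eta> else 0) * Mac n \<eta>"
    using A(1) by simp
  finally show ?thesis using that by blast
qed

text \<open>Uniqueness comes from the joint spectrum, so it also reaches competitors that are
  triangular merely for the coarser order in the definition of \<open>E\<close>.\<close>

lemma E_eq_Mac:
  assumes n: "1 \<le> n" and \<eta>: "is_composition n \<eta>"
  shows "E n \<eta> = Mac n \<eta>"
  unfolding E_def
proof (rule the_equality)
  note M = is_Macdonald_Mac[OF n \<eta>]
  show "is_nonsym_Macdonald n \<eta> (Mac n \<eta>)"
    unfolding is_nonsym_Macdonald_def
  proof (intro conjI ballI)
    fix \<nu> assume "\<nu> \<in> Poly_Mapping.keys (Mac n \<eta>)"
    then have "below n \<nu> \<eta>" using M by (simp add: is_Macdonald_def)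
    then show "\<nu> = \<eta> \<or> is_composition n \<nu> \<and> comp_prec n \<nu> \<eta>"
      using below_imp_comp_prec[OF \<eta>] by (auto simp: below_def)
  qed (use M in \<open>auto simp: is_Macdonald_def\<close>)
  fix f assume f: "is_nonsym_Macdonald n \<eta> f"
  then have "f \<in> npoly n" using \<eta> by (auto simp: is_nonsym_Macdonald_def npoly_def)
  then obtain a where a: "f = Const a * Mac n \<eta>"
    using eigenvector_unique[OF n \<eta>, of f] f by (auto simp: is_nonsym_Macdonald_def)
  then have "a = 1" using f M by (simp add: is_nonsym_Macdonald_def is_Macdonald_def)
  with a show "f = Mac n \<eta>" by simp
qed

lemma is_Macdonald_E: "1 \<le> n \<Longrightarrow> is_composition n \<eta> \<Longrightarrow> is_Macdonald n \<eta> (E n \<eta>)"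
  by (simp add: E_eq_Mac is_Macdonald_Mac)

text \<open>The raised eigenvector is again a Macdonald polynomial; solving for \<open>T i\<close>
  gives its action on two neighbouring members of an orbit.\<close>

lemma T_E_lt:
  assumes "i \<in> {1..<n}" "is_composition n \<eta>" "entry \<eta> i < entry \<eta> (Suc i)"
  shows "T i (E n \<eta>) = Const t * E n (act (adj i) \<eta>) - Const (intertwine n \<eta> i) * E n \<eta>"
proof -
  have n: "1 \<le> n" using assms(1) by simp
  let ?g = "Const (1 / t) * (T i (E n \<eta>) + Const (intertwine n \<eta> i) * E n \<eta>)"
  have g: "is_Macdonald n (act (adj i) \<eta>) ?g"
    by (rule is_Macdonald_raise[OF assms(1,3) is_Macdonald_E[OF n assms(2)]])
  have comp: "is_composition n (act (adj i) \<eta>)" by (rule is_composition_act_adj[OF assms(2,1)])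
  obtain a where a: "?g = Const a * Mac n (act (adj i) \<eta>)"
    using eigenvector_unique[OF n comp is_Macdonald_npoly[OF g]] g by (auto simp: is_Macdonald_def)
  have "zcoeff ?g (act (adj i) \<eta>) = 1" "zcoeff (Mac n (act (adj i) \<eta>)) (act (adj i) \<eta>) = 1"
    using g is_Macdonald_Mac[OF n comp] by (simp_all only: is_Macdonald_def)
  then have "a = 1" using a by simp
  then have "?g = E n (act (adj i) \<eta>)" using a by (simp add: E_eq_Mac[OF n comp])
  then have "Const t * E n (act (adj i) \<eta>) = Const t * ?g" by simp
  also have "\<dots> = Const (t * (1 / t)) * (T i (E n \<eta>) + Const (intertwine n \<eta> i) * E n \<eta>)"
    by (simp only: Const_mult mult.assoc)
  also have "\<dots> = T i (E n \<eta>) + Const (intertwine n \<eta> i) * E n \<eta>" by simp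
  finally show ?thesis by simp
qed


section \<open>Reduced words and parabolic subgroups\<close>

definition inv_set :: "nat \<Rightarrow> (nat \<Rightarrow> nat) \<Rightarrow> (nat \<times> nat) set" where
  "inv_set n \<sigma> = {(a, b). a \<in> {1..n} \<and> b \<in> {1..n} \<and> a < b \<and> \<sigma> b < \<sigma> a}"

definition inv_count :: "nat \<Rightarrow> (nat \<Rightarrow> nat) \<Rightarrow> nat" where
  "inv_count n \<sigma> = card (inv_set n \<sigma>)"

lemma finite_inv_set: "finite (inv_set n \<sigma>)"
  by (rule finite_subset[of _ "{1..n} \<times> {1..n}"]) (auto simp: inv_set_def)

lemma adj_permutes: "i \<in> {1..<n} \<Longrightarrow> adj i permutes {1..n}"
  by (simp add: adj_def permutes_swap_id)

lemma comp_adj_adj: "\<sigma> \<circ> adj i \<circ> adj i = \<sigma>"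
  by (simp add: fun_eq_iff)

text \<open>Exchanging two positions carries the old inversions along bijectively and adds the pair
  of these positions.\<close>

lemma inv_count_ascent:
  assumes "i \<in> {1..<n}" "\<sigma> i < \<sigma> (Suc i)"
  shows "inv_count n (\<sigma> \<circ> adj i) = Suc (inv_count n \<sigma>)"
proof -
  let ?f = "map_prod (adj i) (adj i)"
  have "inv_set n (\<sigma> \<circ> adj i) = insert (i, Suc i) (?f ` inv_set n \<sigma>)"
  proof (intro equalityI subsetI)
    fix x assume x: "x \<in> inv_set n (\<sigma> \<circ> adj i)"
    obtain a b where ab: "x = (a, b)" by (cases x)
    show "x \<in> insert (i, Suc i) (?f ` inv_set n \<sigma>)"
    proof (cases "x = (i, Suc i)")
      case False
      then have "(adj i a, adj i b) \<in> inv_set n \<sigma>"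
        using x assms by (auto simp: ab inv_set_def adj_eq split: if_splits)
      then have "?f (adj i a, adj i b) \<in> ?f ` inv_set n \<sigma>" by (rule imageI)
      then show ?thesis by (simp add: ab)
    qed simp
  next
    fix x assume "x \<in> insert (i, Suc i) (?f ` inv_set n \<sigma>)"
    then show "x \<in> inv_set n (\<sigma> \<circ> adj i)"
    proof
      assume "x = (i, Suc i)"
      then show ?thesis using assms by (simp add: inv_set_def)
    next
      assume "x \<in> ?f ` inv_set n \<sigma>"
      then obtain a b where ab: "x = (adj i a, adj i b)" "(a, b) \<in> inv_set n \<sigma>" by auto
      have "\<not> (a = i \<and> b = Suc i)" using ab(2) assms(2) by (auto simp: inv_set_def)
      moreover have "a \<in> {1..n}" "b \<in> {1..n}" "a < b" "\<sigma> b < \<sigma> a"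
        using ab(2) by (auto simp: inv_set_def)
      moreover from this have "adj i a \<in> {1..n}" "adj i b \<in> {1..n}"
        using assms(1) by (auto simp: adj_eq)
      ultimately show ?thesis
        using ab(1) by (auto simp: inv_set_def) (auto simp: adj_eq split: if_splits)
    qed
  qed
  moreover have "(i, Suc i) \<notin> ?f ` inv_set n \<sigma>"
  proof
    assume "(i, Suc i) \<in> ?f ` inv_set n \<sigma>"
    then obtain a b where "i = adj i a" "Suc i = adj i b" "(a, b) \<in> inv_set n \<sigma>" by auto
    then have "a = Suc i" "b = i" by (metis adj_adj adj_left adj_right)+
    then show False using \<open>(a, b) \<in> inv_set n \<sigma>\<close> by (simp add: inv_set_def)
  qed
  moreover have "card (?f ` inv_set n \<sigma>) = card (inv_set n \<sigma>)"
    by (rule card_image) (auto intro!: inj_onI, (metis adj_adj)+)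
  ultimately show ?thesis
    using finite_inv_set[of n \<sigma>] by (simp add: inv_count_def)
qed

lemma inv_count_descent:
  assumes "i \<in> {1..<n}" "\<sigma> (Suc i) < \<sigma> i"
  shows "inv_count n \<sigma> = Suc (inv_count n (\<sigma> \<circ> adj i))"
  using inv_count_ascent[OF assms(1), of "\<sigma> \<circ> adj i"] assms(2) by (simp add: comp_adj_adj)

lemma permutes_adj_neq: "\<sigma> permutes S \<Longrightarrow> \<sigma> i \<noteq> \<sigma> (Suc i)"
  by (metis n_not_Suc_n permutes_inj injD)

lemma word_perm_Nil [simp]: "word_perm [] = id"
  and word_perm_Cons: "word_perm (k # ks) = adj k \<circ> word_perm ks"
  by (simp_all add: word_perm_def)

lemma word_perm_append: "word_perm (ks @ ls) = word_perm ks \<circ> word_perm ls"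
  by (induction ks) (simp_all add: word_perm_Cons comp_assoc)

lemma word_perm_snoc: "word_perm (ks @ [i]) = word_perm ks \<circ> adj i"
  by (simp add: word_perm_append word_perm_Cons)

lemma word_perm_permutes: "set ks \<subseteq> {1..<n} \<Longrightarrow> word_perm ks permutes {1..n}"
proof (induction ks)
  case (Cons k ks)
  then show ?case
    unfolding word_perm_Cons by (intro permutes_compose adj_permutes) auto
qed (simp add: permutes_id)

lemma inv_count_id: "inv_count n id = 0"
proof -
  have "inv_set n id = {}" by (auto simp: inv_set_def)
  then show ?thesis by (simp add: inv_count_def)
qed

lemma inv_count_word_perm_le: "set ks \<subseteq> {1..<n} \<Longrightarrow> inv_count n (word_perm ks) \<le> length ks"
proof (induction ks rule: rev_induct)
  case (snoc i ks)
  let ?\<sigma> = "word_perm ks"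
  have i: "i \<in> {1..<n}" using snoc by simp
  have "?\<sigma> permutes {1..n}" using snoc.prems by (intro word_perm_permutes) auto
  then have "?\<sigma> i \<noteq> ?\<sigma> (Suc i)" by (rule permutes_adj_neq)
  then have "inv_count n (?\<sigma> \<circ> adj i) \<le> Suc (inv_count n ?\<sigma>)"
    using inv_count_ascent[OF i, of ?\<sigma>] inv_count_descent[OF i, of ?\<sigma>] by (cases "?\<sigma> i < ?\<sigma> (Suc i)") auto
  also have "\<dots> \<le> length (ks @ [i])" using snoc by simp
  finally show ?case by (simp only: word_perm_snoc)
qed (simp add: inv_count_id)


text \<open>The orbits of the subgroup generated by \<open>adj k\<close> for k in K are intervals,
  and all steps inside such an interval belong to K. The subgroup is recognised by preserving these
  blocks (\<open>parabolic_eq\<close>), which makes membership a pointwise condition.\<close>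

definition same_block :: "nat set \<Rightarrow> nat \<Rightarrow> nat \<Rightarrow> bool" where
  "same_block K x y \<longleftrightarrow> {min x y..<max x y} \<subseteq> K"

lemma same_block_refl [simp]: "same_block K x x"
  by (simp add: same_block_def)

lemma same_block_sym: "same_block K x y \<Longrightarrow> same_block K y x"
  by (simp add: same_block_def min.commute max.commute)

lemma same_block_trans: "same_block K x y \<Longrightarrow> same_block K y z \<Longrightarrow> same_block K x z"
proof -
  assume *: "same_block K x y" "same_block K y z"
  have "{min x z..<max x z} \<subseteq> {min x y..<max x y} \<union> {min y z..<max y z}" by auto
  then show ?thesis using * unfolding same_block_def by blast
qed

lemma same_block_Suc: "i \<in> K \<Longrightarrow> same_block K i (Suc i)"
  by (simp add: same_block_def)

lemma same_block_adj: "i \<in> K \<Longrightarrow> same_block K x (adj i x)"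
  using same_block_Suc same_block_sym by (auto simp: adj_eq)

lemma same_block_mono: "same_block K x y \<Longrightarrow> K \<subseteq> L \<Longrightarrow> same_block L x y"
  by (auto simp: same_block_def)

lemma same_block_less_induct:
  assumes "x < y" "same_block K x y" "\<And>i. i \<in> K \<Longrightarrow> \<sigma> i < (\<sigma> (Suc i) :: nat)"
  shows "\<sigma> x < \<sigma> y"
proof -
  have "{x..<y} \<subseteq> K" using assms(1,2) by (simp add: same_block_def)
  with assms(1) show ?thesis
  proof (induction y)
    case (Suc y)
    have "\<sigma> y < \<sigma> (Suc y)" using Suc.prems assms(3) by (auto simp: subset_iff)
    then show ?case using Suc by (cases "x = y") (auto simp: subset_iff less_Suc_eq intro: order_less_trans)
  qed simp
qed

text \<open>Let x be the least moved point and y its preimage. Then y lies in the block of x and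
  behind x, so \<open>\<sigma> x < x\<close>; but points before x are fixed, contradicting
  injectivity.\<close>

lemma ascending_imp_id:
  assumes "\<sigma> permutes S" "\<And>x. same_block K x (\<sigma> x)" "\<And>i. i \<in> K \<Longrightarrow> \<sigma> i < \<sigma> (Suc i)"
  shows "\<sigma> = id"
proof (rule ccontr)
  assume "\<sigma> \<noteq> id"
  then have "\<exists>x. \<sigma> x \<noteq> x" by (auto simp: fun_eq_iff)
  define x where "x = (LEAST x. \<sigma> x \<noteq> x)"
  have x: "\<sigma> x \<noteq> x" unfolding x_def using \<open>\<exists>x. \<sigma> x \<noteq> x\<close> by (rule LeastI_ex)
  have less: "\<sigma> z = z" if "z < x" for z
    using that unfolding x_def by (meson not_less_Least)
  have inj: "\<sigma> a = \<sigma> b \<Longrightarrow> a = b" for a b using assms(1) by (meson injD permutes_inj)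
  obtain y where y: "\<sigma> y = x" using assms(1) by (metis permutes_inverses(1))
  have "x < y" using x y less by (metis linorder_neqE_nat)
  moreover have "same_block K x y" using assms(2)[of y] y by (metis same_block_sym)
  ultimately have "\<sigma> x < \<sigma> y" using assms(3) by (rule same_block_less_induct)
  then have "\<sigma> (\<sigma> x) = \<sigma> x" using less y by simp
  then show False using inj x by blast
qed

text \<open>While the permutation is not the identity it has a descent inside K, and removing it
  lowers the inversion count. This yields both reduced words in general and the fact that those for
  a parabolic element can be kept inside K.\<close>

lemma word_exists:
  assumes "K \<subseteq> {1..<n}" "\<sigma> permutes {1..n}" "\<And>x. same_block K x (\<sigma> x)"
  shows "\<exists>ks. set ks \<subseteq> K \<and> word_perm ks = \<sigma> \<and> length ks = inv_count n \<sigma>"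
  using assms(2,3)
proof (induction "inv_count n \<sigma>" arbitrary: \<sigma> rule: less_induct)
  case less
  show ?case
  proof (cases "\<sigma> = id")
    case True
    then show ?thesis by (intro exI[of _ "[]"]) (simp add: inv_count_id)
  next
    case False
    then obtain i where i: "i \<in> K" "\<not> \<sigma> i < \<sigma> (Suc i)"
      using ascending_imp_id[OF less.prems] by blast
    then have i': "i \<in> {1..<n}" "\<sigma> (Suc i) < \<sigma> i"
      using assms(1) permutes_adj_neq[OF less.prems(1), of i] by auto
    note inv = inv_count_descent[where \<sigma> = \<sigma>, OF i']
    have "same_block K x ((\<sigma> \<circ> adj i) x)" for x
      using same_block_trans[OF same_block_adj[OF i(1)] less.prems(2)] by simp
    moreover have "\<sigma> \<circ> adj i permutes {1..n}"
      by (rule permutes_compose[OF adj_permutes[OF i'(1)] less.prems(1)])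
    ultimately obtain ks where "set ks \<subseteq> K" "word_perm ks = \<sigma> \<circ> adj i" "length ks = inv_count n (\<sigma> \<circ> adj i)"
      using less.hyps[of "\<sigma> \<circ> adj i"] inv by auto
    then show ?thesis
      using i inv by (intro exI[of _ "ks @ [i]"]) (simp add: word_perm_snoc comp_adj_adj)
  qed
qed

lemma same_block_full: "\<sigma> permutes {1..n} \<Longrightarrow> same_block {1..<n} x (\<sigma> x)"
proof (cases "x \<in> {1..n}")
  case True
  assume "\<sigma> permutes {1..n}"
  with True have "\<sigma> x \<in> {1..n}" by (simp only: permutes_in_image)
  with True show ?thesis by (auto simp: same_block_def)
next
  case False
  assume "\<sigma> permutes {1..n}"
  then have "\<sigma> x = x" using False by (rule permutes_not_in)
  then show ?thesis by simp
qed

lemma perm_length_eq: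
  assumes "\<sigma> permutes {1..n}"
  shows "perm_length n \<sigma> = inv_count n \<sigma>"
  unfolding perm_length_def is_word_def
proof (rule Least_equality)
  show "\<exists>ks. (set ks \<subseteq> {1..<n} \<and> word_perm ks = \<sigma>) \<and> length ks = inv_count n \<sigma>"
    using word_exists[OF subset_refl assms same_block_full[OF assms]] by blast
next
  fix m assume "\<exists>ks. (set ks \<subseteq> {1..<n} \<and> word_perm ks = \<sigma>) \<and> length ks = m"
  then show "inv_count n \<sigma> \<le> m" using inv_count_word_perm_le by blast
qed

lemma is_reduced_word_iff:
  "is_reduced_word n \<sigma> ks \<longleftrightarrow> set ks \<subseteq> {1..<n} \<and> word_perm ks = \<sigma> \<and> length ks = inv_count n \<sigma>"
  unfolding is_reduced_word_def is_word_def using perm_length_eq word_perm_permutes by metis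

lemma reduced_word_snocD:
  assumes "is_reduced_word n \<sigma> (ks @ [i])"
  shows "i \<in> {1..<n}" "\<sigma> (Suc i) < \<sigma> i" "is_reduced_word n (\<sigma> \<circ> adj i) ks" "\<sigma> permutes {1..n}"
proof -
  have *: "set ks \<subseteq> {1..<n}" "i \<in> {1..<n}" "\<sigma> = word_perm ks \<circ> adj i" "inv_count n \<sigma> = Suc (length ks)"
    using assms by (auto simp: is_reduced_word_iff word_perm_snoc)
  show i: "i \<in> {1..<n}" by fact
  show "\<sigma> permutes {1..n}"
    unfolding *(3) by (rule permutes_compose[OF adj_permutes[OF i] word_perm_permutes[OF *(1)]])
  have w: "word_perm ks = \<sigma> \<circ> adj i" by (simp add: *(3) comp_adj_adj)
  have le: "inv_count n (\<sigma> \<circ> adj i) \<le> length ks"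
    using inv_count_word_perm_le[OF *(1)] w by simp
  show d: "\<sigma> (Suc i) < \<sigma> i"
  proof (rule ccontr)
    assume "\<not> ?thesis"
    then have "\<sigma> i < \<sigma> (Suc i)"
      using permutes_adj_neq[OF \<open>\<sigma> permutes {1..n}\<close>, of i] by simp
    then show False using inv_count_ascent[OF i, of \<sigma>] le *(4) by simp
  qed
  show "is_reduced_word n (\<sigma> \<circ> adj i) ks"
    using * w inv_count_descent[where \<sigma> = \<sigma>, OF i d] by (simp add: is_reduced_word_iff)
qed

lemma reduced_word_snocI:
  assumes "is_reduced_word n (\<sigma> \<circ> adj i) ks" "i \<in> {1..<n}" "\<sigma> (Suc i) < \<sigma> i"
  shows "is_reduced_word n \<sigma> (ks @ [i])"
  using assms inv_count_descent[where \<sigma> = \<sigma>, OF assms(2,3)]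
  by (simp add: is_reduced_word_iff word_perm_snoc comp_adj_adj)

lemma reduced_word_exists: "\<sigma> permutes {1..n} \<Longrightarrow> \<exists>ks. is_reduced_word n \<sigma> ks"
  unfolding is_reduced_word_iff using word_exists[of "{1..<n}" n \<sigma>] same_block_full by blast

text \<open>Matsumoto's theorem: two words ending in different descents are both moved to words ending
  in the longest element of the dihedral group generated by the two last letters.\<close>

lemma foldr_T_reduced_word:
  "is_reduced_word n \<sigma> ks \<Longrightarrow> is_reduced_word n \<sigma> ls \<Longrightarrow> foldr T ks f = foldr T ls f"
proof (induction "inv_count n \<sigma>" arbitrary: \<sigma> ks ls f rule: less_induct)
  case less
  have len: "length ks = inv_count n \<sigma>" "length ls = inv_count n \<sigma>"
    using less.prems by (simp_all add: is_reduced_word_iff)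
  show ?case
  proof (cases "inv_count n \<sigma>")
    case 0
    then show ?thesis using len by simp
  next
    case (Suc m)
    obtain xs i ys j where ks: "ks = xs @ [i]" and ls: "ls = ys @ [j]"
      using len Suc by (metis length_0_conv nat.distinct(1) rev_exhaust)
    note x = reduced_word_snocD[OF less.prems(1)[unfolded ks]]
    note y = reduced_word_snocD[OF less.prems(2)[unfolded ls]]
    have IH: "foldr T us g = foldr T vs g"
      if "is_reduced_word n (\<sigma> \<circ> adj k) us" "is_reduced_word n (\<sigma> \<circ> adj k) vs"
        "k \<in> {1..<n}" "\<sigma> (Suc k) < \<sigma> k" for us vs g k
      using less.hyps[of "\<sigma> \<circ> adj k" us vs g] that inv_count_descent[where \<sigma> = \<sigma>, OF that(3,4)] by simp
    have commuting: "foldr T (us @ [k]) f = foldr T (vs @ [l]) f"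
      if u: "is_reduced_word n (\<sigma> \<circ> adj k) us" "k \<in> {1..<n}" "\<sigma> (Suc k) < \<sigma> k"
        and v: "is_reduced_word n (\<sigma> \<circ> adj l) vs" "l \<in> {1..<n}" "\<sigma> (Suc l) < \<sigma> l"
        and "Suc k < l" for k l us vs
    proof -
      have comm: "\<sigma> \<circ> adj k \<circ> adj l = \<sigma> \<circ> adj l \<circ> adj k"
        using that(7) by (auto simp: fun_eq_iff adj_eq)
      obtain zs where zs: "is_reduced_word n (\<sigma> \<circ> adj k \<circ> adj l) zs"
        using reduced_word_exists[OF permutes_compose[OF adj_permutes[OF v(2)] permutes_compose[OF adj_permutes[OF u(2)] x(4)]]] by blast
      have "is_reduced_word n (\<sigma> \<circ> adj k) (zs @ [l])"
        by (rule reduced_word_snocI[OF zs v(2)]) (use that in \<open>simp add: adj_eq\<close>)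
      moreover have "is_reduced_word n (\<sigma> \<circ> adj l) (zs @ [k])"
        by (rule reduced_word_snocI[OF zs[unfolded comm] u(2)]) (use that in \<open>simp add: adj_eq\<close>)
      ultimately show ?thesis
        using IH[OF u(1) _ u(2,3), of "zs @ [l]" "T k f"] IH[OF v(1) _ v(2,3), of "zs @ [k]" "T l f"]
          T_commute[OF that(7)] by simp
    qed
    have braiding: "foldr T (us @ [k]) f = foldr T (vs @ [Suc k]) f"
      if u: "is_reduced_word n (\<sigma> \<circ> adj k) us" "k \<in> {1..<n}" "\<sigma> (Suc k) < \<sigma> k"
        and v: "is_reduced_word n (\<sigma> \<circ> adj (Suc k)) vs" "Suc k \<in> {1..<n}" "\<sigma> (Suc (Suc k)) < \<sigma> (Suc k)"
      for k us vs
    proof -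
      let ?s = "adj k" and ?r = "adj (Suc k)"
      have braid: "\<sigma> \<circ> ?s \<circ> ?r \<circ> ?s = \<sigma> \<circ> ?r \<circ> ?s \<circ> ?r"
        by (auto simp: fun_eq_iff adj_eq)
      have p: "\<tau> \<circ> ?s permutes {1..n}" "\<tau> \<circ> ?r permutes {1..n}" if "\<tau> permutes {1..n}" for \<tau>
        using that permutes_compose adj_permutes u(2) v(2) by blast+
      obtain zs where zs: "is_reduced_word n (\<sigma> \<circ> ?s \<circ> ?r \<circ> ?s) zs"
        using reduced_word_exists p x(4) by metis
      have "is_reduced_word n (\<sigma> \<circ> ?s \<circ> ?r) (zs @ [k])"
        by (rule reduced_word_snocI[OF zs u(2)]) (use u v in \<open>simp add: adj_eq\<close>)
      from reduced_word_snocI[OF this v(2)]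
      have 1: "is_reduced_word n (\<sigma> \<circ> ?s) (zs @ [k] @ [Suc k])"
        using u v by (simp add: adj_eq)
      have "is_reduced_word n (\<sigma> \<circ> ?r \<circ> ?s) (zs @ [Suc k])"
        by (rule reduced_word_snocI[OF zs[unfolded braid] v(2)]) (use u v in \<open>simp add: adj_eq\<close>)
      from reduced_word_snocI[OF this u(2)]
      have 2: "is_reduced_word n (\<sigma> \<circ> ?r) (zs @ [Suc k] @ [k])"
        using u v by (simp add: adj_eq)
      show ?thesis
        using IH[OF u(1) 1 u(2,3), of "T k f"] IH[OF v(1) 2 v(2,3), of "T (Suc k) f"]
          T_braid[of k f] by simp
    qed
    consider "i = j" | "Suc i < j" | "Suc j < i" | "j = Suc i" | "i = Suc j" by linarith
    then show ?thesis
    proof cases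
      case 1
      then show ?thesis
        using IH[OF x(3) _ x(1,2), of ys "T i f"] y(3) by (simp add: ks ls)
    next
      case 2
      show ?thesis unfolding ks ls by (rule commuting[OF x(3,1,2) y(3,1,2) 2])
    next
      case 3
      show ?thesis unfolding ks ls by (rule commuting[OF y(3,1,2) x(3,1,2) 3, symmetric])
    next
      case 4
      show ?thesis unfolding ks ls 4 by (rule braiding[OF x(3,1,2) y(3,1,2)[unfolded 4]])
    next
      case 5
      show ?thesis unfolding ks ls 5 by (rule braiding[OF y(3,1,2) x(3,1,2)[unfolded 5], symmetric])
    qed
  qed
qed

lemma T_perm_eq: "is_reduced_word n \<sigma> ks \<Longrightarrow> T_perm n \<sigma> f = foldr T ks f"
  unfolding T_perm_def by (rule foldr_T_reduced_word[OF someI[of "is_reduced_word n \<sigma>"]])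

lemma T_perm_comp_adj:
  assumes "\<sigma> permutes {1..n}" "i \<in> {1..<n}" "\<sigma> i < \<sigma> (Suc i)"
  shows "T_perm n (\<sigma> \<circ> adj i) f = T_perm n \<sigma> (T i f)"
proof -
  obtain ks where ks: "is_reduced_word n \<sigma> ks" using reduced_word_exists[OF assms(1)] by blast
  have "is_reduced_word n (\<sigma> \<circ> adj i) (ks @ [i])"
    by (rule reduced_word_snocI) (use ks assms in \<open>simp_all add: comp_adj_adj\<close>)
  then show ?thesis using ks by (simp add: T_perm_eq)
qed

lemma T_perm_add: "T_perm n \<sigma> (f + g) = T_perm n \<sigma> f + T_perm n \<sigma> g"
  by (simp add: T_perm_def foldr_T_add)

lemma T_perm_Const_mult: "T_perm n \<sigma> (Const c * f) = Const c * T_perm n \<sigma> f"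
  by (simp add: T_perm_def foldr_T_Const_mult)


text \<open>Generators preserve blocks; conversely \<open>word_exists\<close> writes a
  block-preserving permutation as a word in the generators.\<close>

lemma parabolic_eq:
  assumes "K \<subseteq> {1..<n}"
  shows "parabolic n K = {\<sigma>. \<sigma> permutes {1..n} \<and> (\<forall>x. same_block K x (\<sigma> x))}"
proof (intro equalityI subsetI CollectI)
  fix \<sigma> assume "\<sigma> \<in> parabolic n K"
  then show "\<sigma> permutes {1..n} \<and> (\<forall>x. same_block K x (\<sigma> x))"
    unfolding parabolic_def
  proof (induction rule: generate.induct)
    case one
    then show ?case
      unfolding sym_group_one by (intro conjI permutes_id) simp
  next
    case (incl \<sigma>)
    then show ?case using assms adj_permutes same_block_adj by blast
  next
    case (inv \<sigma>)
    then obtain i where i: "\<sigma> = adj i" "i \<in> K" by blast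
    then have "adj i permutes {1..n}" using assms adj_permutes by blast
    then have "inv\<^bsub>sym_group n\<^esub> \<sigma> = adj i" by (simp add: i sym_group_carrier)
    then show ?case using \<open>adj i permutes {1..n}\<close> i same_block_adj by simp
  next
    case (eng \<sigma> \<tau>)
    have "\<sigma> \<circ> \<tau> permutes {1..n}" using eng.IH by (intro permutes_compose) blast+
    moreover have "same_block K x ((\<sigma> \<circ> \<tau>) x)" for x
      using eng.IH same_block_trans[of K x "\<tau> x" "\<sigma> (\<tau> x)"] by simp
    ultimately show ?case unfolding sym_group_mult by blast
  qed
next
  fix \<sigma> assume "\<sigma> \<in> {\<sigma>. \<sigma> permutes {1..n} \<and> (\<forall>x. same_block K x (\<sigma> x))}"
  then obtain ks where ks: "set ks \<subseteq> K" "word_perm ks = \<sigma>" using word_exists[OF assms] by blast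
  have "word_perm ks \<in> generate (sym_group n) (adj ` K)"
    using ks(1)
  proof (induction ks)
    case Nil
    show ?case unfolding word_perm_Nil by (rule generate.one[where G = "sym_group n", unfolded sym_group_one])
  next
    case (Cons k ks)
    then have "adj k \<in> generate (sym_group n) (adj ` K)" by (intro generate.incl) simp
    moreover have "word_perm ks \<in> generate (sym_group n) (adj ` K)" using Cons by simp
    ultimately have "adj k \<otimes>\<^bsub>sym_group n\<^esub> word_perm ks \<in> generate (sym_group n) (adj ` K)"
      by (rule generate.eng)
    then show ?case by (simp only: word_perm_Cons sym_group_mult)
  qed
  then show "\<sigma> \<in> parabolic n K" by (simp add: parabolic_def ks(2))
qed


section \<open>The symmetrizer\<close>

lemma parabolicD:
  assumes "K \<subseteq> {1..<n}" "\<sigma> \<in> parabolic n K"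
  shows "\<sigma> permutes {1..n}" "same_block K x (\<sigma> x)"
  using assms by (simp_all add: parabolic_eq)

lemma parabolic_adj: "K \<subseteq> {1..<n} \<Longrightarrow> i \<in> K \<Longrightarrow> adj i \<in> parabolic n K"
  unfolding parabolic_eq using adj_permutes same_block_adj by blast

lemma parabolic_id: "K \<subseteq> {1..<n} \<Longrightarrow> id \<in> parabolic n K"
  unfolding parabolic_eq by (intro CollectI conjI permutes_id) simp

lemma parabolic_comp:
  assumes "K \<subseteq> {1..<n}" "\<sigma> \<in> parabolic n K" "\<tau> \<in> parabolic n K"
  shows "\<sigma> \<circ> \<tau> \<in> parabolic n K"
  unfolding parabolic_eq[OF assms(1)]
proof (intro CollectI conjI allI)
  show "\<sigma> \<circ> \<tau> permutes {1..n}"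
    using parabolicD(1)[OF assms(1)] assms(2,3) by (intro permutes_compose) auto
  show "same_block K x ((\<sigma> \<circ> \<tau>) x)" for x
    using same_block_trans[OF parabolicD(2)[OF assms(1,3)] parabolicD(2)[OF assms(1,2)]] by simp
qed

lemma parabolic_inv:
  assumes "K \<subseteq> {1..<n}" "\<sigma> \<in> parabolic n K"
  shows "inv' \<sigma> \<in> parabolic n K"
  unfolding parabolic_eq[OF assms(1)]
proof (intro CollectI conjI allI)
  note p = parabolicD(1)[OF assms]
  show "inv' \<sigma> permutes {1..n}" by (rule permutes_inv[OF p])
  show "same_block K x (inv' \<sigma> x)" for x
    using same_block_sym[OF parabolicD(2)[OF assms, of "inv' \<sigma> x"]] by (simp add: permutes_inverses(1)[OF p])
qed

lemma finite_parabolic: "K \<subseteq> {1..<n} \<Longrightarrow> finite (parabolic n K)"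
  unfolding parabolic_eq by (rule finite_subset[OF _ finite_permutations[of "{1..n}"]]) auto

lemma parabolic_mono:
  assumes "K \<subseteq> L" "L \<subseteq> {1..<n}"
  shows "parabolic n K \<subseteq> parabolic n L"
proof
  fix \<sigma> assume "\<sigma> \<in> parabolic n K"
  then show "\<sigma> \<in> parabolic n L"
    using parabolicD[OF order_trans[OF assms]] same_block_mono[OF _ assms(1)]
    unfolding parabolic_eq[OF assms(2)] by blast
qed

section \<open>The commuting factors belonging to I and J\<close>

definition positions :: "nat set \<Rightarrow> nat set" where
  "positions K = K \<union> Suc ` K"

lemma same_block_imp_positions: "same_block K x y \<Longrightarrow> x \<noteq> y \<Longrightarrow> x \<in> positions K"
proof (cases x y rule: linorder_cases)
  case less
  assume "same_block K x y"
  with less show ?thesis by (auto simp: same_block_def positions_def)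
next
  case greater
  assume "same_block K x y"
  with greater have "x - 1 \<in> K" "x = Suc (x - 1)" by (auto simp: same_block_def subset_iff)
  then show ?thesis unfolding positions_def by blast
qed simp

lemma parabolic_fixes: "K \<subseteq> {1..<n} \<Longrightarrow> \<sigma> \<in> parabolic n K \<Longrightarrow> x \<notin> positions K \<Longrightarrow> \<sigma> x = x"
  using parabolicD(2) same_block_imp_positions by metis

lemma parabolic_positions: "K \<subseteq> {1..<n} \<Longrightarrow> \<sigma> \<in> parabolic n K \<Longrightarrow> x \<in> positions K \<Longrightarrow> \<sigma> x \<in> positions K"
  using parabolicD(2) same_block_imp_positions same_block_sym by metis

lemma adj_positions: "i \<in> K \<Longrightarrow> i \<in> positions K \<and> Suc i \<in> positions K"
  by (simp add: positions_def)


locale admissible_sets =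
  fixes n :: nat and I J :: "nat set"
  assumes admissible: "admissible n I J"
begin

lemma I_sub: "I \<subseteq> {1..<n}" and J_sub: "J \<subseteq> {1..<n}" and IJ_sub: "I \<union> J \<subseteq> {1..<n}"
  using admissible by (force simp: admissible_def)+

lemma positions_disjoint: "positions I \<inter> positions J = {}"
  using admissible by (fastforce simp: admissible_def positions_def)

lemma parabolic_commute:
  assumes "\<sigma> \<in> parabolic n I" "\<tau> \<in> parabolic n J"
  shows "\<sigma> \<circ> \<tau> = \<tau> \<circ> \<sigma>"
proof
  fix x
  consider "x \<in> positions I" "x \<notin> positions J" | "x \<in> positions J" "x \<notin> positions I"
    | "x \<notin> positions I" "x \<notin> positions J"
    using positions_disjoint by blast
  then show "(\<sigma> \<circ> \<tau>) x = (\<tau> \<circ> \<sigma>) x"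
  proof cases
    case 1
    then have "\<sigma> x \<notin> positions J" using parabolic_positions[OF I_sub assms(1)] positions_disjoint by blast
    then show ?thesis using 1 parabolic_fixes[OF J_sub assms(2)] by simp
  next
    case 2
    then have "\<tau> x \<notin> positions I" using parabolic_positions[OF J_sub assms(2)] positions_disjoint by blast
    then show ?thesis using 2 parabolic_fixes[OF I_sub assms(1)] by simp
  next
    case 3
    then show ?thesis using parabolic_fixes[OF I_sub assms(1)] parabolic_fixes[OF J_sub assms(2)] by simp
  qed
qed

lemma J_value: "\<sigma> \<in> parabolic n I \<Longrightarrow> \<tau> \<in> parabolic n J \<Longrightarrow> x \<in> positions J \<Longrightarrow> (\<sigma> \<circ> \<tau>) x = \<tau> x"
  using parabolic_fixes[OF I_sub] parabolic_positions[OF J_sub] positions_disjoint by fastforce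

text \<open>The I-factor fixes every position touched by J, so the J-factor can be read off there
  and is the identity elsewhere.\<close>

lemma J_part_comp:
  assumes "\<sigma> \<in> parabolic n I" "\<tau> \<in> parabolic n J"
  shows "J_part n I J (\<sigma> \<circ> \<tau>) = \<tau>"
  unfolding J_part_def
proof (rule the_equality)
  show "\<tau> \<in> parabolic n J \<and> (\<exists>\<omega>I\<in>parabolic n I. \<sigma> \<circ> \<tau> = \<omega>I \<circ> \<tau>)" using assms by blast
  fix \<tau>' assume "\<tau>' \<in> parabolic n J \<and> (\<exists>\<sigma>'\<in>parabolic n I. \<sigma> \<circ> \<tau> = \<sigma>' \<circ> \<tau>')"
  then obtain \<sigma>' where *: "\<tau>' \<in> parabolic n J" "\<sigma>' \<in> parabolic n I" "\<sigma> \<circ> \<tau> = \<sigma>' \<circ> \<tau>'" by blast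
  show "\<tau>' = \<tau>"
  proof
    fix x
    show "\<tau>' x = \<tau> x"
    proof (cases "x \<in> positions J")
      case True
      then show ?thesis using J_value[OF assms True] J_value[OF *(2,1) True] *(3) by simp
    next
      case False
      then show ?thesis
        using parabolic_fixes[OF J_sub assms(2)] parabolic_fixes[OF J_sub *(1)] by simp
    qed
  qed
qed

lemma parabolic_IJ_cases:
  assumes "\<omega> \<in> parabolic n (I \<union> J)"
  obtains \<sigma> \<tau> where "\<sigma> \<in> parabolic n I" "\<tau> \<in> parabolic n J" "\<omega> = \<sigma> \<circ> \<tau>"
proof -
  obtain ks where ks: "set ks \<subseteq> I \<union> J" "word_perm ks = \<omega>"
    using word_exists[OF IJ_sub parabolicD(1)[OF IJ_sub assms] parabolicD(2)[OF IJ_sub assms]] by blast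
  have "\<exists>\<sigma> \<tau>. \<sigma> \<in> parabolic n I \<and> \<tau> \<in> parabolic n J \<and> word_perm ks = \<sigma> \<circ> \<tau>"
    using ks(1)
  proof (induction ks)
    case Nil
    show ?case
      unfolding word_perm_Nil
      by (intro exI[of _ id] conjI parabolic_id I_sub J_sub) (rule comp_id[symmetric])
  next
    case (Cons k ks)
    then have "set ks \<subseteq> I \<union> J" by simp
    then obtain \<sigma> \<tau> where *: "\<sigma> \<in> parabolic n I" "\<tau> \<in> parabolic n J" "word_perm ks = \<sigma> \<circ> \<tau>"
      using Cons.IH by blast
    show ?case
    proof (cases "k \<in> I")
      case True
      have "adj k \<circ> \<sigma> \<in> parabolic n I" by (rule parabolic_comp[OF I_sub parabolic_adj[OF I_sub True] *(1)])
      moreover have "word_perm (k # ks) = (adj k \<circ> \<sigma>) \<circ> \<tau>" unfolding word_perm_Cons *(3) by (rule comp_assoc[symmetric])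
      ultimately show ?thesis using *(2) by blast
    next
      case False
      then have k: "k \<in> J" using Cons.prems by simp
      have "adj k \<circ> \<tau> \<in> parabolic n J" by (rule parabolic_comp[OF J_sub parabolic_adj[OF J_sub k] *(2)])
      moreover have "word_perm (k # ks) = \<sigma> \<circ> (adj k \<circ> \<tau>)"
        unfolding word_perm_Cons *(3) using parabolic_commute[OF *(1) parabolic_adj[OF J_sub k]]
        by (metis comp_assoc)
      ultimately show ?thesis using *(1) by blast
    qed
  qed
  then show ?thesis using that ks(2) by blast
qed

lemma parabolic_I_sub: "parabolic n I \<subseteq> parabolic n (I \<union> J)"
  and parabolic_J_sub: "parabolic n J \<subseteq> parabolic n (I \<union> J)"
  using parabolic_mono[OF _ IJ_sub] by blast+

section \<open>Absorption of the Hecke operators by the symmetrizer\<close>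

definition weight :: "(nat \<Rightarrow> nat) \<Rightarrow> qt" where
  "weight \<omega> = (- 1 / t) ^ perm_length n (J_part n I J \<omega>)"

lemma weight_I:
  assumes "\<omega> \<in> parabolic n (I \<union> J)" "i \<in> I"
  shows "weight (\<omega> \<circ> adj i) = weight \<omega>"
proof -
  obtain \<sigma> \<tau> where *: "\<sigma> \<in> parabolic n I" "\<tau> \<in> parabolic n J" "\<omega> = \<sigma> \<circ> \<tau>"
    using parabolic_IJ_cases[OF assms(1)] .
  have i: "adj i \<in> parabolic n I" by (rule parabolic_adj[OF I_sub assms(2)])
  have "\<omega> \<circ> adj i = (\<sigma> \<circ> adj i) \<circ> \<tau>"
    using parabolic_commute[OF i *(2)] unfolding *(3) by (metis comp_assoc)
  then show ?thesis
    unfolding weight_def using J_part_comp[OF parabolic_comp[OF I_sub *(1) i] *(2)] J_part_comp[OF *(1,2)] *(3) by simp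
qed

lemma weight_J:
  assumes "\<omega> \<in> parabolic n (I \<union> J)" "j \<in> J" "\<omega> j < \<omega> (Suc j)"
  shows "weight (\<omega> \<circ> adj j) = - 1 / t * weight \<omega>"
proof -
  obtain \<sigma> \<tau> where *: "\<sigma> \<in> parabolic n I" "\<tau> \<in> parabolic n J" "\<omega> = \<sigma> \<circ> \<tau>"
    using parabolic_IJ_cases[OF assms(1)] .
  have j: "adj j \<in> parabolic n J" by (rule parabolic_adj[OF J_sub assms(2)])
  have "J_part n I J (\<omega> \<circ> adj j) = \<tau> \<circ> adj j"
    using J_part_comp[OF *(1) parabolic_comp[OF J_sub *(2) j]] *(3) by (simp only: comp_assoc)
  moreover have "J_part n I J \<omega> = \<tau>" using J_part_comp[OF *(1,2)] *(3) by simp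
  moreover have "\<tau> j < \<tau> (Suc j)"
    using assms(3) J_value[OF *(1,2)] adj_positions[OF assms(2)] *(3) by metis
  then have "perm_length n (\<tau> \<circ> adj j) = Suc (perm_length n \<tau>)"
    using inv_count_ascent[of j n \<tau>] assms(2) J_sub
      perm_length_eq[OF parabolicD(1)[OF J_sub *(2)]]
      perm_length_eq[OF parabolicD(1)[OF J_sub parabolic_comp[OF J_sub *(2) j]]] by auto
  ultimately show ?thesis unfolding weight_def by simp
qed

lemma O_op_eq: "O_op n I J f = (\<Sum>\<omega>\<in>parabolic n (I \<union> J). Const (weight \<omega>) * T_perm n \<omega> f)"
  by (simp add: O_op_def weight_def)

lemma O_op_add: "O_op n I J (f + g) = O_op n I J f + O_op n I J g"
  by (simp add: O_op_eq T_perm_add distrib_left sum.distrib)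

lemma O_op_Const_mult: "O_op n I J (Const c * f) = Const c * O_op n I J f"
  by (simp add: O_op_eq T_perm_Const_mult mult.left_commute sum_distrib_left)

lemma O_op_diff: "O_op n I J (f - g) = O_op n I J f - O_op n I J g"
  by (metis O_op_add add_diff_cancel_right' diff_add_cancel)

lemma O_op_0: "O_op n I J 0 = 0"
  using O_op_Const_mult[of 0 0] by simp

lemma O_op_sum: "O_op n I J (sum f A) = (\<Sum>x\<in>A. O_op n I J (f x))"
  by (induction A rule: infinite_finite_induct) (simp_all add: O_op_0 O_op_add)

text \<open>The group is paired off as \<open>\<omega>\<close> and
  \<open>\<omega> \<circ> adj i\<close>, with the shorter element as representative, so that the
  longer one contributes T_\<omega> after \<open>T i\<close>.\<close>

lemma O_op_split:
  assumes "i \<in> I \<union> J"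
  shows "O_op n I J f = (\<Sum>\<omega> | \<omega> \<in> parabolic n (I \<union> J) \<and> \<omega> i < \<omega> (Suc i).
      Const (weight \<omega>) * T_perm n \<omega> f + Const (weight (\<omega> \<circ> adj i)) * T_perm n \<omega> (T i f))"
proof -
  let ?W = "parabolic n (I \<union> J)"
  let ?A = "{\<omega> \<in> ?W. \<omega> i < \<omega> (Suc i)}" and ?B = "{\<omega> \<in> ?W. \<not> \<omega> i < \<omega> (Suc i)}"
  let ?F = "\<lambda>\<omega>. Const (weight \<omega>) * T_perm n \<omega> f"
  have i: "i \<in> {1..<n}" using assms IJ_sub by blast
  have fin: "finite ?W" by (rule finite_parabolic[OF IJ_sub])
  have cl: "\<omega> \<circ> adj i \<in> ?W" if "\<omega> \<in> ?W" for \<omega>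
    by (rule parabolic_comp[OF IJ_sub that parabolic_adj[OF IJ_sub assms]])
  have "O_op n I J f = sum ?F (?A \<union> ?B)"
    unfolding O_op_eq by (rule sum.cong) auto
  also have "\<dots> = sum ?F ?A + sum ?F ?B"
    by (rule sum.union_disjoint) (use fin in auto)
  also have "sum ?F ?B = (\<Sum>\<omega>\<in>?A. ?F (\<omega> \<circ> adj i))"
  proof (rule sum.reindex_bij_witness[of _ "\<lambda>\<omega>. \<omega> \<circ> adj i" "\<lambda>\<omega>. \<omega> \<circ> adj i"])
    fix \<omega> assume "\<omega> \<in> ?B"
    then have \<omega>: "\<omega> \<in> ?W" "\<not> \<omega> i < \<omega> (Suc i)" by blast+
    have "\<omega> i \<noteq> \<omega> (Suc i)" by (rule permutes_adj_neq[OF parabolicD(1)[OF IJ_sub \<omega>(1)]])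
    then show "\<omega> \<circ> adj i \<in> ?A" using \<omega> cl by simp
  next
    fix \<omega> assume "\<omega> \<in> ?A"
    then show "\<omega> \<circ> adj i \<in> ?B" using cl by simp
  qed (simp_all only: comp_adj_adj)
  also have "\<dots> = (\<Sum>\<omega>\<in>?A. Const (weight (\<omega> \<circ> adj i)) * T_perm n \<omega> (T i f))"
    by (rule sum.cong[OF refl]) (use T_perm_comp_adj[OF parabolicD(1)[OF IJ_sub] i] in auto)
  finally show ?thesis by (simp only: sum.distrib)
qed

lemma O_op_T_I:
  assumes "i \<in> I"
  shows "O_op n I J (T i f) = Const t * O_op n I J f"
proof -
  let ?A = "{\<omega> \<in> parabolic n (I \<union> J). \<omega> i < \<omega> (Suc i)}"
  have i: "i \<in> I \<union> J" using assms by simp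
  have split: "O_op n I J g = (\<Sum>\<omega>\<in>?A. Const (weight \<omega>) * T_perm n \<omega> (g + T i g))" for g
    unfolding O_op_split[OF i, of g]
    by (rule sum.cong[OF refl]) (simp add: weight_I[OF _ assms] T_perm_add distrib_left)
  \<comment> \<open>Each pair depends on f only through (1 + T_i) f, which \<open>T i\<close>
    multiplies by t.\<close>
  have "T i f + T i (T i f) = Const t * (f + T i f)"
    by (simp add: T_T Const_diff algebra_simps)
  then show ?thesis
    unfolding split by (simp add: T_perm_Const_mult sum_distrib_left mult.left_commute)
qed

lemma O_op_T_J:
  assumes "j \<in> J"
  shows "O_op n I J (T j f) = - O_op n I J f"
proof -
  let ?A = "{\<omega> \<in> parabolic n (I \<union> J). \<omega> j < \<omega> (Suc j)}"
  have j: "j \<in> I \<union> J" using assms by simp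
  have split: "O_op n I J g = (\<Sum>\<omega>\<in>?A. Const (weight \<omega>) * T_perm n \<omega> (g + Const (- 1 / t) * T j g))" for g
    unfolding O_op_split[OF j, of g]
  proof (rule sum.cong[OF refl])
    fix \<omega> assume "\<omega> \<in> ?A"
    then have "weight (\<omega> \<circ> adj j) = - 1 / t * weight \<omega>" using weight_J[OF _ assms] by blast
    then show "Const (weight \<omega>) * T_perm n \<omega> g + Const (weight (\<omega> \<circ> adj j)) * T_perm n \<omega> (T j g)
        = Const (weight \<omega>) * T_perm n \<omega> (g + Const (- 1 / t) * T j g)"
      by (simp only: T_perm_add T_perm_Const_mult distrib_left Const_mult) (simp only: ac_simps)
  qed
  have t: "Const (- 1 / t) * Const t = - 1" by (simp add: Const_uminus flip: Const_mult)
  \<comment> \<open>The weights combine each pair to (1 - T_j / t) f, the eigenvector of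
    \<open>T j\<close> for the eigenvalue -1.\<close>
  have eq: "T j f + Const (- 1 / t) * T j (T j f) = Const (- 1) * (f + Const (- 1 / t) * T j f)"
    using t by (simp only: T_T Const_diff Const_1 Const_uminus) algebra
  show ?thesis
    unfolding split[of "T j f"] split[of f] eq T_perm_Const_mult
    by (simp only: Const_uminus Const_1 mult_minus_left mult_minus_right mult_1_left sum_negf)
qed

end


section \<open>Arm and leg products\<close>

definition leg_rel :: "exponent \<Rightarrow> nat \<Rightarrow> nat \<Rightarrow> nat \<Rightarrow> bool" where
  "leg_rel \<eta> r j k \<longleftrightarrow> k < r \<and> j \<le> entry \<eta> k + 1 \<and> entry \<eta> k + 1 \<le> entry \<eta> r
    \<or> k > r \<and> j \<le> entry \<eta> k \<and> entry \<eta> k \<le> entry \<eta> r"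

lemma leg_eq_card: "leg n \<eta> (r, j) = card {k \<in> {1..n}. leg_rel \<eta> r j k}"
proof -
  have "{k \<in> {1..n}. leg_rel \<eta> r j k}
    = {k \<in> {1..n}. k < r \<and> j \<le> entry \<eta> k + 1 \<and> entry \<eta> k + 1 \<le> entry \<eta> r}
      \<union> {k \<in> {1..n}. k > r \<and> j \<le> entry \<eta> k \<and> entry \<eta> k \<le> entry \<eta> r}"
    by (auto simp: leg_rel_def)
  moreover have "card \<dots> = leg n \<eta> (r, j)"
    unfolding leg_def prod.case by (rule card_Un_disjoint) auto
  ultimately show ?thesis by simp
qed

text \<open>Exchanging a larger entry with a smaller one behind it carries all leg sets along,
  except at the box of the longer row just beyond the end of the shorter row: its leg gains the
  shorter row.\<close>

lemma leg_rel_act_adj: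
  assumes "entry \<eta> (Suc i) < entry \<eta> i"
  shows "leg_rel (act (adj i) \<eta>) (adj i r) j (adj i k)
    \<longleftrightarrow> leg_rel \<eta> r j k \<or> r = i \<and> j = Suc (entry \<eta> (Suc i)) \<and> k = Suc i"
  using assms by (auto simp: leg_rel_def adj_eq)

lemma card_image_adj: "card (adj i ` A) = card A"
  by (rule card_image) (metis adj_adj inj_onI)

lemma leg_act_adj:
  assumes "i \<in> {1..<n}" "entry \<eta> (Suc i) < entry \<eta> i"
  shows "leg n (act (adj i) \<eta>) (adj i r, j)
    = leg n \<eta> (r, j) + of_bool (r = i \<and> j = Suc (entry \<eta> (Suc i)))"
proof -
  let ?e = "{k. r = i \<and> j = Suc (entry \<eta> (Suc i)) \<and> k = Suc i}" and ?A = "{k \<in> {1..n}. leg_rel \<eta> r j k}"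
  have mem: "adj i k \<in> {1..n} \<longleftrightarrow> k \<in> {1..n}" for k
    using assms(1) by (auto simp: adj_eq)
  have "{k \<in> {1..n}. leg_rel (act (adj i) \<eta>) (adj i r) j k} = adj i ` (?A \<union> ?e)"
  proof (intro equalityI subsetI)
    fix k assume k: "k \<in> {k \<in> {1..n}. leg_rel (act (adj i) \<eta>) (adj i r) j k}"
    then have "leg_rel (act (adj i) \<eta>) (adj i r) j (adj i (adj i k))" by simp
    then have "adj i k \<in> ?A \<union> ?e"
      unfolding leg_rel_act_adj[OF assms(2)] using k mem[of k] by blast
    then have "adj i (adj i k) \<in> adj i ` (?A \<union> ?e)" by (rule imageI)
    then show "k \<in> adj i ` (?A \<union> ?e)" by simp
  next
    fix k assume "k \<in> adj i ` (?A \<union> ?e)"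
    then obtain l where l: "k = adj i l" "l \<in> ?A \<union> ?e" by blast
    moreover have "l \<in> {1..n}" using l(2) assms(1) by auto
    ultimately show "k \<in> {k \<in> {1..n}. leg_rel (act (adj i) \<eta>) (adj i r) j k}"
      using mem[of l] leg_rel_act_adj[OF assms(2), of r j l] by blast
  qed
  then have "leg n (act (adj i) \<eta>) (adj i r, j) = card (?A \<union> ?e)"
    by (simp only: leg_eq_card card_image_adj)
  also have "\<dots> = card ?A + card ?e"
    by (rule card_Un_disjoint) (use assms(2) in \<open>auto simp: leg_rel_def\<close>)
  also have "card ?e = of_bool (r = i \<and> j = Suc (entry \<eta> (Suc i)))" by (auto simp: of_bool_def)
  finally show ?thesis by (simp only: leg_eq_card)
qed

text \<open>The rows counted for position i + 1 but not for i are row i itself and those in the leg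
  of the exceptional box. Hence the eigenvalue ratio is the factor q^(arm+1) t^(leg+1) of that box
  (\<open>eig_ratio_gt\<close>).\<close>

lemma coleg_Suc_gt:
  assumes "i \<in> {1..<n}" "entry \<eta> (Suc i) < entry \<eta> i"
  shows "coleg n \<eta> (Suc i) = coleg n \<eta> i + leg n \<eta> (i, Suc (entry \<eta> (Suc i))) + 1"
proof -
  let ?A = "{k \<in> {1..n}. coleg_rel \<eta> i k}" and ?B = "{k \<in> {1..n}. leg_rel \<eta> i (Suc (entry \<eta> (Suc i))) k}"
  have "coleg_rel \<eta> (Suc i) k \<longleftrightarrow> coleg_rel \<eta> i k \<or> leg_rel \<eta> i (Suc (entry \<eta> (Suc i))) k \<or> k = i" for k
    using assms(2) by (cases k i rule: linorder_cases; cases "k = Suc i") (auto simp: coleg_rel_def leg_rel_def)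
  then have "{k \<in> {1..n}. coleg_rel \<eta> (Suc i) k} = ?A \<union> ?B \<union> {i}"
    using assms(1) by auto
  then have "coleg n \<eta> (Suc i) = card (?A \<union> ?B \<union> {i})"
    by (simp only: coleg_eq_card)
  also have "\<dots> = card (?A \<union> ?B) + card {i}"
    by (rule card_Un_disjoint) (auto simp: coleg_rel_def leg_rel_def)
  also have "card (?A \<union> ?B) = card ?A + card ?B"
    by (rule card_Un_disjoint) (auto simp: coleg_rel_def leg_rel_def)
  finally show ?thesis by (simp only: coleg_eq_card leg_eq_card card.empty card_insert_disjoint finite.emptyI) simp
qed

definition eig_ratio :: "nat \<Rightarrow> exponent \<Rightarrow> nat \<Rightarrow> qt" where
  "eig_ratio n \<eta> i = eigval n \<eta> i / eigval n \<eta> (Suc i)"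

lemma eig_ratio_gt:
  assumes "i \<in> {1..<n}" "entry \<eta> (Suc i) < entry \<eta> i"
  shows "eig_ratio n \<eta> i = q ^ (entry \<eta> i - entry \<eta> (Suc i)) * t ^ (leg n \<eta> (i, Suc (entry \<eta> (Suc i))) + 1)"
proof -
  have "q ^ entry \<eta> i = q ^ (entry \<eta> i - entry \<eta> (Suc i)) * q ^ entry \<eta> (Suc i)"
    using assms(2) by (simp flip: power_add)
  then show ?thesis
    unfolding eig_ratio_def eigval_eq coleg_Suc_gt[OF assms] by (simp add: power_add field_simps)
qed

text \<open>Common form of \<open>d\<close> (e = 1) and \<open>d'\<close> (e = 0), so that the
  effect of an exchange is computed once.\<close>

definition diagram_prod :: "nat \<Rightarrow> nat \<Rightarrow> exponent \<Rightarrow> qt" where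
  "diagram_prod n e \<eta> = (\<Prod>s\<in>diagram n \<eta>. 1 - q ^ (arm \<eta> s + 1) * t ^ (leg n \<eta> s + e))"

lemma finite_diagram: "finite (diagram n \<eta>)"
  by (simp add: diagram_def)

lemma diagram_prod_nonzero: "diagram_prod n e \<eta> \<noteq> 0"
proof -
  have "1 - q ^ (a + 1) * t ^ b \<noteq> 0" for a b
    using qt_power_eq_1_iff[of "a + 1" b] by simp
  then show ?thesis by (simp add: diagram_prod_def finite_diagram)
qed

text \<open>Boxes move with their rows and keep their arms; only the exceptional box gets a leg
  longer by one, so a single factor changes.\<close>

lemma diagram_prod_act_adj:
  assumes "i \<in> {1..<n}" "entry \<eta> (Suc i) < entry \<eta> i"
  defines "L \<equiv> leg n \<eta> (i, Suc (entry \<eta> (Suc i)))" and "a \<equiv> entry \<eta> i - entry \<eta> (Suc i)"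
  shows "diagram_prod n e (act (adj i) \<eta>) * (1 - q ^ a * t ^ (L + e)) = diagram_prod n e \<eta> * (1 - q ^ a * t ^ (L + e + 1))"
proof -
  define s0 where "s0 = (i, Suc (entry \<eta> (Suc i)))"
  have s0: "s0 \<in> diagram n \<eta>" using assms(1,2) by (auto simp: s0_def diagram_def)
  let ?h = "map_prod (adj i) (\<lambda>j. j) :: nat \<times> nat \<Rightarrow> nat \<times> nat"
  let ?F = "\<lambda>s. 1 - q ^ (arm \<eta> s + 1) * t ^ (leg n \<eta> s + e)"
  let ?G = "\<lambda>s. 1 - q ^ (arm \<eta> s + 1) * t ^ (leg n \<eta> s + of_bool (s = s0) + e)"
  have "diagram_prod n e (act (adj i) \<eta>) = (\<Prod>s\<in>diagram n \<eta>. ?G s)"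
    unfolding diagram_prod_def
  proof (rule prod.reindex_bij_witness[of _ ?h ?h])
    have mem: "adj i k \<in> {1..n} \<longleftrightarrow> k \<in> {1..n}" for k
      using assms(1) by (auto simp: adj_eq)
    fix s :: "nat \<times> nat"
    obtain r j where s: "s = (r, j)" by (cases s)
    show "?h (?h s) = s" and "?h (?h s) = s"
      by (simp_all add: s)
    show "?h s \<in> diagram n \<eta>" if "s \<in> diagram n (act (adj i) \<eta>)"
      using that mem[of r] by (simp add: s diagram_def)
    show "?h s \<in> diagram n (act (adj i) \<eta>)" if "s \<in> diagram n \<eta>"
      using that mem[of r] by (simp add: s diagram_def)
    show "?G (?h s) = 1 - q ^ (arm (act (adj i) \<eta>) s + 1) * t ^ (leg n (act (adj i) \<eta>) s + e)"
      using leg_act_adj[OF assms(1,2), of "adj i r" j] by (simp add: s s0_def arm_def)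
  qed
  also have "\<dots> = ?G s0 * (\<Prod>s\<in>diagram n \<eta> - {s0}. ?G s)"
    by (rule prod.remove[OF finite_diagram s0])
  also have "(\<Prod>s\<in>diagram n \<eta> - {s0}. ?G s) = (\<Prod>s\<in>diagram n \<eta> - {s0}. ?F s)"
    by (rule prod.cong) auto
  finally have 1: "diagram_prod n e (act (adj i) \<eta>) = ?G s0 * (\<Prod>s\<in>diagram n \<eta> - {s0}. ?F s)" .
  have 2: "diagram_prod n e \<eta> = ?F s0 * (\<Prod>s\<in>diagram n \<eta> - {s0}. ?F s)"
    unfolding diagram_prod_def by (rule prod.remove[OF finite_diagram s0])
  have arm: "arm \<eta> s0 + 1 = a" using assms(2) by (simp add: arm_def s0_def a_def)
  have leg: "leg n \<eta> s0 = L" by (simp add: s0_def L_def)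
  show ?thesis unfolding 1 2 arm leg by (simp add: ac_simps)
qed

lemma d_eq: "d n \<eta> = diagram_prod n 1 \<eta>" and d'_eq: "d' n \<eta> = diagram_prod n 0 \<eta>"
  by (simp_all add: d_def d'_def diagram_prod_def)

lemma d_nonzero [simp]: "d n \<eta> \<noteq> 0" and d'_nonzero [simp]: "d' n \<eta> \<noteq> 0"
  by (simp_all add: d_eq d'_eq diagram_prod_nonzero)

lemma d_act_adj:
  assumes "i \<in> {1..<n}" "entry \<eta> (Suc i) < entry \<eta> i"
  shows "d n (act (adj i) \<eta>) * (1 - eig_ratio n \<eta> i) = d n \<eta> * (1 - t * eig_ratio n \<eta> i)"
  using diagram_prod_act_adj[OF assms, of 1] by (simp add: d_eq eig_ratio_gt[OF assms] mult.left_commute)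

lemma d'_act_adj:
  assumes "i \<in> {1..<n}" "entry \<eta> (Suc i) < entry \<eta> i"
  shows "d' n (act (adj i) \<eta>) * (1 - eig_ratio n \<eta> i / t) = d' n \<eta> * (1 - eig_ratio n \<eta> i)"
  using diagram_prod_act_adj[OF assms, of 0] by (simp add: d'_eq eig_ratio_gt[OF assms])

text \<open>The exponent of q in the ratio is positive, so no power of t can cancel it.\<close>

lemma eig_ratio_gt_neq:
  assumes "i \<in> {1..<n}" "entry \<eta> (Suc i) < entry \<eta> i"
  shows "eig_ratio n \<eta> i \<noteq> 1" "eig_ratio n \<eta> i / t \<noteq> 1" "t * eig_ratio n \<eta> i \<noteq> 1"
proof -
  have "entry \<eta> i - entry \<eta> (Suc i) \<noteq> 0" using assms(2) by simp
  then show "eig_ratio n \<eta> i \<noteq> 1" "eig_ratio n \<eta> i / t \<noteq> 1" "t * eig_ratio n \<eta> i \<noteq> 1"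
    using qt_power_eq_1_iff[of "entry \<eta> i - entry \<eta> (Suc i)" "leg n \<eta> (i, Suc (entry \<eta> (Suc i))) + 1"]
      qt_power_eq_1_iff[of "entry \<eta> i - entry \<eta> (Suc i)" "leg n \<eta> (i, Suc (entry \<eta> (Suc i)))"]
      qt_power_eq_1_iff[of "entry \<eta> i - entry \<eta> (Suc i)" "leg n \<eta> (i, Suc (entry \<eta> (Suc i))) + 2"]
    unfolding eig_ratio_gt[OF assms] by (simp_all add: power_add power2_eq_square ac_simps)
qed

text \<open>The coefficient field is ordered through leading coefficients. This makes
  \<open>M\<close>, a nonempty sum of powers of t, visibly nonzero.\<close>

lemma t_positive: "0 < t"
  by (simp add: t_def zero_less_Fract_iff less_poly_def pos_poly_def)

lemma intertwine_act_adj: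
  assumes "i \<in> {1..<n}" "entry \<eta> (Suc i) < entry \<eta> i"
  shows "intertwine n (act (adj i) \<eta>) i = (1 - t) / (1 - eig_ratio n \<eta> i)"
proof -
  have "eigval n (act (adj i) \<eta>) i = eigval n \<eta> (Suc i)" "eigval n (act (adj i) \<eta>) (Suc i) = eigval n \<eta> i"
    using assms by (simp_all add: eigval_act_adj)
  moreover have "eigval n \<eta> (Suc i) \<noteq> 0" by simp
  ultimately show ?thesis
    by (simp add: intertwine_def eig_ratio_def divide_simps)
qed


section \<open>Sorting within parabolic orbits\<close>

text \<open>One notion for weak and strict rearrangements: entries in a common J-block of the orbit
  are distinct, so there both agree (\<open>arrange_strict_eq\<close>).\<close>

definition sort_along :: "nat \<Rightarrow> nat set \<Rightarrow> bool \<Rightarrow> exponent \<Rightarrow> exponent" where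
  "sort_along n K up \<eta> = (THE \<mu>. \<mu> \<in> par_orbit n K \<eta> \<and> sorted_along up K \<mu>)"

lemma act_comp_parabolic:
  "K \<subseteq> {1..<n} \<Longrightarrow> \<sigma> \<in> parabolic n K \<Longrightarrow> \<tau> permutes {1..n} \<Longrightarrow> act (\<sigma> \<circ> \<tau>) \<mu> = act \<sigma> (act \<tau> \<mu>)"
  by (rule act_comp[OF permutes_bij[OF parabolicD(1)] permutes_bij])

lemma act_inv_act: "\<sigma> permutes {1..n} \<Longrightarrow> act (inv' \<sigma>) (act \<sigma> \<mu>) = \<mu>"
  using act_comp[of "inv' \<sigma>" \<sigma> \<mu>] permutes_bij[of \<sigma>] permutes_inv_o(2)[of \<sigma>]
  by (simp add: bij_imp_bij_inv)

lemma entry_act_image: "\<sigma> permutes {1..n} \<Longrightarrow> entry (act \<sigma> \<mu>) (\<sigma> x) = entry \<mu> x"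
  by (simp add: act_permutes_entry permutes_inverses(2))

lemma entry_act_fixed: "\<sigma> permutes {1..n} \<Longrightarrow> \<sigma> x = x \<Longrightarrow> entry (act \<sigma> \<mu>) x = entry \<mu> x"
  by (metis entry_act_image)

lemma sorted_along_block:
  assumes "sorted_along up K \<mu>" "same_block K x y" "x < y"
  shows "if up then entry \<mu> x \<le> entry \<mu> y else entry \<mu> y \<le> entry \<mu> x"
proof -
  have "{x..<y} \<subseteq> K" using assms(2,3) by (simp add: same_block_def)
  with assms(3) show ?thesis
  proof (induction y)
    case (Suc y)
    have "if up then entry \<mu> y \<le> entry \<mu> (Suc y) else entry \<mu> (Suc y) \<le> entry \<mu> y"
      using Suc.prems assms(1) by (auto simp: sorted_along_def subset_iff)
    then show ?case
      using Suc by (cases "x = y") (auto simp: subset_iff less_Suc_eq split: if_splits)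
  qed simp
qed

text \<open>At a descent of \<open>\<sigma>\<close> inside K the two sortedness conditions force
  equal entries, so the corresponding exchange fixes \<open>\<mu>\<close> and can be stripped
  off.\<close>

lemma sorted_along_unique:
  assumes K: "K \<subseteq> {1..<n}" and \<sigma>: "\<sigma> \<in> parabolic n K"
    and "sorted_along up K \<mu>" "sorted_along up K (act \<sigma> \<mu>)"
  shows "act \<sigma> \<mu> = \<mu>"
  using \<sigma> assms(4)
proof (induction "inv_count n \<sigma>" arbitrary: \<sigma> rule: less_induct)
  case less
  note p = parabolicD[OF K less.prems(1)]
  show ?case
  proof (cases "\<sigma> = id")
    case False
    then obtain i where i: "i \<in> K" "\<not> \<sigma> i < \<sigma> (Suc i)"
      using ascending_imp_id[OF p] by blast
    then have i': "i \<in> {1..<n}" "\<sigma> (Suc i) < \<sigma> i"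
      using K permutes_adj_neq[OF p(1), of i] by auto
    have "same_block K (\<sigma> (Suc i)) (\<sigma> i)"
      using p(2) same_block_Suc[OF i(1)] by (meson same_block_sym same_block_trans)
    from sorted_along_block[OF less.prems(2) this i'(2)]
    have "if up then entry \<mu> (Suc i) \<le> entry \<mu> i else entry \<mu> i \<le> entry \<mu> (Suc i)"
      by (cases up) (simp_all add: entry_act_image[OF p(1)])
    moreover have "if up then entry \<mu> i \<le> entry \<mu> (Suc i) else entry \<mu> (Suc i) \<le> entry \<mu> i"
      using assms(3) i(1) by (simp add: sorted_along_def)
    ultimately have "act (adj i) \<mu> = \<mu>" by (auto simp: act_adj_eq_iff split: if_splits)
    then have "act (\<sigma> \<circ> adj i) \<mu> = act \<sigma> \<mu>"
      using act_comp_parabolic[OF K less.prems(1) adj_permutes[OF i'(1)], of \<mu>] by simp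
    moreover have "\<sigma> \<circ> adj i \<in> parabolic n K"
      by (rule parabolic_comp[OF K less.prems(1) parabolic_adj[OF K i(1)]])
    ultimately show ?thesis
      using less.hyps[of "\<sigma> \<circ> adj i"] less.prems(2) inv_count_descent[where \<sigma> = \<sigma>, OF i'] by simp
  qed simp
qed

lemma par_orbit_trans:
  assumes K: "K \<subseteq> {1..<n}" and "\<mu> \<in> par_orbit n K \<eta>" "\<nu> \<in> par_orbit n K \<mu>"
  shows "\<nu> \<in> par_orbit n K \<eta>"
proof -
  obtain \<sigma> \<tau> where *: "\<sigma> \<in> parabolic n K" "\<mu> = act \<sigma> \<eta>" "\<tau> \<in> parabolic n K" "\<nu> = act \<tau> \<mu>"
    using assms(2,3) unfolding par_orbit_def by blast
  then have "\<nu> = act (\<tau> \<circ> \<sigma>) \<eta>" using act_comp_parabolic[OF K *(3) parabolicD(1)[OF K *(1)]] by simp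
  then show ?thesis using parabolic_comp[OF K *(3,1)] unfolding par_orbit_def by blast
qed

lemma par_orbit_sym:
  assumes K: "K \<subseteq> {1..<n}" and "\<mu> \<in> par_orbit n K \<eta>"
  shows "\<eta> \<in> par_orbit n K \<mu>"
proof -
  obtain \<sigma> where *: "\<sigma> \<in> parabolic n K" "\<mu> = act \<sigma> \<eta>"
    using assms(2) unfolding par_orbit_def by blast
  then have "\<eta> = act (inv' \<sigma>) \<mu>" using act_inv_act[OF parabolicD(1)[OF K *(1)]] by simp
  then show ?thesis using parabolic_inv[OF K *(1)] unfolding par_orbit_def by blast
qed

lemma par_orbit_refl: "K \<subseteq> {1..<n} \<Longrightarrow> \<eta> \<in> par_orbit n K \<eta>"
  unfolding par_orbit_def using parabolic_id by (metis act_id image_eqI)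

lemma par_orbit_act: "\<sigma> \<in> parabolic n K \<Longrightarrow> act \<sigma> \<eta> \<in> par_orbit n K \<eta>"
  unfolding par_orbit_def by blast

lemma sort_along_eqI:
  assumes K: "K \<subseteq> {1..<n}" and "\<mu> \<in> par_orbit n K \<eta>" "sorted_along up K \<mu>"
  shows "sort_along n K up \<eta> = \<mu>"
  unfolding sort_along_def
proof (rule the_equality)
  fix \<nu> assume \<nu>: "\<nu> \<in> par_orbit n K \<eta> \<and> sorted_along up K \<nu>"
  then have "\<nu> \<in> par_orbit n K \<mu>" using par_orbit_trans[OF K par_orbit_sym[OF K assms(2)]] by blast
  then show "\<nu> = \<mu>" using sorted_along_unique[OF K _ assms(3)] \<nu> unfolding par_orbit_def by blast
qed (use assms in simp)

lemma sort_along: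
  assumes K: "K \<subseteq> {1..<n}"
  shows "sort_along n K up \<eta> \<in> par_orbit n K \<eta>" "sorted_along up K (sort_along n K up \<eta>)"
proof -
  obtain \<sigma> where \<sigma>: "\<sigma> \<in> parabolic n K" "sorted_along up K (act \<sigma> \<eta>)"
    using sorted_along_exists[OF K parabolic_id[OF K] permutes_bij[OF parabolicD(1)[OF K]]]
      parabolic_comp[OF K parabolic_adj[OF K]] by metis
  have "sort_along n K up \<eta> = act \<sigma> \<eta>"
    by (rule sort_along_eqI[OF K par_orbit_act[OF \<sigma>(1)] \<sigma>(2)])
  then show "sort_along n K up \<eta> \<in> par_orbit n K \<eta>" "sorted_along up K (sort_along n K up \<eta>)"
    using \<sigma> par_orbit_act[OF \<sigma>(1)] by simp_all
qed

lemma sort_along_act: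
  assumes K: "K \<subseteq> {1..<n}" and "\<sigma> \<in> parabolic n K"
  shows "sort_along n K up (act \<sigma> \<eta>) = sort_along n K up \<eta>"
  by (rule sort_along_eqI[OF K])
    (use par_orbit_trans[OF K par_orbit_sym[OF K par_orbit_act[OF assms(2)]]] sort_along[OF K] in auto)

lemma sort_along_commute:
  assumes K: "K \<subseteq> {1..<n}" and \<sigma>: "\<sigma> permutes {1..n}" "\<And>x. x \<in> positions K \<Longrightarrow> \<sigma> x = x"
    and comm: "\<And>\<tau>. \<tau> \<in> parabolic n K \<Longrightarrow> \<sigma> \<circ> \<tau> = \<tau> \<circ> \<sigma>"
  shows "sort_along n K up (act \<sigma> \<eta>) = act \<sigma> (sort_along n K up \<eta>)"
proof (rule sort_along_eqI[OF K])
  obtain \<tau> where \<tau>: "\<tau> \<in> parabolic n K" "sort_along n K up \<eta> = act \<tau> \<eta>"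
    using sort_along(1)[OF K, of up \<eta>] unfolding par_orbit_def by blast
  have "act \<sigma> (act \<tau> \<eta>) = act \<tau> (act \<sigma> \<eta>)"
    using act_comp[of \<sigma> \<tau> \<eta>] act_comp[of \<tau> \<sigma> \<eta>] comm[OF \<tau>(1)]
      permutes_bij[OF \<sigma>(1)] permutes_bij[OF parabolicD(1)[OF K \<tau>(1)]] by simp
  then show "act \<sigma> (sort_along n K up \<eta>) \<in> par_orbit n K (act \<sigma> \<eta>)"
    using par_orbit_act[OF \<tau>(1)] \<tau>(2) by simp
  have "entry (act \<sigma> (sort_along n K up \<eta>)) i = entry (sort_along n K up \<eta>) i"
    "entry (act \<sigma> (sort_along n K up \<eta>)) (Suc i) = entry (sort_along n K up \<eta>) (Suc i)" if "i \<in> K" for i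
    using entry_act_fixed[OF \<sigma>(1) \<sigma>(2)] adj_positions[OF that] by blast+
  then show "sorted_along up K (act \<sigma> (sort_along n K up \<eta>))"
    using sort_along(2)[OF K, of up \<eta>] unfolding sorted_along_def by metis
qed

text \<open>The form of strict monotonicity along K that survives rearrangement.\<close>

definition block_distinct :: "nat set \<Rightarrow> exponent \<Rightarrow> bool" where
  "block_distinct K \<mu> \<longleftrightarrow> (\<forall>x y. same_block K x y \<longrightarrow> x \<noteq> y \<longrightarrow> entry \<mu> x \<noteq> entry \<mu> y)"

lemma block_distinct_act:
  assumes "\<sigma> permutes {1..n}" "\<And>x y. same_block K x y \<Longrightarrow> same_block K (\<sigma> x) (\<sigma> y)" "block_distinct K (act \<sigma> \<mu>)"
  shows "block_distinct K \<mu>"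
  unfolding block_distinct_def
proof (intro allI impI)
  fix x y assume xy: "same_block K x y" "x \<noteq> y"
  have "\<sigma> x \<noteq> \<sigma> y" using xy(2) assms(1) by (metis permutes_inverses(2))
  then have "entry (act \<sigma> \<mu>) (\<sigma> x) \<noteq> entry (act \<sigma> \<mu>) (\<sigma> y)"
    using assms(2)[OF xy(1)] assms(3) by (simp add: block_distinct_def)
  then show "entry \<mu> x \<noteq> entry \<mu> y" by (simp add: entry_act_image[OF assms(1)])
qed

lemma block_distinct_parabolic:
  assumes K: "K \<subseteq> {1..<n}" and "\<sigma> \<in> parabolic n K" "block_distinct K \<mu>"
  shows "block_distinct K (act \<sigma> \<mu>)"
proof (rule block_distinct_act)
  note p = parabolicD[OF K parabolic_inv[OF K assms(2)]]
  show "inv' \<sigma> permutes {1..n}" by (rule p)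
  show "same_block K (inv' \<sigma> x) (inv' \<sigma> y)" if "same_block K x y" for x y
    using p(2) that by (meson same_block_sym same_block_trans)
  show "block_distinct K (act (inv' \<sigma>) (act \<sigma> \<mu>))"
    using assms(3) by (simp add: act_inv_act[OF parabolicD(1)[OF K assms(2)]])
qed

lemma strictly_sorted_iff:
  assumes "block_distinct K \<mu>"
  shows "(\<forall>i\<in>K. entry \<mu> i > entry \<mu> (i + 1)) \<longleftrightarrow> sorted_along False K \<mu>"
    and "(\<forall>i\<in>K. entry \<mu> i < entry \<mu> (i + 1)) \<longleftrightarrow> sorted_along True K \<mu>"
proof -
  have "entry \<mu> i \<noteq> entry \<mu> (Suc i)" "entry \<mu> (Suc i) \<noteq> entry \<mu> i" if "i \<in> K" for i
    using assms same_block_Suc[OF that] same_block_sym[OF same_block_Suc[OF that]] unfolding block_distinct_def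
    by (metis n_not_Suc_n)+
  then show "(\<forall>i\<in>K. entry \<mu> i > entry \<mu> (i + 1)) \<longleftrightarrow> sorted_along False K \<mu>"
    and "(\<forall>i\<in>K. entry \<mu> i < entry \<mu> (i + 1)) \<longleftrightarrow> sorted_along True K \<mu>"
    by (auto simp: sorted_along_def order_less_le)
qed

lemma arrange_weak_eq:
  "arrange_weak n K Pl \<eta> = sort_along n K False \<eta>"
  "arrange_weak n K Mi \<eta> = sort_along n K True \<eta>"
  by (simp_all add: sort_along_def sorted_along_def)

lemma arrange_strict_eq:
  assumes K: "K \<subseteq> {1..<n}" and "block_distinct K \<eta>"
  shows "arrange_strict n K Pl \<eta> = sort_along n K False \<eta>"
    and "arrange_strict n K Mi \<eta> = sort_along n K True \<eta>"
proof -
  have d: "block_distinct K \<mu>" if "\<mu> \<in> par_orbit n K \<eta>" for \<mu>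
    using that block_distinct_parabolic[OF K _ assms(2)] unfolding par_orbit_def by blast
  have "(\<mu> \<in> par_orbit n K \<eta> \<and> (\<forall>i\<in>K. entry \<mu> i > entry \<mu> (i + 1)))
      \<longleftrightarrow> (\<mu> \<in> par_orbit n K \<eta> \<and> sorted_along False K \<mu>)" for \<mu>
    using strictly_sorted_iff(1)[OF d] by blast
  then show "arrange_strict n K Pl \<eta> = sort_along n K False \<eta>"
    unfolding sort_along_def arrange_strict.simps by presburger
  have "(\<mu> \<in> par_orbit n K \<eta> \<and> (\<forall>i\<in>K. entry \<mu> i < entry \<mu> (i + 1)))
      \<longleftrightarrow> (\<mu> \<in> par_orbit n K \<eta> \<and> sorted_along True K \<mu>)" for \<mu>
    using strictly_sorted_iff(2)[OF d] by blast
  then show "arrange_strict n K Mi \<eta> = sort_along n K True \<eta>"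
    unfolding sort_along_def arrange_strict.simps by presburger
qed

text \<open>The whole orbit is reached from a sorted member by exchanges in one direction.
  \<open>lead_eq\<close> uses it from the decreasing arrangement, \<open>below_\<eta>m\<close> and
  \<open>O_op_E\<close> from the increasing one.\<close>

lemma par_orbit_induct:
  assumes K: "K \<subseteq> {1..<n}" and "\<eta> \<in> par_orbit n K \<eta>0" and base: "P (sort_along n K up \<eta>0)"
    and step: "\<And>\<mu> i. \<mu> \<in> par_orbit n K \<eta>0 \<Longrightarrow> i \<in> K \<Longrightarrow> P \<mu> \<Longrightarrow>
      (if up then entry \<mu> i < entry \<mu> (Suc i) else entry \<mu> (Suc i) < entry \<mu> i) \<Longrightarrow> P (act (adj i) \<mu>)"
  shows "P \<eta>"
proof -
  show ?thesis
    using assms(2)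
  proof (induction "sort_weight n up \<eta>" arbitrary: \<eta> rule: less_induct)
    case less
    show ?case
    proof (cases "sorted_along up K \<eta>")
      case True
      then show ?thesis using base sort_along_eqI[OF K less.prems] by simp
    next
      case False
      then obtain i where i: "i \<in> K" "\<not> (if up then entry \<eta> i \<le> entry \<eta> (Suc i) else entry \<eta> (Suc i) \<le> entry \<eta> i)"
        unfolding sorted_along_def by blast
      let ?\<mu> = "act (adj i) \<eta>"
      have i': "i \<in> {1..<n}" using i(1) K by blast
      have "sort_weight n up ?\<mu> < sort_weight n up \<eta>"
        by (rule sort_weight_act_adj[OF i']) (use i(2) in \<open>cases up; simp\<close>)
      moreover have \<mu>: "?\<mu> \<in> par_orbit n K \<eta>0"
        by (rule par_orbit_trans[OF K less.prems par_orbit_act[OF parabolic_adj[OF K i(1)]]])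
      ultimately have "P ?\<mu>" by (rule less.hyps)
      moreover have "if up then entry ?\<mu> i < entry ?\<mu> (Suc i) else entry ?\<mu> (Suc i) < entry ?\<mu> i"
        using i(2) by (cases up) simp_all
      ultimately have "P (act (adj i) ?\<mu>)" by (rule step[OF \<mu> i(1)])
      then show ?thesis by simp
    qed
  qed
qed


section \<open>Leading coefficients\<close>

text \<open>Ascents were treated for multiplication on the right, whereas a word of operators grows
  on the left; inversion links the two.\<close>

lemma inv_count_inv:
  assumes "\<sigma> permutes {1..n}"
  shows "inv_count n (inv' \<sigma>) = inv_count n \<sigma>"
proof -
  have in_range: "\<sigma> a \<in> {1..n} \<longleftrightarrow> a \<in> {1..n}" "inv' \<sigma> a \<in> {1..n} \<longleftrightarrow> a \<in> {1..n}" for a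
    using permutes_in_image[OF assms] permutes_in_image[OF permutes_inv[OF assms]] by blast+
  have "bij_betw (\<lambda>(a, b). (\<sigma> b, \<sigma> a)) (inv_set n \<sigma>) (inv_set n (inv' \<sigma>))"
    by (rule bij_betwI[of _ _ _ "\<lambda>(a, b). (inv' \<sigma> b, inv' \<sigma> a)"])
      (use in_range in \<open>auto simp: inv_set_def permutes_inverses[OF assms] simp del: atLeastAtMost_iff One_nat_def\<close>)
  then show ?thesis unfolding inv_count_def by (rule bij_betw_same_card[symmetric])
qed

lemma inv_count_adj_comp:
  assumes "\<sigma> permutes {1..n}" "k \<in> {1..<n}"
  shows "inv_count n (adj k \<circ> \<sigma>) = inv_count n (inv' \<sigma> \<circ> adj k)"
proof -
  have "inv' (adj k \<circ> \<sigma>) = inv' \<sigma> \<circ> adj k"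
    using o_inv_distrib[OF bij_adj permutes_bij[OF assms(1)]] by simp
  then show ?thesis
    using inv_count_inv[OF permutes_compose[OF assms(1) adj_permutes[OF assms(2)]]] by simp
qed

lemma sign_adj_comp:
  assumes "\<sigma> permutes {1..n}" "k \<in> {1..<n}"
  shows "(- 1) ^ perm_length n (adj k \<circ> \<sigma>) = - ((- 1) ^ perm_length n \<sigma> :: 'a :: ring_1)"
proof -
  note p = permutes_inv[OF assms(1)]
  have "inv' \<sigma> k \<noteq> inv' \<sigma> (Suc k)" by (rule permutes_adj_neq[OF p])
  then have "inv_count n (adj k \<circ> \<sigma>) = Suc (inv_count n \<sigma>) \<or> inv_count n \<sigma> = Suc (inv_count n (adj k \<circ> \<sigma>))"
    unfolding inv_count_adj_comp[OF assms] inv_count_inv[OF assms(1), symmetric]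
    using inv_count_ascent[OF assms(2), of "inv' \<sigma>"] inv_count_descent[OF assms(2), of "inv' \<sigma>"]
    by (cases "inv' \<sigma> k < inv' \<sigma> (Suc k)") auto
  then show ?thesis
    unfolding perm_length_eq[OF assms(1)] perm_length_eq[OF permutes_compose[OF assms(1) adj_permutes[OF assms(2)]]]
    by (elim disjE) simp_all
qed

lemma reduced_word_ConsD:
  assumes "is_reduced_word n \<sigma> (k # ks)"
  shows "k \<in> {1..<n}" "is_reduced_word n (word_perm ks) ks"
    "inv' (word_perm ks) k < inv' (word_perm ks) (Suc k)"
proof -
  let ?\<tau> = "word_perm ks"
  have *: "k \<in> {1..<n}" "set ks \<subseteq> {1..<n}" "inv_count n (adj k \<circ> ?\<tau>) = Suc (length ks)"
    using assms by (auto simp: is_reduced_word_iff word_perm_Cons)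
  note p = word_perm_permutes[OF *(2)]
  have le: "inv_count n (inv' ?\<tau>) \<le> length ks"
    using inv_count_word_perm_le[OF *(2)] by (simp only: inv_count_inv[OF p])
  have eq: "inv_count n (inv' ?\<tau> \<circ> adj k) = Suc (length ks)"
    using *(3) by (simp only: inv_count_adj_comp[OF p *(1)])
  show less: "inv' ?\<tau> k < inv' ?\<tau> (Suc k)"
  proof (rule ccontr)
    assume "\<not> ?thesis"
    then have "inv' ?\<tau> (Suc k) < inv' ?\<tau> k"
      using permutes_adj_neq[OF permutes_inv[OF p], of k] by simp
    then show False using inv_count_descent[where \<sigma> = "inv' ?\<tau>", OF *(1)] eq le by simp
  qed
  show "is_reduced_word n ?\<tau> ks"
    using inv_count_ascent[where \<sigma> = "inv' ?\<tau>", OF *(1) less] eq *(2)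
    by (simp add: is_reduced_word_iff inv_count_inv[OF p])
qed (use assms in \<open>auto simp: is_reduced_word_iff\<close>)

lemma parabolic_reduced_word:
  assumes "K \<subseteq> {1..<n}" "\<sigma> \<in> parabolic n K"
  obtains ks where "set ks \<subseteq> K" "is_reduced_word n \<sigma> ks"
proof -
  obtain ks where "set ks \<subseteq> K" "word_perm ks = \<sigma>" "length ks = inv_count n \<sigma>"
    using word_exists[OF assms(1) parabolicD(1)[OF assms] parabolicD(2)[OF assms]] by blast
  then show ?thesis using that[of ks] assms(1) by (auto simp: is_reduced_word_iff)
qed


text \<open>Compares only the underlying partitions, and is therefore stable under permutations,
  unlike \<open>below\<close>.\<close>

definition strictly_lower :: "nat \<Rightarrow> exponent \<Rightarrow> exponent \<Rightarrow> bool" where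
  "strictly_lower n \<nu> \<mu> \<longleftrightarrow> (\<forall>c. excess n c \<nu> \<le> excess n c \<mu>) \<and> (\<exists>c. excess n c \<nu> < excess n c \<mu>)"

lemma not_strictly_lower_self: "\<not> strictly_lower n \<mu> \<mu>"
  by (simp add: strictly_lower_def)

lemma excess_act: "\<sigma> permutes {1..n} \<Longrightarrow> excess n c (act \<sigma> \<mu>) = excess n c \<mu>"
  unfolding excess_def by (rule sum_act)

lemma excess_par_orbit: "K \<subseteq> {1..<n} \<Longrightarrow> \<nu> \<in> par_orbit n K \<mu> \<Longrightarrow> excess n c \<nu> = excess n c \<mu>"
  unfolding par_orbit_def using excess_act parabolicD(1) by blast

lemma mids_strictly_lower:
  assumes "i \<in> {1..<n}" "\<mu> \<in> mids i \<nu>" "\<And>c. excess n c \<nu> \<le> excess n c \<eta>"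
  shows "strictly_lower n \<mu> \<eta>"
  unfolding strictly_lower_def
  using mids_excess[OF assms(1,2)] assms(3) by (meson order_trans order_less_le_trans)

text \<open>For an exchange-stable set A of exponents not exceeding \<open>\<eta>\<close> this space
  is invariant under \<open>T\<close>: all intermediate terms are strictly lower.\<close>

definition lower_polys :: "nat \<Rightarrow> exponent set \<Rightarrow> exponent \<Rightarrow> zpoly set" where
  "lower_polys n A \<eta> = {f. \<forall>\<kappa>\<in>Poly_Mapping.keys f. \<kappa> \<in> A \<or> strictly_lower n \<kappa> \<eta>}"

lemma lower_polys_add: "f \<in> lower_polys n A \<eta> \<Longrightarrow> g \<in> lower_polys n A \<eta> \<Longrightarrow> f + g \<in> lower_polys n A \<eta>"
  unfolding lower_polys_def using keys_add[of f g] by blast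

lemma lower_polys_Const_mult: "f \<in> lower_polys n A \<eta> \<Longrightarrow> Const c * f \<in> lower_polys n A \<eta>"
  unfolding lower_polys_def using keys_Const_mult[of c f] by blast

lemma lower_polys_sum: "(\<And>x. x \<in> B \<Longrightarrow> f x \<in> lower_polys n A \<eta>) \<Longrightarrow> sum f B \<in> lower_polys n A \<eta>"
  unfolding lower_polys_def using keys_sum_subset[of f B] by blast

lemma lower_polys_T:
  assumes i: "i \<in> {1..<n}" and A: "\<And>\<kappa> c. \<kappa> \<in> A \<Longrightarrow> excess n c \<kappa> \<le> excess n c \<eta>"
    "\<And>\<kappa>. \<kappa> \<in> A \<Longrightarrow> act (adj i) \<kappa> \<in> A" and f: "f \<in> lower_polys n A \<eta>"
  shows "T i f \<in> lower_polys n A \<eta>"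
  unfolding lower_polys_def
proof (intro CollectI ballI)
  fix \<mu> assume "\<mu> \<in> Poly_Mapping.keys (T i f)"
  then obtain \<kappa> where \<kappa>: "\<kappa> \<in> Poly_Mapping.keys f" "\<mu> \<in> {\<kappa>, act (adj i) \<kappa>} \<union> mids i \<kappa>"
    using keys_T by blast
  then have low: "\<kappa> \<in> A \<or> strictly_lower n \<kappa> \<eta>" using f unfolding lower_polys_def by blast
  then have "excess n c \<kappa> \<le> excess n c \<eta>" for c using A(1) unfolding strictly_lower_def by blast
  then have "\<mu> \<in> mids i \<kappa> \<Longrightarrow> strictly_lower n \<mu> \<eta>"
    by (intro mids_strictly_lower[of i n \<mu> \<kappa> \<eta>, OF i])
  moreover have "act (adj i) \<kappa> \<in> A \<or> strictly_lower n (act (adj i) \<kappa>) \<eta>"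
    using low A(2) by (auto simp: strictly_lower_def excess_act_adj[OF i])
  ultimately show "\<mu> \<in> A \<or> strictly_lower n \<mu> \<eta>" using low \<kappa>(2) by blast
qed

lemma zcoeff_lower_0: "f \<in> lower_polys n A \<eta> \<Longrightarrow> \<eta> \<notin> A \<Longrightarrow> zcoeff f \<eta> = 0"
  by (rule zcoeff_eq_0I) (use not_strictly_lower_self in \<open>auto simp: lower_polys_def\<close>)

lemma lower_polys_T_perm:
  assumes K: "K \<subseteq> {1..<n}" and "\<sigma> \<in> parabolic n K" and \<nu>: "\<And>c. excess n c \<nu> \<le> excess n c \<eta>"
    and f: "f \<in> lower_polys n (par_orbit n K \<nu>) \<eta>"
  shows "T_perm n \<sigma> f \<in> lower_polys n (par_orbit n K \<nu>) \<eta>"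
proof -
  obtain ks where ks: "set ks \<subseteq> K" "is_reduced_word n \<sigma> ks"
    using parabolic_reduced_word[OF K assms(2)] .
  have "foldr T ks f \<in> lower_polys n (par_orbit n K \<nu>) \<eta>"
    using ks(1)
  proof (induction ks)
    case (Cons k ks)
    then have k: "k \<in> K" "k \<in> {1..<n}" using K by auto
    have "T k (foldr T ks f) \<in> lower_polys n (par_orbit n K \<nu>) \<eta>"
    proof (rule lower_polys_T[OF k(2)])
      show "excess n c \<kappa> \<le> excess n c \<eta>" if "\<kappa> \<in> par_orbit n K \<nu>" for \<kappa> c
        using excess_par_orbit[OF K that] \<nu> by simp
      show "act (adj k) \<kappa> \<in> par_orbit n K \<nu>" if "\<kappa> \<in> par_orbit n K \<nu>" for \<kappa>
        by (rule par_orbit_trans[OF K that par_orbit_act[OF parabolic_adj[OF K k(1)]]])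
      show "foldr T ks f \<in> lower_polys n (par_orbit n K \<nu>) \<eta>" using Cons by simp
    qed
    then show ?case by simp
  qed (use f in simp)
  then show ?thesis by (simp add: T_perm_eq[OF ks(2)])
qed

text \<open>Along a reduced word starting from a decreasing composition each letter meets a weakly
  decreasing pair: equal entries give a factor t, unequal ones are exchanged with coefficient 1. An
  exchange strictly increases the weight, so a monomial that has left \<open>\<eta>\<close> never
  returns.\<close>

lemma T_word_dominant:
  assumes K: "K \<subseteq> {1..<n}" and dec: "sorted_along False K \<eta>"
  shows "set ks \<subseteq> K \<Longrightarrow> is_reduced_word n (word_perm ks) ks \<Longrightarrow>
    \<exists>e g. foldr T ks (zmon \<eta>) = Const (t ^ e) * zmon (act (word_perm ks) \<eta>) + g \<and> g \<in> lower_polys n {} \<eta> \<and>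
      (act (word_perm ks) \<eta> = \<eta> \<and> e = length ks
       \<or> sort_weight n False \<eta> < sort_weight n False (act (word_perm ks) \<eta>))"
proof (induction ks)
  case Nil
  then show ?case unfolding word_perm_Nil act_id by (intro exI[of _ 0]) (simp add: lower_polys_def)
next
  case (Cons k ks)
  let ?\<tau> = "word_perm ks" and ?w = "sort_weight n False"
  note red = reduced_word_ConsD[OF Cons.prems(2)]
  obtain e g where IH: "foldr T ks (zmon \<eta>) = Const (t ^ e) * zmon (act ?\<tau> \<eta>) + g" "g \<in> lower_polys n {} \<eta>"
    "act ?\<tau> \<eta> = \<eta> \<and> e = length ks \<or> ?w \<eta> < ?w (act ?\<tau> \<eta>)"
    using Cons.IH red(2) Cons.prems(1) by auto
  have ks: "set ks \<subseteq> {1..<n}" "k \<in> K" using Cons.prems(1) K by auto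
  note p = word_perm_permutes[OF ks(1)]
  have \<tau>: "?\<tau> \<in> parabolic n K"
  proof -
    have "set ks \<subseteq> K" using Cons.prems(1) by simp
    then show ?thesis
    proof (induction ks)
      case Nil
      show ?case unfolding word_perm_Nil by (rule parabolic_id[OF K])
    next
      case (Cons k ks)
      then show ?case
        unfolding word_perm_Cons by (intro parabolic_comp[OF K] parabolic_adj[OF K]) simp_all
    qed
  qed
  let ?\<mu> = "act ?\<tau> \<eta>"
  have act: "act (word_perm (k # ks)) \<eta> = act (adj k) ?\<mu>"
    unfolding word_perm_Cons by (rule act_comp[OF bij_adj permutes_bij[OF p]])
  \<comment> \<open>Reducedness says that the entries now at k and k + 1 come from increasing
    positions; these lie in one block, along which \<open>\<eta>\<close> decreases.\<close>
  have "same_block K (inv' ?\<tau> k) (inv' ?\<tau> (Suc k))"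
    using parabolicD(2)[OF K parabolic_inv[OF K \<tau>]] same_block_Suc[OF ks(2)]
    by (meson same_block_sym same_block_trans)
  from sorted_along_block[OF dec this red(3)]
  have ge: "entry ?\<mu> (Suc k) \<le> entry ?\<mu> k"
    by (simp add: act_permutes_entry[OF p])
  have Tg: "T k g \<in> lower_polys n {} \<eta>" by (rule lower_polys_T[OF red(1) _ _ IH(2)]) simp_all
  show ?case
  proof (cases "entry ?\<mu> (Suc k) = entry ?\<mu> k")
    case True
    have "act (adj k) ?\<mu> = ?\<mu>" using True by (simp add: act_adj_eq_iff)
    moreover have "foldr T (k # ks) (zmon \<eta>) = Const (t ^ Suc e) * zmon ?\<mu> + T k g"
      using True by (simp add: IH(1) T_add T_Const_mult T_zmon_eq Const_mult ac_simps)
    ultimately show ?thesis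
      unfolding act using IH(3) Tg by (intro exI[of _ "Suc e"] exI[of _ "T k g"]) auto
  next
    case False
    then have gt: "entry ?\<mu> (Suc k) < entry ?\<mu> k" using ge by simp
    obtain r where r: "Poly_Mapping.keys r \<subseteq> mids k ?\<mu>" "T k (zmon ?\<mu>) = zmon (act (adj k) ?\<mu>) + r"
      using T_zmon_gt[OF gt] by blast
    have "r \<in> lower_polys n {} \<eta>"
      unfolding lower_polys_def using r(1) mids_strictly_lower[OF red(1), of _ ?\<mu> \<eta>]
      by (auto simp: excess_act[OF p])
    then have "Const (t ^ e) * r + T k g \<in> lower_polys n {} \<eta>"
      by (intro lower_polys_add lower_polys_Const_mult Tg)
    moreover have "foldr T (k # ks) (zmon \<eta>) = Const (t ^ e) * zmon (act (adj k) ?\<mu>) + (Const (t ^ e) * r + T k g)"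
      by (simp add: IH(1) T_add T_Const_mult r(2) distrib_left)
    moreover have "?w \<eta> < ?w (act (adj k) ?\<mu>)"
    proof -
      have "?w (act (adj k) (act (adj k) ?\<mu>)) < ?w (act (adj k) ?\<mu>)"
        by (rule sort_weight_act_adj[OF red(1)]) (use gt in simp)
      then have "?w ?\<mu> < ?w (act (adj k) ?\<mu>)" by simp
      then show ?thesis using IH(3) by auto
    qed
    ultimately show ?thesis unfolding act by blast
  qed
qed

lemma zcoeff_T_perm_dominant:
  assumes K: "K \<subseteq> {1..<n}" and dec: "sorted_along False K \<eta>" and \<sigma>: "\<sigma> \<in> parabolic n K"
  shows "zcoeff (T_perm n \<sigma> (zmon \<eta>)) \<eta> = (if act \<sigma> \<eta> = \<eta> then t ^ perm_length n \<sigma> else 0)"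
proof -
  obtain ks where ks: "set ks \<subseteq> K" "is_reduced_word n \<sigma> ks"
    using parabolic_reduced_word[OF K \<sigma>] .
  have w: "word_perm ks = \<sigma>" "perm_length n \<sigma> = length ks"
    using ks(2) by (simp_all add: is_reduced_word_def is_word_def)
  obtain e g where *: "T_perm n \<sigma> (zmon \<eta>) = Const (t ^ e) * zmon (act \<sigma> \<eta>) + g" "g \<in> lower_polys n {} \<eta>"
    "act \<sigma> \<eta> = \<eta> \<and> e = length ks \<or> sort_weight n False \<eta> < sort_weight n False (act \<sigma> \<eta>)"
    using T_word_dominant[OF K dec ks(1)] ks(2) unfolding w(1) T_perm_eq[OF ks(2)] by blast
  show ?thesis
    using *(3) by (auto simp: *(1) lookup_add zcoeff_zmon zcoeff_lower_0[OF *(2)] w(2))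
qed


section \<open>Prescribed symmetry\<close>

locale prescribed_symmetry = admissible_sets +
  fixes \<eta>s :: exponent
  assumes n: "1 \<le> n" and comp_\<eta>s: "is_composition n \<eta>s"
    and dec_I: "\<forall>i\<in>I. entry \<eta>s i \<ge> entry \<eta>s (i + 1)"
    and dec_J: "\<forall>j\<in>J. entry \<eta>s j > entry \<eta>s (j + 1)"
begin

abbreviation "K \<equiv> I \<union> J"
abbreviation "orb \<equiv> par_orbit n K \<eta>s"
abbreviation "sort_I \<equiv> sort_along n I"
abbreviation "sort_J \<equiv> sort_along n J"

lemma dec_K: "sorted_along False K \<eta>s"
  using dec_I dec_J by (auto simp: sorted_along_def order_less_imp_le)

lemma I_range: "i \<in> I \<Longrightarrow> i \<in> {1..<n}" and J_range: "j \<in> J \<Longrightarrow> j \<in> {1..<n}"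
  using I_sub J_sub by blast+

lemma orb_composition: "\<eta> \<in> orb \<Longrightarrow> is_composition n \<eta>"
  unfolding par_orbit_def using is_composition_act[OF parabolicD(1)[OF IJ_sub] comp_\<eta>s] by blast

lemma orb_act: "\<eta> \<in> orb \<Longrightarrow> \<sigma> \<in> parabolic n K \<Longrightarrow> act \<sigma> \<eta> \<in> orb"
  by (rule par_orbit_trans[OF IJ_sub _ par_orbit_act])

lemma orb_adj: "\<eta> \<in> orb \<Longrightarrow> i \<in> K \<Longrightarrow> act (adj i) \<eta> \<in> orb"
  by (rule orb_act[OF _ parabolic_adj[OF IJ_sub]])

lemma sort_K_\<eta>s: "sort_along n K False \<eta>s = \<eta>s"
  by (rule sort_along_eqI[OF IJ_sub par_orbit_refl[OF IJ_sub] dec_K])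

lemma block_distinct_\<eta>s: "block_distinct J \<eta>s"
proof -
  have less: "entry \<eta>s y < entry \<eta>s x" if "same_block J x y" "x < y" for x y
  proof -
    have "{x..<y} \<subseteq> J" using that by (simp add: same_block_def)
    with that(2) show ?thesis
    proof (induction y)
      case (Suc y)
      have "entry \<eta>s (Suc y) < entry \<eta>s y" using Suc.prems dec_J by (auto simp: subset_iff)
      then show ?case using Suc by (cases "x = y") (auto simp: subset_iff less_Suc_eq intro: order_less_trans)
    qed simp
  qed
  show ?thesis
    unfolding block_distinct_def using less by (metis linorder_neqE_nat nat_neq_iff same_block_sym)
qed

lemma I_fixes_J: "\<sigma> \<in> parabolic n I \<Longrightarrow> x \<in> positions J \<Longrightarrow> \<sigma> x = x"
  using parabolic_fixes[OF I_sub] positions_disjoint by blast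

lemma J_fixes_I: "\<tau> \<in> parabolic n J \<Longrightarrow> x \<in> positions I \<Longrightarrow> \<tau> x = x"
  using parabolic_fixes[OF J_sub] positions_disjoint by blast

lemma block_distinct_I_act:
  assumes "\<sigma> \<in> parabolic n I" "block_distinct J \<mu>"
  shows "block_distinct J (act \<sigma> \<mu>)"
proof (rule block_distinct_act)
  note p = parabolic_inv[OF I_sub assms(1)]
  show "inv' \<sigma> permutes {1..n}" by (rule parabolicD(1)[OF I_sub p])
  show "same_block J (inv' \<sigma> x) (inv' \<sigma> y)" if "same_block J x y" for x y
  proof (cases "x = y")
    case False
    then have "x \<in> positions J" "y \<in> positions J"
      using that same_block_imp_positions same_block_sym by metis+
    then show ?thesis using that I_fixes_J[OF p] by simp
  qed simp
  show "block_distinct J (act (inv' \<sigma>) (act \<sigma> \<mu>))"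
    using assms(2) by (simp add: act_inv_act[OF parabolicD(1)[OF I_sub assms(1)]])
qed

lemma block_distinct_orb:
  assumes "\<eta> \<in> orb"
  shows "block_distinct J \<eta>"
proof -
  obtain \<omega> where \<omega>: "\<omega> \<in> parabolic n K" "\<eta> = act \<omega> \<eta>s" using assms unfolding par_orbit_def by blast
  obtain \<sigma> \<tau> where *: "\<sigma> \<in> parabolic n I" "\<tau> \<in> parabolic n J" "\<omega> = \<sigma> \<circ> \<tau>"
    using parabolic_IJ_cases[OF \<omega>(1)] .
  have "\<eta> = act \<sigma> (act \<tau> \<eta>s)"
    unfolding \<omega>(2) *(3) by (rule act_comp_parabolic[OF I_sub *(1) parabolicD(1)[OF J_sub *(2)]])
  then show ?thesis
    using block_distinct_I_act[OF *(1) block_distinct_parabolic[OF J_sub *(2) block_distinct_\<eta>s]] by simp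
qed

lemma sort_I_J_act: "\<tau> \<in> parabolic n J \<Longrightarrow> sort_I up (act \<tau> \<eta>) = act \<tau> (sort_I up \<eta>)"
  by (rule sort_along_commute[OF I_sub parabolicD(1)[OF J_sub] J_fixes_I])
    (simp_all add: parabolic_commute[symmetric])

lemma sort_J_I_act: "\<sigma> \<in> parabolic n I \<Longrightarrow> sort_J up (act \<sigma> \<eta>) = act \<sigma> (sort_J up \<eta>)"
  by (rule sort_along_commute[OF J_sub parabolicD(1)[OF I_sub] I_fixes_J])
    (simp_all add: parabolic_commute)

lemma sort_I_orb: "\<eta> \<in> orb \<Longrightarrow> sort_I up \<eta> \<in> orb"
proof -
  assume \<eta>: "\<eta> \<in> orb"
  obtain \<sigma> where "\<sigma> \<in> parabolic n I" "sort_I up \<eta> = act \<sigma> \<eta>"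
    using sort_along(1)[OF I_sub, of up \<eta>] unfolding par_orbit_def by blast
  then show ?thesis using orb_act[OF \<eta>, of \<sigma>] parabolic_I_sub by auto
qed

lemma sort_J_orb: "\<eta> \<in> orb \<Longrightarrow> sort_J up \<eta> \<in> orb"
proof -
  assume \<eta>: "\<eta> \<in> orb"
  obtain \<sigma> where "\<sigma> \<in> parabolic n J" "sort_J up \<eta> = act \<sigma> \<eta>"
    using sort_along(1)[OF J_sub, of up \<eta>] unfolding par_orbit_def by blast
  then show ?thesis using orb_act[OF \<eta>, of \<sigma>] parabolic_J_sub by auto
qed

lemma arrange_eq:
  assumes "\<eta> \<in> orb"
  shows "arrange n I J \<eta> Pl Pl = sort_J False (sort_I False \<eta>)"
    "arrange n I J \<eta> Pl Ze = sort_I False \<eta>"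
    "arrange n I J \<eta> Ze Pl = sort_J False \<eta>"
    "arrange n I J \<eta> Mi Pl = sort_J False (sort_I True \<eta>)"
    "arrange n I J \<eta> Mi Mi = sort_J True (sort_I True \<eta>)"
  unfolding arrange_def arrange_weak_eq
  using arrange_strict_eq[OF J_sub block_distinct_orb] sort_I_orb[OF assms] assms by simp_all

lemma M_eq: "\<eta> \<in> orb \<Longrightarrow> M n I J \<eta> = (\<Sum>\<sigma> | \<sigma> \<in> parabolic n I \<and> act \<sigma> \<eta> = sort_I False \<eta>. t ^ perm_length n \<sigma>)"
  by (simp add: M_def arrange_eq)

lemma M_pos:
  assumes "\<eta> \<in> orb"
  shows "0 < M n I J \<eta>"
  unfolding M_eq[OF assms]
proof (rule sum_pos)
  show "finite {\<sigma> \<in> parabolic n I. act \<sigma> \<eta> = sort_I False \<eta>}"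
    using finite_parabolic[OF I_sub] by simp
  show "{\<sigma> \<in> parabolic n I. act \<sigma> \<eta> = sort_I False \<eta>} \<noteq> {}"
    using sort_along(1)[OF I_sub, of False \<eta>] unfolding par_orbit_def by auto
qed (simp add: t_positive)

lemma adj_I: "i \<in> I \<Longrightarrow> adj i \<in> parabolic n I" and adj_J: "j \<in> J \<Longrightarrow> adj j \<in> parabolic n J"
  using parabolic_adj[OF I_sub] parabolic_adj[OF J_sub] by blast+

text \<open>Right multiplication by \<open>adj i\<close> matches the two sums. A permutation sorting
  \<open>\<eta>\<close> decreasingly keeps its i-th entry before the smaller (i+1)-st, so each
  matched length grows by one.\<close>

lemma M_act_I:
  assumes "\<eta> \<in> orb" "i \<in> I" "entry \<eta> (Suc i) < entry \<eta> i"
  shows "M n I J (act (adj i) \<eta>) = t * M n I J \<eta>"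
proof -
  let ?A = "{\<sigma> \<in> parabolic n I. act \<sigma> \<eta> = sort_I False \<eta>}"
  let ?B = "{\<sigma> \<in> parabolic n I. act \<sigma> (act (adj i) \<eta>) = sort_I False \<eta>}"
  note i = I_range[OF assms(2)]
  have act: "act (\<sigma> \<circ> adj i) \<mu> = act \<sigma> (act (adj i) \<mu>)" if "\<sigma> \<in> parabolic n I" for \<sigma> \<mu>
    by (rule act_comp_parabolic[OF I_sub that adj_permutes[OF i]])
  have cl: "\<sigma> \<circ> adj i \<in> parabolic n I" if "\<sigma> \<in> parabolic n I" for \<sigma>
    by (rule parabolic_comp[OF I_sub that adj_I[OF assms(2)]])
  have "M n I J (act (adj i) \<eta>) = (\<Sum>\<sigma>\<in>?B. t ^ perm_length n \<sigma>)"
    using M_eq[OF orb_adj[OF assms(1), of i]] assms(2) sort_along_act[OF I_sub adj_I[OF assms(2)]] by simp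
  also have "\<dots> = (\<Sum>\<sigma>\<in>?A. t * t ^ perm_length n \<sigma>)"
  proof (rule sum.reindex_bij_witness[of _ "\<lambda>\<sigma>. \<sigma> \<circ> adj i" "\<lambda>\<sigma>. \<sigma> \<circ> adj i"])
    fix \<sigma> assume \<sigma>: "\<sigma> \<in> ?B"
    then show A: "\<sigma> \<circ> adj i \<in> ?A" using act cl by simp
    let ?\<tau> = "\<sigma> \<circ> adj i"
    have \<tau>: "?\<tau> \<in> parabolic n I" "act ?\<tau> \<eta> = sort_I False \<eta>" using A by blast+
    note p = parabolicD[OF I_sub \<tau>(1)]
    have "?\<tau> i < ?\<tau> (Suc i)"
    proof (rule ccontr)
      assume "\<not> ?thesis"
      then have less: "?\<tau> (Suc i) < ?\<tau> i" using permutes_adj_neq[OF p(1), of i] by simp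
      have "same_block I (?\<tau> (Suc i)) (?\<tau> i)"
        using p(2) same_block_Suc[OF assms(2)] by (meson same_block_sym same_block_trans)
      from sorted_along_block[OF sort_along(2)[OF I_sub] this less, of False \<eta>]
      have "entry (act ?\<tau> \<eta>) (?\<tau> i) \<le> entry (act ?\<tau> \<eta>) (?\<tau> (Suc i))" using \<tau>(2) by simp
      then have "entry \<eta> i \<le> entry \<eta> (Suc i)" by (simp only: entry_act_image[OF p(1)])
      then show False using assms(3) by simp
    qed
    then have "inv_count n (?\<tau> \<circ> adj i) = Suc (inv_count n ?\<tau>)" by (rule inv_count_ascent[OF i])
    then have "perm_length n \<sigma> = Suc (perm_length n ?\<tau>)"
      using perm_length_eq[OF p(1)] perm_length_eq[OF parabolicD(1)[OF I_sub]] \<sigma> by (simp add: comp_adj_adj)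
    then show "t * t ^ perm_length n ?\<tau> = t ^ perm_length n \<sigma>" by simp
  next
    fix \<sigma> assume "\<sigma> \<in> ?A"
    then show "\<sigma> \<circ> adj i \<in> ?B" using act cl by simp
  qed (simp_all only: comp_adj_adj)
  finally show ?thesis by (simp add: M_eq[OF assms(1)] sum_distrib_left)
qed

lemma M_act_J:
  assumes "\<eta> \<in> orb" "j \<in> J"
  shows "M n I J (act (adj j) \<eta>) = M n I J \<eta>"
proof -
  have "act \<sigma> (act (adj j) \<eta>) = act (adj j) (act \<sigma> \<eta>)" if "\<sigma> \<in> parabolic n I" for \<sigma>
    using act_comp_parabolic[OF I_sub that adj_permutes[OF J_range[OF assms(2)]]]
      act_comp_parabolic[OF J_sub adj_J[OF assms(2)] parabolicD(1)[OF I_sub that]]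
      parabolic_commute[OF that adj_J[OF assms(2)]] by metis
  then have "act \<sigma> (act (adj j) \<eta>) = sort_I False (act (adj j) \<eta>) \<longleftrightarrow> act \<sigma> \<eta> = sort_I False \<eta>"
    if "\<sigma> \<in> parabolic n I" for \<sigma>
    using that sort_I_J_act[OF adj_J[OF assms(2)]] by (metis act_adj_adj)
  then have "{\<sigma> \<in> parabolic n I. act \<sigma> (act (adj j) \<eta>) = sort_I False (act (adj j) \<eta>)}
     = {\<sigma> \<in> parabolic n I. act \<sigma> \<eta> = sort_I False \<eta>}" by blast
  then show ?thesis
    using M_eq[OF assms(1)] M_eq[OF orb_adj[OF assms(1), of j]] assms(2) by simp
qed


text \<open>The permutation that supplies the sign, freed from the rearrangement along I that occurs
  in the theorem (\<open>J_permI\<close>). Sign statements are made for every such permutation,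
  which lets the inductions compose with \<open>adj j\<close> directly.\<close>

definition J_perm :: "exponent \<Rightarrow> (nat \<Rightarrow> nat) \<Rightarrow> bool" where
  "J_perm \<eta> \<tau> \<longleftrightarrow> \<tau> \<in> parabolic n J \<and> act \<tau> (sort_J False \<eta>) = \<eta>"

lemma J_perm_exists: "\<exists>\<tau>. J_perm \<eta> \<tau>"
  using par_orbit_sym[OF J_sub sort_along(1)[OF J_sub, of False \<eta>]] unfolding par_orbit_def J_perm_def by force

lemma J_perm_act_I:
  assumes "i \<in> I" "J_perm (act (adj i) \<eta>) \<tau>"
  shows "J_perm \<eta> \<tau>"
proof -
  have \<tau>: "\<tau> \<in> parabolic n J" and eq: "act \<tau> (sort_J False (act (adj i) \<eta>)) = act (adj i) \<eta>"
    using assms(2) by (auto simp: J_perm_def)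
  have "act \<tau> (act (adj i) \<mu>) = act (adj i) (act \<tau> \<mu>)" for \<mu>
    using act_comp_parabolic[OF J_sub \<tau> adj_permutes[OF I_range[OF assms(1)]]]
      act_comp_parabolic[OF I_sub adj_I[OF assms(1)] parabolicD(1)[OF J_sub \<tau>]]
      parabolic_commute[OF adj_I[OF assms(1)] \<tau>] by metis
  then have "act (adj i) (act \<tau> (sort_J False \<eta>)) = act (adj i) \<eta>"
    using eq sort_J_I_act[OF adj_I[OF assms(1)]] by simp
  then show ?thesis using \<tau> unfolding J_perm_def by (metis act_adj_adj)
qed

lemma J_perm_act_J:
  assumes "j \<in> J" "J_perm (act (adj j) \<eta>) \<tau>"
  shows "J_perm \<eta> (adj j \<circ> \<tau>)"
    and "(- 1) ^ perm_length n (adj j \<circ> \<tau>) = - ((- 1) ^ perm_length n \<tau> :: qt)"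
proof -
  have \<tau>: "\<tau> \<in> parabolic n J" and eq: "act \<tau> (sort_J False (act (adj j) \<eta>)) = act (adj j) \<eta>"
    using assms(2) by (auto simp: J_perm_def)
  have "act (adj j \<circ> \<tau>) (sort_J False \<eta>) = act (adj j) (act \<tau> (sort_J False \<eta>))"
    by (rule act_comp_parabolic[OF J_sub adj_J[OF assms(1)] parabolicD(1)[OF J_sub \<tau>]])
  also have "\<dots> = \<eta>"
    using eq sort_along_act[OF J_sub adj_J[OF assms(1)]] by simp
  finally show "J_perm \<eta> (adj j \<circ> \<tau>)"
    unfolding J_perm_def using parabolic_comp[OF J_sub adj_J[OF assms(1)] \<tau>] by blast
  show "(- 1) ^ perm_length n (adj j \<circ> \<tau>) = - ((- 1) ^ perm_length n \<tau> :: qt)"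
    by (rule sign_adj_comp[OF parabolicD(1)[OF J_sub \<tau>] J_range[OF assms(1)]])
qed

text \<open>Entries in a J-block of \<open>\<eta>s\<close> are distinct, so a stabilizing element
  cannot move any J-position.\<close>

lemma J_stabilizer:
  assumes "\<omega> \<in> parabolic n K" "act \<omega> \<eta>s = \<eta>s" "\<sigma> \<in> parabolic n I" "\<tau> \<in> parabolic n J" "\<omega> = \<sigma> \<circ> \<tau>"
  shows "\<tau> = id"
proof
  fix x
  show "\<tau> x = id x"
  proof (cases "x \<in> positions J")
    case True
    have "entry \<eta>s (\<omega> x) = entry \<eta>s x"
      using entry_act_image[OF parabolicD(1)[OF IJ_sub assms(1)], of \<eta>s x] assms(2) by simp
    then have "entry \<eta>s (\<tau> x) = entry \<eta>s x" using J_value[OF assms(3,4) True] assms(5) by simp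
    then show ?thesis
      using block_distinct_\<eta>s parabolicD(2)[OF J_sub assms(4), of x] unfolding block_distinct_def by (metis id_apply)
  next
    case False
    then show ?thesis using parabolic_fixes[OF J_sub assms(4)] by simp
  qed
qed

lemma perm_length_id: "perm_length n id = 0"
  using perm_length_eq[OF permutes_id] inv_count_id by simp


section \<open>Symmetrized monomials and their coefficient at \<open>\<eta>s\<close>\<close>

definition lead :: "exponent \<Rightarrow> qt" where
  "lead \<mu> = zcoeff (O_op n I J (zmon \<mu>)) \<eta>s"

text \<open>Symmetrizing stays within the orbit of \<open>\<nu>\<close> and terms strictly lower
  than \<open>\<eta>s\<close>; neither contains \<open>\<eta>s\<close>.\<close>

lemma lead_outside_orbit:
  assumes "\<And>c. excess n c \<nu> \<le> excess n c \<eta>s" "\<nu> \<notin> orb"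
  shows "lead \<nu> = 0"
proof -
  have z: "zmon \<nu> \<in> lower_polys n (par_orbit n K \<nu>) \<eta>s"
    using par_orbit_refl[OF IJ_sub] by (simp add: lower_polys_def)
  have "O_op n I J (zmon \<nu>) \<in> lower_polys n (par_orbit n K \<nu>) \<eta>s"
    unfolding O_op_eq
    by (intro lower_polys_sum lower_polys_Const_mult lower_polys_T_perm[OF IJ_sub _ _ z] assms(1))
  moreover have "\<eta>s \<notin> par_orbit n K \<nu>" using assms(2) par_orbit_sym[OF IJ_sub] by blast
  ultimately show ?thesis unfolding lead_def by (rule zcoeff_lower_0)
qed

lemma zcoeff_O_op: "zcoeff (O_op n I J f) \<eta>s = (\<Sum>\<nu>\<in>Poly_Mapping.keys f. zcoeff f \<nu> * lead \<nu>)"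
proof -
  have "O_op n I J f = O_op n I J (\<Sum>\<nu>\<in>Poly_Mapping.keys f. Const (zcoeff f \<nu>) * zmon \<nu>)"
    using zpoly_expansion[of "Poly_Mapping.keys f" f] by simp
  then show ?thesis by (simp add: O_op_sum O_op_Const_mult lookup_sum lead_def)
qed

lemma orb_excess: "\<mu> \<in> orb \<Longrightarrow> excess n c \<mu> = excess n c \<eta>s"
  by (rule excess_par_orbit[OF IJ_sub])

lemma lead_strictly_lower: "strictly_lower n \<nu> \<eta>s \<Longrightarrow> lead \<nu> = 0"
proof (rule lead_outside_orbit)
  assume "strictly_lower n \<nu> \<eta>s"
  then show "\<nu> \<notin> orb" using orb_excess unfolding strictly_lower_def by (metis less_irrefl)
qed (simp add: strictly_lower_def)

text \<open>The intermediate terms of \<open>T i\<close> are strictly lower and drop out. Together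
  with the absorption of \<open>T i\<close> by \<open>O_op\<close> this gives the recursions for
  \<open>lead\<close>.\<close>

lemma zcoeff_O_op_T:
  assumes "\<mu> \<in> orb" "i \<in> {1..<n}" "entry \<mu> (Suc i) < entry \<mu> i"
  shows "zcoeff (O_op n I J (T i (zmon \<mu>))) \<eta>s = lead (act (adj i) \<mu>)"
proof -
  obtain r where r: "Poly_Mapping.keys r \<subseteq> mids i \<mu>" "T i (zmon \<mu>) = zmon (act (adj i) \<mu>) + r"
    using T_zmon_gt[OF assms(3)] by blast
  have "strictly_lower n \<nu> \<eta>s" if "\<nu> \<in> Poly_Mapping.keys r" for \<nu>
    by (rule mids_strictly_lower[OF assms(2), of \<nu> \<mu>]) (use r(1) that orb_excess[OF assms(1)] in auto)
  then have "zcoeff (O_op n I J r) \<eta>s = 0"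
    unfolding zcoeff_O_op[of r] using lead_strictly_lower by (intro sum.neutral) simp
  then show ?thesis by (simp add: r(2) O_op_add lookup_add lead_def)
qed

lemma lead_act_I:
  assumes "\<mu> \<in> orb" "i \<in> I" "entry \<mu> (Suc i) < entry \<mu> i"
  shows "lead (act (adj i) \<mu>) = t * lead \<mu>"
  using zcoeff_O_op_T[OF assms(1) I_range[OF assms(2)] assms(3)]
  by (simp add: O_op_T_I[OF assms(2)] lead_def)

lemma lead_act_J:
  assumes "\<mu> \<in> orb" "j \<in> J" "entry \<mu> (Suc j) < entry \<mu> j"
  shows "lead (act (adj j) \<mu>) = - lead \<mu>"
  using zcoeff_O_op_T[OF assms(1) J_range[OF assms(2)] assms(3)]
  by (simp add: O_op_T_J[OF assms(2)] lead_def)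

lemma sort_\<eta>s: "sort_I False \<eta>s = \<eta>s" "sort_J False \<eta>s = \<eta>s"
  using dec_K by (auto intro!: sort_along_eqI I_sub J_sub par_orbit_refl simp: sorted_along_def)

text \<open>Only elements stabilizing \<open>\<eta>s\<close> contribute; their J-factor is trivial,
  so they have weight 1.\<close>

lemma lead_\<eta>s: "lead \<eta>s = M n I J \<eta>s"
proof -
  have "lead \<eta>s = (\<Sum>\<omega>\<in>parabolic n K. if act \<omega> \<eta>s = \<eta>s then weight \<omega> * t ^ perm_length n \<omega> else 0)"
    unfolding lead_def O_op_eq lookup_sum zcoeff_Const_mult
    by (rule sum.cong[OF refl]) (simp add: zcoeff_T_perm_dominant[OF IJ_sub dec_K])
  also have "\<dots> = (\<Sum>\<omega> | \<omega> \<in> parabolic n K \<and> act \<omega> \<eta>s = \<eta>s. weight \<omega> * t ^ perm_length n \<omega>)"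
    by (rule sum.inter_filter[symmetric]) (rule finite_parabolic[OF IJ_sub])
  also have "\<dots> = (\<Sum>\<sigma> | \<sigma> \<in> parabolic n I \<and> act \<sigma> \<eta>s = \<eta>s. t ^ perm_length n \<sigma>)"
  proof (rule sum.cong)
    have I: "\<omega> \<in> parabolic n I" if \<omega>: "\<omega> \<in> parabolic n K" "act \<omega> \<eta>s = \<eta>s" for \<omega>
    proof -
      obtain \<sigma> \<tau> where *: "\<sigma> \<in> parabolic n I" "\<tau> \<in> parabolic n J" "\<omega> = \<sigma> \<circ> \<tau>"
        using parabolic_IJ_cases[OF \<omega>(1)] .
      have "\<tau> = id" by (rule J_stabilizer[OF \<omega> *])
      then show ?thesis using * by simp
    qed
    then show "{\<omega>. \<omega> \<in> parabolic n K \<and> act \<omega> \<eta>s = \<eta>s} = {\<sigma>. \<sigma> \<in> parabolic n I \<and> act \<sigma> \<eta>s = \<eta>s}"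
      using parabolic_I_sub by blast
    fix \<sigma> assume "\<sigma> \<in> {\<sigma>. \<sigma> \<in> parabolic n I \<and> act \<sigma> \<eta>s = \<eta>s}"
    then have "J_part n I J (\<sigma> \<circ> id) = id" using J_part_comp[OF _ parabolic_id[OF J_sub]] by blast
    then have "weight \<sigma> = 1" by (simp add: weight_def perm_length_id)
    then show "weight \<sigma> * t ^ perm_length n \<sigma> = t ^ perm_length n \<sigma>" by simp
  qed
  also have "\<dots> = M n I J \<eta>s"
    by (simp add: M_eq[OF par_orbit_refl[OF IJ_sub]] sort_\<eta>s)
  finally show ?thesis .
qed

lemma lead_eq:
  assumes "\<mu> \<in> orb" "J_perm \<mu> \<tau>"
  shows "lead \<mu> = (- 1) ^ perm_length n \<tau> * M n I J \<mu>"
proof -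
  have "\<forall>\<tau>. J_perm \<mu> \<tau> \<longrightarrow> lead \<mu> = (- 1) ^ perm_length n \<tau> * M n I J \<mu>"
    using assms(1)
  proof (rule par_orbit_induct[OF IJ_sub, where up = False], unfold sort_K_\<eta>s)
    show "\<forall>\<tau>. J_perm \<eta>s \<tau> \<longrightarrow> lead \<eta>s = (- 1) ^ perm_length n \<tau> * M n I J \<eta>s"
    proof (intro allI impI)
      fix \<tau> assume "J_perm \<eta>s \<tau>"
      then have *: "\<tau> \<in> parabolic n J" "act \<tau> \<eta>s = \<eta>s" by (simp_all add: J_perm_def sort_\<eta>s)
      then have "\<tau> \<in> parabolic n K" using parabolic_J_sub by blast
      then have "\<tau> = id" using J_stabilizer[OF _ *(2) parabolic_id[OF I_sub] *(1)] by simp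
      then show "lead \<eta>s = (- 1) ^ perm_length n \<tau> * M n I J \<eta>s" by (simp add: lead_\<eta>s perm_length_id)
    qed
  next
    fix \<mu> i
    assume \<mu>: "\<mu> \<in> orb" and i: "i \<in> K"
      and IH: "\<forall>\<tau>. J_perm \<mu> \<tau> \<longrightarrow> lead \<mu> = (- 1) ^ perm_length n \<tau> * M n I J \<mu>"
      and "if False then entry \<mu> i < entry \<mu> (Suc i) else entry \<mu> (Suc i) < entry \<mu> i"
    then have gt: "entry \<mu> (Suc i) < entry \<mu> i" by simp
    show "\<forall>\<tau>. J_perm (act (adj i) \<mu>) \<tau> \<longrightarrow>
        lead (act (adj i) \<mu>) = (- 1) ^ perm_length n \<tau> * M n I J (act (adj i) \<mu>)"
    proof (intro allI impI)
      fix \<tau> assume \<tau>: "J_perm (act (adj i) \<mu>) \<tau>"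
      show "lead (act (adj i) \<mu>) = (- 1) ^ perm_length n \<tau> * M n I J (act (adj i) \<mu>)"
      proof (cases "i \<in> I")
        case True
        then show ?thesis
          using IH J_perm_act_I[OF True \<tau>] by (simp add: lead_act_I[OF \<mu> True gt] M_act_I[OF \<mu> True gt])
      next
        case False
        then have j: "i \<in> J" using i by blast
        show ?thesis
          using IH J_perm_act_J[OF j \<tau>] by (simp add: lead_act_J[OF \<mu> j gt] M_act_J[OF \<mu> j])
      qed
    qed
  qed
  then show ?thesis using assms(2) by blast
qed

end


text \<open>A J-block lies entirely on one side of a position outside it, so rearranging the block
  does not change what that position counts.\<close>

lemma eigval_act_fixed:
  assumes J: "J \<subseteq> {1..<n}" and \<tau>: "\<tau> \<in> parabolic n J" and x: "x \<notin> positions J"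
  shows "eigval n (act \<tau> \<eta>) x = eigval n \<eta> x"
proof -
  note p = parabolicD[OF J \<tau>]
  have ent: "entry (act \<tau> \<eta>) x = entry \<eta> x"
    by (rule entry_act_fixed[OF p(1) parabolic_fixes[OF J \<tau> x]])
  have not_between: "\<not> (a < x \<and> x \<le> b)" "\<not> (a \<le> x \<and> x < b)" if "same_block J a b" for a b
  proof -
    show "\<not> (a < x \<and> x \<le> b)"
    proof
      assume "a < x \<and> x \<le> b"
      then have "x - 1 \<in> {a..<b}" "x = Suc (x - 1)" by auto
      moreover have "{a..<b} \<subseteq> J" using that \<open>a < x \<and> x \<le> b\<close> by (simp add: same_block_def)
      ultimately show False using x unfolding positions_def by blast
    qed
    show "\<not> (a \<le> x \<and> x < b)"
    proof
      assume "a \<le> x \<and> x < b"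
      then have "x \<in> J" using that by (auto simp: same_block_def subset_iff)
      then show False using x unfolding positions_def by blast
    qed
  qed
  have "\<tau> j < x \<longleftrightarrow> j < x" "\<tau> j > x \<longleftrightarrow> j > x" for j
    using not_between[OF p(2)[of j]] not_between[OF same_block_sym[OF p(2)[of j]]] by linarith+
  then have "coleg n (act \<tau> \<eta>) x = coleg n \<eta> x"
    by (intro coleg_eqI[OF permutes_imp_bij[OF p(1)]]) (simp add: coleg_rel_def ent entry_act_image[OF p(1)])
  then show ?thesis by (simp add: eigval_def ent)
qed

section \<open>Comparison of the constants with the explicit formula\<close>

context prescribed_symmetry
begin

text \<open>The arrangement (-,-) of every member of the orbit
  (\<open>sort_J_sort_I_True\<close>).\<close>

definition \<eta>m :: exponent where
  "\<eta>m = sort_along n K True \<eta>s"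

lemma \<eta>m_orb: "\<eta>m \<in> orb"
  unfolding \<eta>m_def by (rule sort_along(1)[OF IJ_sub])

lemma sort_J_sort_I:
  assumes "\<eta> \<in> orb"
  shows "sort_J up (sort_I up' \<eta>) = sort_J up (sort_I up' \<eta>s)"
proof -
  obtain \<omega> where \<omega>: "\<omega> \<in> parabolic n K" "\<eta> = act \<omega> \<eta>s" using assms unfolding par_orbit_def by blast
  obtain \<sigma> \<tau> where *: "\<sigma> \<in> parabolic n I" "\<tau> \<in> parabolic n J" "\<omega> = \<sigma> \<circ> \<tau>"
    using parabolic_IJ_cases[OF \<omega>(1)] .
  have "\<eta> = act \<sigma> (act \<tau> \<eta>s)"
    unfolding \<omega>(2) *(3) by (rule act_comp_parabolic[OF I_sub *(1) parabolicD(1)[OF J_sub *(2)]])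
  then show ?thesis
    by (simp add: sort_along_act[OF I_sub *(1)] sort_I_J_act[OF *(2)] sort_along_act[OF J_sub *(2)])
qed

lemma sort_J_sort_I_True:
  assumes "\<eta> \<in> orb"
  shows "sort_J True (sort_I True \<eta>) = \<eta>m"
proof -
  let ?\<mu> = "sort_J True (sort_I True \<eta>)"
  obtain \<tau> where \<tau>: "\<tau> \<in> parabolic n J" "?\<mu> = act \<tau> (sort_I True \<eta>)"
    using sort_along(1)[OF J_sub, of True "sort_I True \<eta>"] unfolding par_orbit_def by blast
  have "entry ?\<mu> x = entry (sort_I True \<eta>) x" if "x \<in> positions I" for x
    unfolding \<tau>(2) by (rule entry_act_fixed[OF parabolicD(1)[OF J_sub \<tau>(1)] J_fixes_I[OF \<tau>(1) that]])
  then have "sorted_along True I ?\<mu>"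
    using sort_along(2)[OF I_sub, of True \<eta>] adj_positions unfolding sorted_along_def by metis
  moreover have "sorted_along True J ?\<mu>" by (rule sort_along(2)[OF J_sub])
  ultimately have "sorted_along True K ?\<mu>" unfolding sorted_along_def by blast
  moreover have "?\<mu> \<in> orb" by (rule sort_J_orb[OF sort_I_orb[OF assms]])
  ultimately show ?thesis unfolding \<eta>m_def by (intro sort_along_eqI[OF IJ_sub, symmetric])
qed

text \<open>The increasing arrangement is the minimum of the orbit; consequently its Macdonald
  polynomial contains no other monomial of the orbit.\<close>

lemma below_\<eta>m:
  assumes "\<nu> \<in> orb"
  shows "below n \<eta>m \<nu>"
  using assms
proof (rule par_orbit_induct[OF IJ_sub, where up = True], fold \<eta>m_def)
  show "below n \<eta>m \<eta>m" by (rule below_refl[OF orb_composition[OF \<eta>m_orb]])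
next
  fix \<mu> i
  assume \<mu>: "\<mu> \<in> orb" and i: "i \<in> K" and IH: "below n \<eta>m \<mu>"
    and "if True then entry \<mu> i < entry \<mu> (Suc i) else entry \<mu> (Suc i) < entry \<mu> i"
  then have le: "entry \<mu> i \<le> entry \<mu> (Suc i)" by simp
  have "i \<in> {1..<n}" using i IJ_sub by blast
  then show "below n \<eta>m (act (adj i) \<mu>)"
    using below_trans[OF IH below_act_adj(2)[OF _ below_refl[OF orb_composition[OF \<mu>]] le]] by blast
qed

lemma zcoeff_O_op_\<eta>m: "zcoeff (O_op n I J (E n \<eta>m)) \<eta>s = lead \<eta>m"
proof -
  let ?E = "E n \<eta>m"
  have M: "is_Macdonald n \<eta>m ?E" by (rule is_Macdonald_E[OF n orb_composition[OF \<eta>m_orb]])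
  have "zcoeff ?E \<nu> * lead \<nu> = (if \<nu> = \<eta>m then lead \<eta>m else 0)" if "\<nu> \<in> Poly_Mapping.keys ?E" for \<nu>
  proof (cases "\<nu> = \<eta>m")
    case False
    have below: "below n \<nu> \<eta>m" using M that by (simp add: is_Macdonald_def)
    have "\<nu> \<notin> orb" using below_antisym[OF below below_\<eta>m] False by blast
    then have "lead \<nu> = 0"
      by (rule lead_outside_orbit[rotated])
        (use below_excess[OF below] orb_excess[OF \<eta>m_orb] in simp)
    then show ?thesis using False by simp
  qed (use M in \<open>simp add: is_Macdonald_def\<close>)
  then have "zcoeff (O_op n I J ?E) \<eta>s = (\<Sum>\<nu>\<in>Poly_Mapping.keys ?E. if \<nu> = \<eta>m then lead \<eta>m else 0)"
    unfolding zcoeff_O_op[of ?E] by (rule sum.cong[OF refl])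
  moreover have "\<eta>m \<in> Poly_Mapping.keys ?E" using M by (simp add: is_Macdonald_def in_keys_iff)
  ultimately show ?thesis by simp
qed

lemma lead_\<eta>m_nonzero: "lead \<eta>m \<noteq> 0"
  using J_perm_exists[of \<eta>m] lead_eq[OF \<eta>m_orb] M_pos[OF \<eta>m_orb] by auto

text \<open>The right-hand side of the theorem, with the arrangements (-,+) and (-,-) already
  replaced by their common values on the orbit.\<close>

definition coef :: "exponent \<Rightarrow> (nat \<Rightarrow> nat) \<Rightarrow> qt" where
  "coef \<eta> \<tau> = (- 1) ^ perm_length n \<tau> * M n I J \<eta> *
     ((d' n \<eta> * d' n (sort_J False (sort_I True \<eta>s)) * d n (sort_J False (sort_I True \<eta>s))) /
      (d' n (sort_J False \<eta>) * d n (sort_J False \<eta>) * d' n \<eta>m))"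

lemma coef_nonzero: "\<eta> \<in> orb \<Longrightarrow> coef \<eta> \<tau> \<noteq> 0"
  using M_pos[of \<eta>] by (simp add: coef_def)

text \<open>At \<open>\<eta>m\<close> the arrangements (0,+) and (-,+) coincide, so the quotient of
  diagram products is 1.\<close>

lemma coef_\<eta>m:
  assumes "J_perm \<eta>m \<tau>"
  shows "coef \<eta>m \<tau> = lead \<eta>m"
proof -
  obtain \<rho> where \<rho>: "\<rho> \<in> parabolic n J" "sort_J True (sort_I True \<eta>s) = act \<rho> (sort_I True \<eta>s)"
    using sort_along(1)[OF J_sub, of True "sort_I True \<eta>s"] unfolding par_orbit_def by blast
  have "sort_J False \<eta>m = sort_J False (sort_I True \<eta>s)"
    using sort_J_sort_I_True[OF par_orbit_refl[OF IJ_sub]] \<rho>(2)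
      sort_along_act[OF J_sub \<rho>(1), of False "sort_I True \<eta>s"] by metis
  then show ?thesis unfolding coef_def lead_eq[OF \<eta>m_orb assms] by simp
qed

text \<open>Symmetrizing \<open>T_E_lt\<close> replaces the operator by t; the constant is t + (1 -
  t)/(1 - x), divided by t.\<close>

lemma O_op_E_raise_I:
  assumes \<eta>: "\<eta> \<in> orb" and i: "i \<in> I" and gt: "entry \<eta> (Suc i) < entry \<eta> i"
  defines "x \<equiv> eig_ratio n \<eta> i"
  shows "O_op n I J (E n \<eta>) = Const ((1 - t * x) / (t * (1 - x))) * O_op n I J (E n (act (adj i) \<eta>))"
proof -
  let ?\<mu> = "act (adj i) \<eta>"
  note i' = I_range[OF i]
  have \<mu>: "is_composition n ?\<mu>" by (rule is_composition_act_adj[OF orb_composition[OF \<eta>] i'])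
  have "T i (E n ?\<mu>) = Const t * E n \<eta> - Const ((1 - t) / (1 - x)) * E n ?\<mu>"
    using T_E_lt[OF i' \<mu>] gt by (simp add: intertwine_act_adj[OF i' gt] x_def)
  then have "Const t * O_op n I J (E n ?\<mu>)
      = Const t * O_op n I J (E n \<eta>) - Const ((1 - t) / (1 - x)) * O_op n I J (E n ?\<mu>)"
    using O_op_T_I[OF i, of "E n ?\<mu>"] by (simp add: O_op_diff O_op_Const_mult)
  then have "Const t * O_op n I J (E n \<eta>) = Const (t + (1 - t) / (1 - x)) * O_op n I J (E n ?\<mu>)"
    by (simp add: Const_add distrib_right)
  also have "t + (1 - t) / (1 - x) = t * ((1 - t * x) / (t * (1 - x)))"
    using eig_ratio_gt_neq[OF i' gt] by (simp add: x_def field_simps)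
  finally have "Const t * O_op n I J (E n \<eta>) = Const t * (Const ((1 - t * x) / (t * (1 - x))) * O_op n I J (E n ?\<mu>))"
    by (simp only: Const_mult mult.assoc)
  then show ?thesis by simp
qed

text \<open>As along I, with the operator replaced by -1.\<close>

lemma O_op_E_raise_J:
  assumes \<eta>: "\<eta> \<in> orb" and j: "j \<in> J" and gt: "entry \<eta> (Suc j) < entry \<eta> j"
  defines "x \<equiv> eig_ratio n \<eta> j"
  shows "O_op n I J (E n \<eta>) = Const (- ((1 - x / t) / (1 - x))) * O_op n I J (E n (act (adj j) \<eta>))"
proof -
  let ?\<mu> = "act (adj j) \<eta>"
  note j' = J_range[OF j]
  have \<mu>: "is_composition n ?\<mu>" by (rule is_composition_act_adj[OF orb_composition[OF \<eta>] j'])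
  have "T j (E n ?\<mu>) = Const t * E n \<eta> - Const ((1 - t) / (1 - x)) * E n ?\<mu>"
    using T_E_lt[OF j' \<mu>] gt by (simp add: intertwine_act_adj[OF j' gt] x_def)
  then have "- O_op n I J (E n ?\<mu>)
      = Const t * O_op n I J (E n \<eta>) - Const ((1 - t) / (1 - x)) * O_op n I J (E n ?\<mu>)"
    using O_op_T_J[OF j, of "E n ?\<mu>"] by (simp add: O_op_diff O_op_Const_mult)
  then have "Const t * O_op n I J (E n \<eta>) = Const ((1 - t) / (1 - x) - 1) * O_op n I J (E n ?\<mu>)"
    by (simp add: Const_diff left_diff_distrib) (simp add: algebra_simps)
  also have "(1 - t) / (1 - x) - 1 = t * (- ((1 - x / t) / (1 - x)))"
    using eig_ratio_gt_neq[OF j' gt] by (simp add: x_def field_simps)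
  finally have "Const t * O_op n I J (E n \<eta>) = Const t * (Const (- ((1 - x / t) / (1 - x))) * O_op n I J (E n ?\<mu>))"
    by (simp only: Const_mult mult.assoc)
  then show ?thesis by simp
qed

text \<open>The ratio x is the same at \<open>\<eta>\<close> and after sorting along J, so the two
  \<open>d'\<close> factors cancel; \<open>d\<close> of the sorted composition and \<open>M\<close>
  supply the constant.\<close>

lemma coef_raise_I:
  assumes \<eta>: "\<eta> \<in> orb" and i: "i \<in> I" and gt: "entry \<eta> (Suc i) < entry \<eta> i"
  defines "x \<equiv> eig_ratio n \<eta> i"
  shows "coef \<eta> \<tau> = (1 - t * x) / (t * (1 - x)) * coef (act (adj i) \<eta>) \<tau>"
proof -
  let ?\<mu> = "act (adj i) \<eta>" and ?X = "sort_J False \<eta>"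
  note i' = I_range[OF i]
  obtain \<rho> where \<rho>: "\<rho> \<in> parabolic n J" "?X = act \<rho> \<eta>"
    using sort_along(1)[OF J_sub, of False \<eta>] unfolding par_orbit_def by blast
  have pos: "i \<in> positions I" "Suc i \<in> positions I" using adj_positions[OF i] by auto
  then have notJ: "i \<notin> positions J" "Suc i \<notin> positions J" using positions_disjoint by blast+
  have ent: "entry ?X k = entry \<eta> k" if "k \<in> positions I" for k
    unfolding \<rho>(2) by (rule entry_act_fixed[OF parabolicD(1)[OF J_sub \<rho>(1)] J_fixes_I[OF \<rho>(1) that]])
  have gtX: "entry ?X (Suc i) < entry ?X i" using gt ent pos by simp
  have x: "eig_ratio n ?X i = x"
    unfolding eig_ratio_def \<rho>(2) eigval_act_fixed[OF J_sub \<rho>(1) notJ(1)] eigval_act_fixed[OF J_sub \<rho>(1) notJ(2)] x_def ..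
  have \<mu>X: "sort_J False ?\<mu> = act (adj i) ?X" by (rule sort_J_I_act[OF adj_I[OF i]])
  note nz = eig_ratio_gt_neq[OF i' gt, folded x_def]
  have nz': "1 - x \<noteq> 0" "1 - x / t \<noteq> 0" "1 - t * x \<noteq> 0" using nz by auto
  have e1: "d' n ?\<mu> = d' n \<eta> * (1 - x) / (1 - x / t)"
    using d'_act_adj[OF i' gt] nz' by (simp add: x_def nonzero_eq_divide_eq)
  have e2: "d' n (act (adj i) ?X) = d' n ?X * (1 - x) / (1 - x / t)"
    using d'_act_adj[OF i' gtX] nz' by (simp add: x nonzero_eq_divide_eq)
  have e3: "d n (act (adj i) ?X) = d n ?X * (1 - t * x) / (1 - x)"
    using d_act_adj[OF i' gtX] nz' by (simp add: x nonzero_eq_divide_eq)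
  \<comment> \<open>Stated for independent quantities, so that the diagram products stay opaque
    while denominators are cleared.\<close>
  have generic: "s * m * (a * b * c / (u * v * w))
      = z / (t * y) * (s * (t * m) * ((a * y / k) * b * c / ((u * y / k) * (v * z / y) * w)))"
    if "y \<noteq> 0" "k \<noteq> 0" "z \<noteq> 0" "u \<noteq> 0" "v \<noteq> 0" "w \<noteq> 0" for s m a b c u v w y k z :: qt
    using that by (simp add: divide_simps)
  show ?thesis
    unfolding coef_def M_act_I[OF \<eta> i gt] \<mu>X e1 e2 e3
    by (rule generic) (use nz' in simp_all)
qed

text \<open>Sorting along J forgets the exchange, so only \<open>d'\<close> of \<open>\<eta>\<close>
  and the sign change.\<close>

lemma coef_raise_J:
  assumes \<eta>: "\<eta> \<in> orb" and j: "j \<in> J" and gt: "entry \<eta> (Suc j) < entry \<eta> j"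
    and \<tau>: "(- 1) ^ perm_length n \<tau>' = - ((- 1) ^ perm_length n \<tau> :: qt)"
  defines "x \<equiv> eig_ratio n \<eta> j"
  shows "coef \<eta> \<tau> = - ((1 - x / t) / (1 - x)) * coef (act (adj j) \<eta>) \<tau>'"
proof -
  let ?\<mu> = "act (adj j) \<eta>"
  note j' = J_range[OF j]
  have nz: "1 - x \<noteq> 0" "1 - x / t \<noteq> 0" using eig_ratio_gt_neq[OF j' gt, folded x_def] by auto
  have e: "d' n ?\<mu> = d' n \<eta> * (1 - x) / (1 - x / t)"
    using d'_act_adj[OF j' gt] nz by (simp add: x_def nonzero_eq_divide_eq)
  have generic: "s * m * (a * b * c / r) = - (k / y) * (- s * m * ((a * y / k) * b * c / r))"
    if "y \<noteq> 0" "k \<noteq> 0" for s m a b c r y k :: qt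
    using that by (simp add: divide_simps)
  show ?thesis
    unfolding coef_def M_act_J[OF \<eta> j] sort_along_act[OF J_sub adj_J[OF j]] \<tau> e
    by (rule generic[OF nz])
qed

definition S0 :: zpoly where
  "S0 = Const (1 / lead \<eta>m) * O_op n I J (E n \<eta>m)"

lemma zcoeff_S0: "zcoeff S0 \<eta>s = 1"
  using lead_\<eta>m_nonzero by (simp add: S0_def zcoeff_O_op_\<eta>m)

lemma O_op_E_\<eta>m: "O_op n I J (E n \<eta>m) = Const (lead \<eta>m) * S0"
  unfolding S0_def using lead_\<eta>m_nonzero by (simp flip: Const_mult mult.assoc)

lemma O_op_E:
  assumes "\<eta> \<in> orb" "J_perm \<eta> \<tau>"
  shows "O_op n I J (E n \<eta>) = Const (coef \<eta> \<tau>) * S0"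
proof -
  have "\<forall>\<tau>. J_perm \<eta> \<tau> \<longrightarrow> O_op n I J (E n \<eta>) = Const (coef \<eta> \<tau>) * S0"
    using assms(1)
  proof (rule par_orbit_induct[OF IJ_sub, where up = True], fold \<eta>m_def)
    show "\<forall>\<tau>. J_perm \<eta>m \<tau> \<longrightarrow> O_op n I J (E n \<eta>m) = Const (coef \<eta>m \<tau>) * S0"
      using O_op_E_\<eta>m coef_\<eta>m by simp
  next
    fix \<mu> i
    let ?\<eta> = "act (adj i) \<mu>"
    assume \<mu>: "\<mu> \<in> orb" and i: "i \<in> K"
      and IH: "\<forall>\<tau>. J_perm \<mu> \<tau> \<longrightarrow> O_op n I J (E n \<mu>) = Const (coef \<mu> \<tau>) * S0"
      and "if True then entry \<mu> i < entry \<mu> (Suc i) else entry \<mu> (Suc i) < entry \<mu> i"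
    then have gt: "entry ?\<eta> (Suc i) < entry ?\<eta> i" by simp
    have \<eta>: "?\<eta> \<in> orb" by (rule orb_adj[OF \<mu> i])
    show "\<forall>\<tau>. J_perm ?\<eta> \<tau> \<longrightarrow> O_op n I J (E n ?\<eta>) = Const (coef ?\<eta> \<tau>) * S0"
    proof (intro allI impI)
      fix \<tau> assume \<tau>: "J_perm ?\<eta> \<tau>"
      show "O_op n I J (E n ?\<eta>) = Const (coef ?\<eta> \<tau>) * S0"
      proof (cases "i \<in> I")
        case True
        have "O_op n I J (E n \<mu>) = Const (coef \<mu> \<tau>) * S0"
          using IH J_perm_act_I[OF True \<tau>] by blast
        then show ?thesis
          unfolding O_op_E_raise_I[OF \<eta> True gt] coef_raise_I[OF \<eta> True gt] act_adj_adj
          by (simp only: Const_mult mult.assoc)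
      next
        case False
        then have j: "i \<in> J" using i by blast
        note \<tau>' = J_perm_act_J[OF j \<tau>]
        have "O_op n I J (E n \<mu>) = Const (coef \<mu> (adj i \<circ> \<tau>)) * S0"
          using IH \<tau>'(1) by blast
        then show ?thesis
          unfolding O_op_E_raise_J[OF \<eta> j gt] coef_raise_J[OF \<eta> j gt \<tau>'(2)] act_adj_adj
          by (simp only: Const_mult mult.assoc)
      qed
    qed
  qed
  then show ?thesis using assms(2) by blast
qed

lemma S_poly_eq: "S_poly n I J \<eta>s = S0"
  unfolding S_poly_def
proof (rule the_equality)
  have "\<exists>a. a \<noteq> 0 \<and> O_op n I J (E n \<eta>) = Const a * S0" if "\<eta> \<in> orb" for \<eta>
    using J_perm_exists[of \<eta>] O_op_E[OF that] coef_nonzero[OF that] by blast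
  then show "zcoeff S0 \<eta>s = 1 \<and> (\<forall>\<eta>\<in>orb. \<exists>a. a \<noteq> 0 \<and> O_op n I J (E n \<eta>) = Const a * S0)"
    using zcoeff_S0 by blast
  fix S assume S: "zcoeff S \<eta>s = 1 \<and> (\<forall>\<eta>\<in>orb. \<exists>a. a \<noteq> 0 \<and> O_op n I J (E n \<eta>) = Const a * S)"
  then obtain a where a: "a \<noteq> 0" "Const (lead \<eta>m) * S0 = Const a * S"
    using \<eta>m_orb O_op_E_\<eta>m by metis
  \<comment> \<open>The normalisation at \<open>\<eta>s\<close> fixes the scalar.\<close>
  have "lead \<eta>m = a"
    using arg_cong[OF a(2), of "\<lambda>f. zcoeff f \<eta>s"] S zcoeff_S0 by simp
  then show "S = S0" using a by simp
qed

lemma sym_const_eq: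
  assumes "\<eta> \<in> orb" "J_perm \<eta> \<tau>"
  shows "sym_const n I J \<eta>s \<eta> = coef \<eta> \<tau>"
  unfolding sym_const_def S_poly_eq O_op_E[OF assms]
proof (rule the_equality)
  fix a assume "Const (coef \<eta> \<tau>) * S0 = Const a * S0"
  then have "zcoeff (Const (coef \<eta> \<tau>) * S0) \<eta>s = zcoeff (Const a * S0) \<eta>s" by (simp only:)
  then show "a = coef \<eta> \<tau>" by (simp add: zcoeff_S0)
qed simp

text \<open>The rearrangement along I commutes with W_J and can be cancelled on both sides.\<close>

lemma J_permI:
  assumes "\<tau> \<in> parabolic n J" "act \<tau> (sort_J False (sort_I False \<eta>)) = sort_I False \<eta>"
  shows "J_perm \<eta> \<tau>"
proof -
  obtain \<rho> where \<rho>: "\<rho> \<in> parabolic n I" "sort_I False \<eta> = act \<rho> \<eta>"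
    using sort_along(1)[OF I_sub, of False \<eta>] unfolding par_orbit_def by blast
  note p = parabolicD(1)[OF I_sub \<rho>(1)]
  have "act \<rho> (act \<tau> (sort_J False \<eta>)) = act \<tau> (act \<rho> (sort_J False \<eta>))"
    using act_comp_parabolic[OF I_sub \<rho>(1) parabolicD(1)[OF J_sub assms(1)]]
      act_comp_parabolic[OF J_sub assms(1) p] parabolic_commute[OF \<rho>(1) assms(1)] by metis
  also have "\<dots> = act \<rho> \<eta>"
    using assms(2) by (simp add: \<rho>(2) sort_J_I_act[OF \<rho>(1)])
  finally have "act \<tau> (sort_J False \<eta>) = \<eta>" by (metis act_inv_act[OF p])
  then show ?thesis using assms(1) by (simp add: J_perm_def)
qed

end

theorem proposition3:
  fixes n :: nat and I J :: "nat set" and \<eta>s \<eta> :: exponent and \<omega>J :: "nat \<Rightarrow> nat"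
  assumes "n \<ge> 1"
    and "admissible n I J"
    and "is_composition n \<eta>s"
    and "\<forall>i\<in>I. entry \<eta>s i \<ge> entry \<eta>s (i + 1)"
    and "\<forall>j\<in>J. entry \<eta>s j > entry \<eta>s (j + 1)"
    and "\<eta> \<in> par_orbit n (I \<union> J) \<eta>s"
    and "\<omega>J \<in> parabolic n J"
    and "act \<omega>J (arrange n I J \<eta> Pl Pl) = arrange n I J \<eta> Pl Ze"
  shows "O_op n I J (E n \<eta>) = Const (sym_const n I J \<eta>s \<eta>) * S_poly n I J \<eta>s \<and>
    sym_const n I J \<eta>s \<eta> =
      (- 1) ^ perm_length n \<omega>J * M n I J \<eta> *
        ((d' n \<eta> * d' n (arrange n I J \<eta> Mi Pl) * d n (arrange n I J \<eta> Mi Pl)) /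
         (d' n (arrange n I J \<eta> Ze Pl) * d n (arrange n I J \<eta> Ze Pl) * d' n (arrange n I J \<eta> Mi Mi)))"
proof -
  interpret prescribed_symmetry n I J \<eta>s
    by unfold_locales (fact assms)+
  note \<eta> = assms(6)
  have J: "J_perm \<eta> \<omega>J"
    by (rule J_permI[OF assms(7)]) (use assms(8) in \<open>simp add: arrange_eq[OF \<eta>]\<close>)
  show ?thesis
    \<comment> \<open>The arrangements (-,+) and (-,-) of \<open>\<eta>\<close> are replaced by
      those of \<open>\<eta>s\<close>, the form used in \<open>coef\<close>.\<close>
    unfolding sym_const_eq[OF \<eta> J] S_poly_eq arrange_eq[OF \<eta>] sort_J_sort_I[OF \<eta>, of False]
      sort_J_sort_I_True[OF \<eta>]
    using O_op_E[OF \<eta> J] by (simp only: coef_def)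
qed

end
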